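(* Let $L/K$ be a finite Galois extension with Galois group $G$, and let $X$ be a topological space. For any $\mathcal{F}\in\mathrm{Mod}(L_X)$ equipped with a $G$-structure $(\varphi_g)_{g\in G}$, there exist a sheaf $\mathcal{G}\in\mathrm{Mod}(K_X)$ and a natural isomorphism $\psi\colon L_X\otimes_{K_X}\mathcal{G}\overset{\sim}{\to}\mathcal{F}$ in $\mathrm{Mod}(L_X)$ such that the natural $G$-structure on $L_X\otimes_{K_X}\mathcal{G}$ corresponds via $\psi$ to the given one on $\mathcal{F}$, i.e. for every $g\in G$ $$\varphi_g\circ\psi=\overline{\psi}^g\circ(g\otimes\mathrm{id}_{\mathcal{G}})\colon L_X\otimes_{K_X}\mathcal{G}\to\overline{\mathcal{F}}^g .$$ In particular, the functor $\Phi_{L/K}=L_X\otimes_{K_X}(-)$ induces an equivalence of categories $$\Phi_{L/K}^G\colon \mathrm{Mod}(K_X)\to\mathrm{Mod}(L_X)^G,\qquad \mathcal{G}\mapsto\big(L_X\otimes_{K_X}\mathcal{G},(g\otimes\mathrm{id}_{\mathcal{G}})_{g\in G}\big).$$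
   Context: All topological spaces are assumed good: Hausdorff, locally compact, second countable and of finite cohomological dimension. For a field $k$, $k_X$ is the constant sheaf and $\mathrm{Mod}(k_X)$ the category of sheaves of $k$-vector spaces on $X$. For $g\in G$ and an $L$-vector space $V$, $\overline{V}^g$ is the $K$-vector space $V$ with $L$-action $\ell\cdot v:=g(\ell)v$. For $\mathcal{F}\in\mathrm{Mod}(L_X)$, $\overline{\mathcal{F}}^g$ is the sheaf $U\mapsto\overline{\mathcal{F}(U)}^g$ (on morphisms, the same underlying maps); one has $\overline{\overline{\mathcal{F}}^g}^h=\overline{\mathcal{F}}^{gh}$. A $G$-structure on $\mathcal{F}$ is a family of isomorphisms $\varphi_g\colon\mathcal{F}\to\overline{\mathcal{F}}^g$ ($g\in G$) in $\mathrm{Mod}(L_X)$ with $\varphi_{gh}=\overline{\varphi_g}^h\circ\varphi_h$ for all $g,h\in G$. $\mathrm{Mod}(L_X)^G$ is the category of pairs $(\mathcal{F},(\varphi_g)_{g\in G})$; a morphism $(\mathcal{F},(\varphi_g))\to(\mathcal{F}',(\varphi'_g))$ is a morphism $f\colon\mathcal{F}\to\mathcal{F}'$ with $\varphi'_g\circ f=\overline{f}^g\circ\varphi_g$ for all $g\in G$. For $\mathcal{G}\in\mathrm{Mod}(K_X)$, $L_X\otimes_{K_X}\mathcal{G}$ is the sheafification of $U\mapsto L\otimes_K\mathcal{G}(U)$, with $L$ acting on the first factor. Its natural $G$-structure is $g\otimes\mathrm{id}_{\mathcal{G}}\colon L_X\otimes_{K_X}\mathcal{G}\to\overline{L_X}^g\otimes_{K_X}\mathcal{G}=\overline{L_X\otimes_{K_X}\mathcal{G}}^g$,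 where $g\colon L_X\to\overline{L_X}^g$ is induced by $\ell\mapsto g(\ell)$. *)

theory Defs
  imports
    "HOL-Analysis.Abstract_Topological_Spaces"
    "HOL-Algebra.Free_Abelian_Groups"
    "HOL-Algebra.Embedded_Algebras"
    "HOL-Algebra.IntRing"
begin

section \<open>Finite Galois extensions\<close>

text \<open>The group law of the Galois group is \<open>gh = compose (carrier L) g h\<close>, i.e. \<open>g \<circ> h\<close>; automorphisms
  are extensional functions, so that equal automorphisms are equal functions.\<close>

definition galois_group :: "('l, 'm) ring_scheme \<Rightarrow> 'l set \<Rightarrow> ('l \<Rightarrow> 'l) set" where
  "galois_group L K = {g \<in> ring_iso L L \<inter> extensional (carrier L). \<forall>k\<in>K. g k = k}"

text \<open>Bourbaki's definition of a Galois extension: algebraic (automatic in finite degree), with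
  \<open>K\<close> the field of invariants of the automorphisms of \<open>L\<close> over \<open>K\<close>.\<close>

definition finite_galois_extension :: "('l, 'm) ring_scheme \<Rightarrow> 'l set \<Rightarrow> bool" where
  "finite_galois_extension L K \<longleftrightarrow>
     field L \<and> subfield K L \<and> ring.finite_dimension L K (carrier L) \<and>
     {x \<in> carrier L. \<forall>g\<in>galois_group L K. g x = x} = K"

section \<open>Sheaves of modules\<close>

definition linear_maps ::
    "('l, 'm) ring_scheme \<Rightarrow> ('l, 'v) module \<Rightarrow> ('l, 'w) module \<Rightarrow> ('v \<Rightarrow> 'w) set" where
  "linear_maps R M N = {f \<in> hom (add_monoid M) (add_monoid N).
     \<forall>a\<in>carrier R. \<forall>v\<in>carrier M. f (a \<odot>\<^bsub>M\<^esub> v) = a \<odot>\<^bsub>N\<^esub> f v}"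

record ('l, 'x, 'v) sheaf_data =
  sec :: "'x set \<Rightarrow> ('l, 'v) module"
  res :: "'x set \<Rightarrow> 'x set \<Rightarrow> 'v \<Rightarrow> 'v" \<comment> \<open>\<open>res F U V\<close> restricts from \<open>U\<close> to \<open>V\<close>, for \<open>V \<subseteq> U\<close>\<close>

definition presheaf ::
    "('l, 'm) ring_scheme \<Rightarrow> 'x topology \<Rightarrow> ('l, 'x, 'v) sheaf_data \<Rightarrow> bool" where
  "presheaf R X F \<longleftrightarrow>
     (\<forall>U. openin X U \<longrightarrow> Module.module R (sec F U)) \<and>
     (\<forall>U V. openin X U \<and> openin X V \<and> V \<subseteq> U \<longrightarrow> res F U V \<in> linear_maps R (sec F U) (sec F V)) \<and>
     (\<forall>U. openin X U \<longrightarrow> (\<forall>s\<in>carrier (sec F U). res F U U s = s)) \<and>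
     (\<forall>U V W. openin X U \<and> openin X V \<and> openin X W \<and> W \<subseteq> V \<and> V \<subseteq> U \<longrightarrow>
        (\<forall>s\<in>carrier (sec F U). res F V W (res F U V s) = res F U W s))"

definition sheaf ::
    "('l, 'm) ring_scheme \<Rightarrow> 'x topology \<Rightarrow> ('l, 'x, 'v) sheaf_data \<Rightarrow> bool" where
  "sheaf R X F \<longleftrightarrow> presheaf R X F \<and>
     (\<forall>\<U>. (\<forall>U\<in>\<U>. openin X U) \<longrightarrow>
        (\<forall>s\<in>carrier (sec F (\<Union>\<U>)). \<forall>t\<in>carrier (sec F (\<Union>\<U>)).
           (\<forall>U\<in>\<U>. res F (\<Union>\<U>) U s = res F (\<Union>\<U>) U t) \<longrightarrow> s = t) \<and>
        (\<forall>\<sigma>. (\<forall>U\<in>\<U>. \<sigma> U \<in> carrier (sec F U)) \<and>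
             (\<forall>U\<in>\<U>. \<forall>V\<in>\<U>. res F U (U \<inter> V) (\<sigma> U) = res F V (U \<inter> V) (\<sigma> V)) \<longrightarrow>
           (\<exists>s\<in>carrier (sec F (\<Union>\<U>)). \<forall>U\<in>\<U>. res F (\<Union>\<U>) U s = \<sigma> U)))"

text \<open>A morphism is a family of maps indexed by the open sets. Both the family and its members are
  extensional, so that equality of morphisms is equality in HOL.\<close>

definition sheaf_hom ::
    "('l, 'm) ring_scheme \<Rightarrow> 'x topology \<Rightarrow> ('l, 'x, 'v) sheaf_data \<Rightarrow> ('l, 'x, 'w) sheaf_data
      \<Rightarrow> ('x set \<Rightarrow> 'v \<Rightarrow> 'w) set" where
  "sheaf_hom R X F F' = {f \<in> extensional {U. openin X U}.
     (\<forall>U. openin X U \<longrightarrow>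
        f U \<in> linear_maps R (sec F U) (sec F' U) \<inter> extensional (carrier (sec F U))) \<and>
     (\<forall>U V. openin X U \<and> openin X V \<and> V \<subseteq> U \<longrightarrow>
        (\<forall>s\<in>carrier (sec F U). f V (res F U V s) = res F' U V (f U s)))}"

definition sheaf_id :: "'x topology \<Rightarrow> ('l, 'x, 'v) sheaf_data \<Rightarrow> 'x set \<Rightarrow> 'v \<Rightarrow> 'v" where
  "sheaf_id X F = (\<lambda>U\<in>{U. openin X U}. \<lambda>s\<in>carrier (sec F U). s)"

text \<open>The composite \<open>g \<circ> f\<close> of morphisms where \<open>F\<close> is the domain of \<open>f\<close>.\<close>

definition sheaf_comp ::
    "'x topology \<Rightarrow> ('l, 'x, 'u) sheaf_data \<Rightarrow> ('x set \<Rightarrow> 'v \<Rightarrow> 'w) \<Rightarrow> ('x set \<Rightarrow> 'u \<Rightarrow> 'v)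
      \<Rightarrow> 'x set \<Rightarrow> 'u \<Rightarrow> 'w" where
  "sheaf_comp X F g f = (\<lambda>U\<in>{U. openin X U}. compose (carrier (sec F U)) (g U) (f U))"

definition sheaf_iso ::
    "('l, 'm) ring_scheme \<Rightarrow> 'x topology \<Rightarrow> ('l, 'x, 'v) sheaf_data \<Rightarrow> ('l, 'x, 'w) sheaf_data
      \<Rightarrow> ('x set \<Rightarrow> 'v \<Rightarrow> 'w) set" where
  "sheaf_iso R X F F' = {f \<in> sheaf_hom R X F F'. \<exists>f'\<in>sheaf_hom R X F' F.
     sheaf_comp X F f' f = sheaf_id X F \<and> sheaf_comp X F' f f' = sheaf_id X F'}"

section \<open>Good topological spaces\<close>

definition flabby :: "'x topology \<Rightarrow> ('l, 'x, 'v) sheaf_data \<Rightarrow> bool" where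
  "flabby X F \<longleftrightarrow> (\<forall>U. openin X U \<longrightarrow>
     (\<forall>s\<in>carrier (sec F U). \<exists>t\<in>carrier (sec F (topspace X)). res F (topspace X) U t = s))"

definition sheaf_exact ::
    "'x topology \<Rightarrow> ('l, 'x, 'u) sheaf_data \<Rightarrow> ('l, 'x, 'v) sheaf_data \<Rightarrow> ('l, 'x, 'w) sheaf_data
      \<Rightarrow> ('x set \<Rightarrow> 'u \<Rightarrow> 'v) \<Rightarrow> ('x set \<Rightarrow> 'v \<Rightarrow> 'w) \<Rightarrow> bool" where
  "sheaf_exact X A B C f g \<longleftrightarrow> (\<forall>U. openin X U \<longrightarrow> (\<forall>s\<in>carrier (sec B U).
     g U s = \<zero>\<^bsub>sec C U\<^esub> \<longleftrightarrow>
     (\<forall>x\<in>U. \<exists>V. openin X V \<and> x \<in> V \<and> V \<subseteq> U \<and> (\<exists>t\<in>carrier (sec A V). f V t = res B U V s))))"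

definition flabby_resolution ::
    "'x topology \<Rightarrow> (int, 'x, 'v) sheaf_data \<Rightarrow> ('x set \<Rightarrow> 'v \<Rightarrow> 'v)
      \<Rightarrow> (nat \<Rightarrow> (int, 'x, 'v) sheaf_data) \<Rightarrow> (nat \<Rightarrow> 'x set \<Rightarrow> 'v \<Rightarrow> 'v) \<Rightarrow> bool" where
  "flabby_resolution X F \<iota> I d \<longleftrightarrow>
     (\<forall>j. sheaf int_ring X (I j) \<and> flabby X (I j) \<and> d j \<in> sheaf_hom int_ring X (I j) (I (Suc j))) \<and>
     \<iota> \<in> sheaf_hom int_ring X F (I 0) \<and>
     (\<forall>U. openin X U \<longrightarrow> inj_on (\<iota> U) (carrier (sec F U))) \<and>
     sheaf_exact X F (I 0) (I 1) \<iota> (d 0) \<and>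
     (\<forall>j. sheaf_exact X (I j) (I (Suc j)) (I (Suc (Suc j))) (d j) (d (Suc j)))"

text \<open>There is \<open>n\<close> with \<open>H\<^sup>i(X; F) = 0\<close> for all \<open>i > n\<close> and all sheaves \<open>F\<close> of abelian groups, cohomology
  being computed by flabby resolutions. The index \<open>i = Suc j\<close> is at least 1, so exactness of the
  complex of global sections at \<open>I (Suc j)\<close> is the vanishing of the cohomology in that degree.
  Sections range over the type \<open>'v\<close>.\<close>

definition finite_cohomological_dimension :: "'v itself \<Rightarrow> 'x topology \<Rightarrow> bool" where
  "finite_cohomological_dimension _ X \<longleftrightarrow> (\<exists>n. \<forall>(F :: (int, 'x, 'v) sheaf_data) \<iota> I d.
     sheaf int_ring X F \<and> flabby_resolution X F \<iota> I d \<longrightarrow>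
     (\<forall>j\<ge>n. \<forall>s\<in>carrier (sec (I (Suc j)) (topspace X)).
        d (Suc j) (topspace X) s = \<zero>\<^bsub>sec (I (Suc (Suc j))) (topspace X)\<^esub> \<longrightarrow>
        (\<exists>t\<in>carrier (sec (I j) (topspace X)). d j (topspace X) t = s)))"

definition good_space :: "'v itself \<Rightarrow> 'x topology \<Rightarrow> bool" where
  "good_space TYPE_v X \<longleftrightarrow> Hausdorff_space X \<and> locally_compact_space X \<and> second_countable X \<and>
     finite_cohomological_dimension TYPE_v X"

section \<open>Categories\<close>

record ('o, 'm) cat =
  ob :: "'o set"
  mor :: "'o \<Rightarrow> 'o \<Rightarrow> 'm set"
  ident :: "'o \<Rightarrow> 'm"
  cmp :: "'o \<Rightarrow> 'o \<Rightarrow> 'o \<Rightarrow> 'm \<Rightarrow> 'm \<Rightarrow> 'm" \<comment> \<open>\<open>cmp C a b c g f\<close> is \<open>g \<circ> f\<close> for \<open>f: a \<rightarrow> b\<close>, \<open>g: b \<rightarrow> c\<close>\<close>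

definition is_category :: "('o, 'm) cat \<Rightarrow> bool" where
  "is_category C \<longleftrightarrow>
     (\<forall>a\<in>ob C. ident C a \<in> mor C a a) \<and>
     (\<forall>a\<in>ob C. \<forall>b\<in>ob C. \<forall>c\<in>ob C. \<forall>f\<in>mor C a b. \<forall>g\<in>mor C b c. cmp C a b c g f \<in> mor C a c) \<and>
     (\<forall>a\<in>ob C. \<forall>b\<in>ob C. \<forall>f\<in>mor C a b.
        cmp C a a b f (ident C a) = f \<and> cmp C a b b (ident C b) f = f) \<and>
     (\<forall>a\<in>ob C. \<forall>b\<in>ob C. \<forall>c\<in>ob C. \<forall>d\<in>ob C. \<forall>f\<in>mor C a b. \<forall>g\<in>mor C b c. \<forall>h\<in>mor C c d.
        cmp C a c d h (cmp C a b c g f) = cmp C a b d (cmp C b c d h g) f)"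

definition is_functor ::
    "('o, 'm) cat \<Rightarrow> ('p, 'n) cat \<Rightarrow> ('o \<Rightarrow> 'p) \<Rightarrow> ('o \<Rightarrow> 'o \<Rightarrow> 'm \<Rightarrow> 'n) \<Rightarrow> bool" where
  "is_functor C D Fo Fm \<longleftrightarrow>
     (\<forall>a\<in>ob C. Fo a \<in> ob D \<and> Fm a a (ident C a) = ident D (Fo a)) \<and>
     (\<forall>a\<in>ob C. \<forall>b\<in>ob C. \<forall>f\<in>mor C a b. Fm a b f \<in> mor D (Fo a) (Fo b)) \<and>
     (\<forall>a\<in>ob C. \<forall>b\<in>ob C. \<forall>c\<in>ob C. \<forall>f\<in>mor C a b. \<forall>g\<in>mor C b c.
        Fm a c (cmp C a b c g f) = cmp D (Fo a) (Fo b) (Fo c) (Fm b c g) (Fm a b f))"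

definition is_isomorphism :: "('o, 'm) cat \<Rightarrow> 'o \<Rightarrow> 'o \<Rightarrow> 'm \<Rightarrow> bool" where
  "is_isomorphism C a b f \<longleftrightarrow> f \<in> mor C a b \<and>
     (\<exists>g\<in>mor C b a. cmp C a b a g f = ident C a \<and> cmp C b a b f g = ident C b)"

definition natural_isomorphism ::
    "('o, 'm) cat \<Rightarrow> ('p, 'n) cat \<Rightarrow> ('o \<Rightarrow> 'p) \<Rightarrow> ('o \<Rightarrow> 'o \<Rightarrow> 'm \<Rightarrow> 'n)
      \<Rightarrow> ('o \<Rightarrow> 'p) \<Rightarrow> ('o \<Rightarrow> 'o \<Rightarrow> 'm \<Rightarrow> 'n) \<Rightarrow> ('o \<Rightarrow> 'n) \<Rightarrow> bool" where
  "natural_isomorphism C D Fo Fm Go Gm \<eta> \<longleftrightarrow>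
     (\<forall>a\<in>ob C. is_isomorphism D (Fo a) (Go a) (\<eta> a)) \<and>
     (\<forall>a\<in>ob C. \<forall>b\<in>ob C. \<forall>f\<in>mor C a b.
        cmp D (Fo a) (Fo b) (Go b) (\<eta> b) (Fm a b f) = cmp D (Fo a) (Go a) (Go b) (Gm a b f) (\<eta> a))"

definition equivalence_of_categories ::
    "('o, 'm) cat \<Rightarrow> ('p, 'n) cat \<Rightarrow> ('o \<Rightarrow> 'p) \<Rightarrow> ('o \<Rightarrow> 'o \<Rightarrow> 'm \<Rightarrow> 'n) \<Rightarrow> bool" where
  "equivalence_of_categories C D Fo Fm \<longleftrightarrow>
     is_category C \<and> is_category D \<and> is_functor C D Fo Fm \<and>
     (\<exists>Go Gm \<eta> \<epsilon>. is_functor D C Go Gm \<and>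
        natural_isomorphism C C (\<lambda>a. a) (\<lambda>a b f. f)
          (\<lambda>a. Go (Fo a)) (\<lambda>a b f. Gm (Fo a) (Fo b) (Fm a b f)) \<eta> \<and>
        natural_isomorphism D D (\<lambda>a. Fo (Go a)) (\<lambda>a b f. Fm (Go a) (Go b) (Gm a b f))
          (\<lambda>a. a) (\<lambda>a b f. f) \<epsilon>)"

section \<open>Conjugation and \<open>G\<close>-structures\<close>

definition twist :: "('l \<Rightarrow> 'l) \<Rightarrow> ('l, 'x, 'v) sheaf_data \<Rightarrow> ('l, 'x, 'v) sheaf_data" where
  "twist g F = F\<lparr>sec := \<lambda>U. (sec F U)\<lparr>smult := \<lambda>a v. g a \<odot>\<^bsub>sec F U\<^esub> v\<rparr>\<rparr>"

text \<open>Conjugation leaves the underlying maps of a morphism unchanged.\<close>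

definition twist_mor :: "('l \<Rightarrow> 'l) \<Rightarrow> ('x set \<Rightarrow> 'v \<Rightarrow> 'w) \<Rightarrow> 'x set \<Rightarrow> 'v \<Rightarrow> 'w" where
  "twist_mor g f = f"

definition G_structure ::
    "('l, 'm) ring_scheme \<Rightarrow> 'l set \<Rightarrow> 'x topology \<Rightarrow> ('l, 'x, 'v) sheaf_data
      \<Rightarrow> (('l \<Rightarrow> 'l) \<Rightarrow> 'x set \<Rightarrow> 'v \<Rightarrow> 'v) \<Rightarrow> bool" where
  "G_structure L K X F \<phi> \<longleftrightarrow>
     (\<forall>g\<in>galois_group L K. \<phi> g \<in> sheaf_iso L X F (twist g F)) \<and>
     (\<forall>g\<in>galois_group L K. \<forall>h\<in>galois_group L K.
        \<phi> (compose (carrier L) g h) = sheaf_comp X F (twist_mor h (\<phi> g)) (\<phi> h))"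

text \<open>\<open>ShMod R X\<close> is the category of sheaves of \<open>R\<close>-modules on \<open>X\<close> with sections in \<open>'v\<close>; the base field \<open>K\<close>
  enters as \<open>R = L\<lparr>carrier := K\<rparr>\<close>. \<open>ShModG\<close> consists of the sheaves over \<open>L\<close> with a \<open>G\<close>-structure.\<close>

definition ShMod ::
    "('l, 'm) ring_scheme \<Rightarrow> 'x topology \<Rightarrow> (('l, 'x, 'v) sheaf_data, 'x set \<Rightarrow> 'v \<Rightarrow> 'v) cat" where
  "ShMod R X = \<lparr>ob = {F. sheaf R X F}, mor = sheaf_hom R X, ident = sheaf_id X,
     cmp = \<lambda>F F' F''. sheaf_comp X F\<rparr>"

definition ShModG ::
    "('l, 'm) ring_scheme \<Rightarrow> 'l set \<Rightarrow> 'x topology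
      \<Rightarrow> (('l, 'x, 'v) sheaf_data \<times> (('l \<Rightarrow> 'l) \<Rightarrow> 'x set \<Rightarrow> 'v \<Rightarrow> 'v), 'x set \<Rightarrow> 'v \<Rightarrow> 'v) cat" where
  "ShModG L K X = \<lparr>ob = {(F, \<phi>). sheaf L X F \<and> G_structure L K X F \<phi>},
     mor = \<lambda>(F, \<phi>) (F', \<phi>'). {f \<in> sheaf_hom L X F F'. \<forall>g\<in>galois_group L K.
       sheaf_comp X F (\<phi>' g) f = sheaf_comp X F (twist_mor g f) (\<phi> g)},
     ident = \<lambda>(F, \<phi>). sheaf_id X F,
     cmp = \<lambda>(F, \<phi>) F' F''. sheaf_comp X F\<rparr>"

section \<open>Tensor products of vector spaces\<close>

text \<open>\<open>L \<otimes>\<^sub>K V\<close> is the free abelian group on \<open>L \<times> V\<close> modulo the usual relations; its elements are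
  cosets of formal sums.\<close>

definition tensor_free ::
    "('l, 'm) ring_scheme \<Rightarrow> ('l, 'v) module \<Rightarrow> (('l \<times> 'v) \<Rightarrow>\<^sub>0 int) monoid" where
  "tensor_free L V = free_Abelian_group (carrier L \<times> carrier V)"

definition tensor_rel ::
    "('l, 'm) ring_scheme \<Rightarrow> 'l set \<Rightarrow> ('l, 'v) module \<Rightarrow> (('l \<times> 'v) \<Rightarrow>\<^sub>0 int) set" where
  "tensor_rel L K V = generate (tensor_free L V)
    ({frag_of (a \<oplus>\<^bsub>L\<^esub> b, v) - frag_of (a, v) - frag_of (b, v) |a b v.
        a \<in> carrier L \<and> b \<in> carrier L \<and> v \<in> carrier V} \<union>
     {frag_of (a, v \<oplus>\<^bsub>V\<^esub> w) - frag_of (a, v) - frag_of (a, w) |a v w.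
        a \<in> carrier L \<and> v \<in> carrier V \<and> w \<in> carrier V} \<union>
     {frag_of (a \<otimes>\<^bsub>L\<^esub> k, v) - frag_of (a, k \<odot>\<^bsub>V\<^esub> v) |a k v.
        a \<in> carrier L \<and> k \<in> K \<and> v \<in> carrier V})"

text \<open>The map \<open>\<alpha> \<otimes> r\<close> into \<open>L \<otimes>\<^sub>K W\<close>, on cosets \<open>C\<close>; for well-defined \<open>\<alpha> \<otimes> r\<close> all \<open>c \<in> C\<close> contribute
  the same coset to the union.\<close>

definition tensor_map ::
    "('l, 'm) ring_scheme \<Rightarrow> 'l set \<Rightarrow> ('l, 'w) module \<Rightarrow> ('l \<Rightarrow> 'l) \<Rightarrow> ('v \<Rightarrow> 'w)
      \<Rightarrow> (('l \<times> 'v) \<Rightarrow>\<^sub>0 int) set \<Rightarrow> (('l \<times> 'w) \<Rightarrow>\<^sub>0 int) set" where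
  "tensor_map L K W \<alpha> r C =
     (\<Union>c\<in>C. tensor_rel L K W #>\<^bsub>tensor_free L W\<^esub> frag_extend (\<lambda>(l, v). frag_of (\<alpha> l, r v)) c)"

text \<open>The fields \<open>mult\<close> and \<open>one\<close> of a \<open>module\<close> record are irrelevant to the module structure.\<close>

definition tensor ::
    "('l, 'm) ring_scheme \<Rightarrow> 'l set \<Rightarrow> ('l, 'v) module \<Rightarrow> ('l, (('l \<times> 'v) \<Rightarrow>\<^sub>0 int) set) module" where
  "tensor L K V = (let Q = tensor_free L V Mod tensor_rel L K V in
     \<lparr>carrier = carrier Q, monoid.mult = undefined, one = undefined, zero = one Q, add = monoid.mult Q,
      smult = \<lambda>a. tensor_map L K V (\<lambda>l. a \<otimes>\<^bsub>L\<^esub> l) (\<lambda>v. v)\<rparr>)"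

section \<open>Sheafification\<close>

definition germ ::
    "'x topology \<Rightarrow> ('l, 'x, 'v) sheaf_data \<Rightarrow> 'x \<Rightarrow> 'x set \<Rightarrow> 'v \<Rightarrow> ('x set \<times> 'v) set" where
  "germ X P x U s = {(V, t). openin X V \<and> x \<in> V \<and> t \<in> carrier (sec P V) \<and>
     (\<exists>W. openin X W \<and> x \<in> W \<and> W \<subseteq> U \<inter> V \<and> res P U W s = res P V W t)}"

definition stalk ::
    "'x topology \<Rightarrow> ('l, 'x, 'v) sheaf_data \<Rightarrow> 'x \<Rightarrow> ('l, ('x set \<times> 'v) set) module" where
  "stalk X P x =
    \<lparr>carrier = {germ X P x U s |U s. openin X U \<and> x \<in> U \<and> s \<in> carrier (sec P U)},
     monoid.mult = undefined, one = undefined,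
     zero = germ X P x (topspace X) \<zero>\<^bsub>sec P (topspace X)\<^esub>,
     add = \<lambda>A B. THE C. \<exists>U s t. openin X U \<and> x \<in> U \<and> s \<in> carrier (sec P U) \<and> t \<in> carrier (sec P U) \<and>
       A = germ X P x U s \<and> B = germ X P x U t \<and> C = germ X P x U (s \<oplus>\<^bsub>sec P U\<^esub> t),
     smult = \<lambda>a A. THE C. \<exists>U s. openin X U \<and> x \<in> U \<and> s \<in> carrier (sec P U) \<and>
       A = germ X P x U s \<and> C = germ X P x U (a \<odot>\<^bsub>sec P U\<^esub> s)\<rparr>"

definition sheafify ::
    "'x topology \<Rightarrow> ('l, 'x, 'v) sheaf_data \<Rightarrow> ('l, 'x, 'x \<Rightarrow> ('x set \<times> 'v) set) sheaf_data" where
  "sheafify X P =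
    \<lparr>sec = \<lambda>U.
      \<lparr>carrier = {\<sigma> \<in> extensional U. \<forall>x\<in>U. \<exists>V t. openin X V \<and> x \<in> V \<and> V \<subseteq> U \<and>
         t \<in> carrier (sec P V) \<and> (\<forall>y\<in>V. \<sigma> y = germ X P y V t)},
       monoid.mult = undefined, one = undefined,
       zero = \<lambda>x\<in>U. \<zero>\<^bsub>stalk X P x\<^esub>,
       add = \<lambda>\<sigma> \<tau>. \<lambda>x\<in>U. \<sigma> x \<oplus>\<^bsub>stalk X P x\<^esub> \<tau> x,
       smult = \<lambda>a \<sigma>. \<lambda>x\<in>U. a \<odot>\<^bsub>stalk X P x\<^esub> \<sigma> x\<rparr>,
     res = \<lambda>U V \<sigma>. restrict \<sigma> V\<rparr>"

definition stalk_map ::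
    "'x topology \<Rightarrow> ('l, 'x, 'v) sheaf_data \<Rightarrow> ('l, 'x, 'w) sheaf_data \<Rightarrow> ('x set \<Rightarrow> 'v \<Rightarrow> 'w)
      \<Rightarrow> 'x \<Rightarrow> ('x set \<times> 'v) set \<Rightarrow> ('x set \<times> 'w) set" where
  "stalk_map X P P' f x A = (THE C. \<exists>U s. openin X U \<and> x \<in> U \<and> s \<in> carrier (sec P U) \<and>
     A = germ X P x U s \<and> C = germ X P' x U (f U s))"

definition sheafify_map ::
    "'x topology \<Rightarrow> ('l, 'x, 'v) sheaf_data \<Rightarrow> ('l, 'x, 'w) sheaf_data \<Rightarrow> ('x set \<Rightarrow> 'v \<Rightarrow> 'w)
      \<Rightarrow> 'x set \<Rightarrow> ('x \<Rightarrow> ('x set \<times> 'v) set) \<Rightarrow> ('x \<Rightarrow> ('x set \<times> 'w) set)" where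
  "sheafify_map X P P' f = (\<lambda>U\<in>{U. openin X U}. \<lambda>\<sigma>\<in>carrier (sec (sheafify X P) U).
     \<lambda>x\<in>U. stalk_map X P P' f x (\<sigma> x))"

section \<open>Extension of scalars\<close>

type_synonym ('l, 'x, 'v) tensor_section = "'x \<Rightarrow> ('x set \<times> (('l \<times> 'v) \<Rightarrow>\<^sub>0 int) set) set"

definition pre_ext ::
    "('l, 'm) ring_scheme \<Rightarrow> 'l set \<Rightarrow> ('l, 'x, 'v) sheaf_data
      \<Rightarrow> ('l, 'x, (('l \<times> 'v) \<Rightarrow>\<^sub>0 int) set) sheaf_data" where
  "pre_ext L K G = \<lparr>sec = \<lambda>U. tensor L K (sec G U),
     res = \<lambda>U V. tensor_map L K (sec G V) (\<lambda>l. l) (res G U V)\<rparr>"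

definition ext ::
    "('l, 'm) ring_scheme \<Rightarrow> 'l set \<Rightarrow> 'x topology \<Rightarrow> ('l, 'x, 'v) sheaf_data
      \<Rightarrow> ('l, 'x, ('l, 'x, 'v) tensor_section) sheaf_data" where
  "ext L K X G = sheafify X (pre_ext L K G)"

definition ext_map ::
    "('l, 'm) ring_scheme \<Rightarrow> 'l set \<Rightarrow> 'x topology \<Rightarrow> ('l, 'x, 'v) sheaf_data \<Rightarrow> ('l, 'x, 'w) sheaf_data
      \<Rightarrow> ('x set \<Rightarrow> 'v \<Rightarrow> 'w)
      \<Rightarrow> 'x set \<Rightarrow> ('l, 'x, 'v) tensor_section \<Rightarrow> ('l, 'x, 'w) tensor_section" where
  "ext_map L K X G G' f = sheafify_map X (pre_ext L K G) (pre_ext L K G')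
     (\<lambda>U. tensor_map L K (sec G' U) (\<lambda>l. l) (f U))"

text \<open>The natural \<open>G\<close>-structure \<open>g \<otimes> id\<close>. Its target is the twist by \<open>g\<close> of \<open>ext L K X G\<close>, which has
  the same sections, and the same germs, as \<open>ext L K X G\<close>.\<close>

definition ext_act ::
    "('l, 'm) ring_scheme \<Rightarrow> 'l set \<Rightarrow> 'x topology \<Rightarrow> ('l, 'x, 'v) sheaf_data \<Rightarrow> ('l \<Rightarrow> 'l)
      \<Rightarrow> 'x set \<Rightarrow> ('l, 'x, 'v) tensor_section \<Rightarrow> ('l, 'x, 'v) tensor_section" where
  "ext_act L K X G g = sheafify_map X (pre_ext L K G) (pre_ext L K G)
     (\<lambda>U. tensor_map L K (sec G U) g (\<lambda>v. v))"

section \<open>Extension of scalars inside a universe\<close>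

text \<open>The sections of \<open>ext L K X G\<close> have another type than those of \<open>G\<close>. To get a functor between
  categories of sheaves with sections in one type \<open>'u\<close>, which then plays the role of the universe,
  we copy the sections of each \<open>ext L K X G\<close> back into \<open>'u\<close> along injections \<open>e G U\<close>. Their existence
  is a closure property of \<open>'u\<close>.\<close>

definition universe_embedding ::
    "('l, 'm) ring_scheme \<Rightarrow> 'l set \<Rightarrow> 'x topology
      \<Rightarrow> (('l, 'x, 'u) sheaf_data \<Rightarrow> 'x set \<Rightarrow> ('l, 'x, 'u) tensor_section \<Rightarrow> 'u) \<Rightarrow> bool" where
  "universe_embedding L K X e \<longleftrightarrow>
     (\<forall>G U. sheaf (L\<lparr>carrier := K\<rparr>) X G \<and> openin X U \<longrightarrow>
        inj_on (e G U) (carrier (sec (ext L K X G) U)))"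

definition transport ::
    "('x set \<Rightarrow> 'v \<Rightarrow> 'w) \<Rightarrow> ('l, 'x, 'v) sheaf_data \<Rightarrow> ('l, 'x, 'w) sheaf_data" where
  "transport i F = (let j = (\<lambda>U. inv_into (carrier (sec F U)) (i U)) in
    \<lparr>sec = \<lambda>U.
      \<lparr>carrier = i U ` carrier (sec F U), monoid.mult = undefined, one = undefined,
       zero = i U \<zero>\<^bsub>sec F U\<^esub>,
       add = \<lambda>a b. i U (j U a \<oplus>\<^bsub>sec F U\<^esub> j U b),
       smult = \<lambda>r a. i U (r \<odot>\<^bsub>sec F U\<^esub> j U a)\<rparr>,
     res = \<lambda>U V a. i V (res F U V (j U a))\<rparr>)"

definition transport_map ::
    "'x topology \<Rightarrow> ('x set \<Rightarrow> 'v \<Rightarrow> 'w) \<Rightarrow> ('x set \<Rightarrow> 'v' \<Rightarrow> 'w') \<Rightarrow> ('l, 'x, 'v) sheaf_data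
      \<Rightarrow> ('x set \<Rightarrow> 'v \<Rightarrow> 'v') \<Rightarrow> 'x set \<Rightarrow> 'w \<Rightarrow> 'w'" where
  "transport_map X i i' F f = (\<lambda>U\<in>{U. openin X U}. \<lambda>a\<in>i U ` carrier (sec F U).
     i' U (f U (inv_into (carrier (sec F U)) (i U) a)))"

definition PhiG ::
    "('l, 'm) ring_scheme \<Rightarrow> 'l set \<Rightarrow> 'x topology
      \<Rightarrow> (('l, 'x, 'u) sheaf_data \<Rightarrow> 'x set \<Rightarrow> ('l, 'x, 'u) tensor_section \<Rightarrow> 'u)
      \<Rightarrow> ('l, 'x, 'u) sheaf_data \<Rightarrow> ('l, 'x, 'u) sheaf_data \<times> (('l \<Rightarrow> 'l) \<Rightarrow> 'x set \<Rightarrow> 'u \<Rightarrow> 'u)" where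
  "PhiG L K X e G = (transport (e G) (ext L K X G),
     \<lambda>g. transport_map X (e G) (e G) (ext L K X G) (ext_act L K X G g))"

definition PhiG_map ::
    "('l, 'm) ring_scheme \<Rightarrow> 'l set \<Rightarrow> 'x topology
      \<Rightarrow> (('l, 'x, 'u) sheaf_data \<Rightarrow> 'x set \<Rightarrow> ('l, 'x, 'u) tensor_section \<Rightarrow> 'u)
      \<Rightarrow> ('l, 'x, 'u) sheaf_data \<Rightarrow> ('l, 'x, 'u) sheaf_data \<Rightarrow> ('x set \<Rightarrow> 'u \<Rightarrow> 'u)
      \<Rightarrow> 'x set \<Rightarrow> 'u \<Rightarrow> 'u" where
  "PhiG_map L K X e G G' f = transport_map X (e G) (e G') (ext L K X G) (ext_map L K X G G' f)"

text \<open>Universes exist: an injection as below suffices, and the datatype \<open>univ\<close>, which contains a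
  copy of an arbitrary type \<open>'a\<close>, admits one.\<close>

lemma universe_embedding_exists:
  fixes j :: "('x \<Rightarrow> 'x set \<times> (int \<times> 'l \<times> 'u) list) \<Rightarrow> 'u"
  assumes "inj j"
  shows "\<exists>e :: ('l, 'x, 'u) sheaf_data \<Rightarrow> 'x set \<Rightarrow> ('l, 'x, 'u) tensor_section \<Rightarrow> 'u.
    universe_embedding L K X e"
proof -
  define fr :: "(int \<times> 'l \<times> 'u) list \<Rightarrow> (('l \<times> 'u) \<Rightarrow>\<^sub>0 int)"
    where "fr xs = sum_list (map (\<lambda>(n, p). frag_cmul n (frag_of p)) xs)" for xs
  have fr_ex: "\<exists>xs. fr xs = c" for c
  proof -
    obtain ks where ks: "set ks = Poly_Mapping.keys c" "distinct ks"
      using finite_distinct_list[OF finite_keys] by metis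
    have "c = (\<Sum>p\<in>Poly_Mapping.keys c. frag_cmul (Poly_Mapping.lookup c p) (frag_of p))"
      by (subst frag_expansion) (simp add: frag_extend_def)
    also have "\<dots> = fr (map (\<lambda>p. (Poly_Mapping.lookup c p, p)) ks)"
      unfolding fr_def ks(1)[symmetric] using ks(2) by (simp add: sum.distinct_set_conv_list o_def)
    finally show ?thesis by metis
  qed
  define dec :: "('l, 'x, 'u) sheaf_data \<Rightarrow> 'x \<Rightarrow> 'x set \<times> (int \<times> 'l \<times> 'u) list
      \<Rightarrow> ('x set \<times> (('l \<times> 'u) \<Rightarrow>\<^sub>0 int) set) set"
    where "dec G x = (\<lambda>(V, xs). germ X (pre_ext L K G) x V
      (tensor_rel L K (sec G V) #>\<^bsub>tensor_free L (sec G V)\<^esub> fr xs))" for G x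
  have dec_ex: "\<exists>p. dec G x p = \<sigma> x"
    if "\<sigma> \<in> carrier (sec (ext L K X G) U)" "x \<in> U" for G U \<sigma> x
  proof -
    have "\<forall>x\<in>U. \<exists>V t. openin X V \<and> x \<in> V \<and> V \<subseteq> U \<and> t \<in> carrier (sec (pre_ext L K G) V) \<and>
        (\<forall>y\<in>V. \<sigma> y = germ X (pre_ext L K G) y V t)"
      using that(1) by (simp add: ext_def sheafify_def)
    with that(2) obtain V t where "t \<in> carrier (sec (pre_ext L K G) V)"
      and eq: "\<sigma> x = germ X (pre_ext L K G) x V t"
      by metis
    then have t: "t \<in> carrier (tensor L K (sec G V))" by (simp add: pre_ext_def)
    from t obtain c where "t = tensor_rel L K (sec G V) #>\<^bsub>tensor_free L (sec G V)\<^esub> c"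
      by (auto simp: tensor_def Let_def FactGroup_def RCOSETS_def)
    moreover obtain xs where "fr xs = c" using fr_ex by metis
    ultimately have "dec G x (V, xs) = \<sigma> x" using eq by (simp add: dec_def)
    then show ?thesis by (rule exI)
  qed
  define e where "e G U \<sigma> = j (\<lambda>x. if x \<in> U then SOME p. dec G x p = \<sigma> x else undefined)"
    for G U \<sigma>
  have "inj_on (e G U) (carrier (sec (ext L K X G) U))" for G U
  proof (rule inj_onI)
    fix \<sigma> \<tau> assume st: "\<sigma> \<in> carrier (sec (ext L K X G) U)" "\<tau> \<in> carrier (sec (ext L K X G) U)"
      and "e G U \<sigma> = e G U \<tau>"
    then have ext_eq: "(\<lambda>x. if x \<in> U then SOME p. dec G x p = \<sigma> x else undefined)
        = (\<lambda>x. if x \<in> U then SOME p. dec G x p = \<tau> x else undefined)"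
      using injD[OF assms] unfolding e_def by blast
    have "\<sigma> x = \<tau> x" if "x \<in> U" for x
    proof -
      have eq: "(SOME p. dec G x p = \<sigma> x) = (SOME p. dec G x p = \<tau> x)"
        using fun_cong[OF ext_eq, of x] that by simp
      have "\<sigma> x = dec G x (SOME p. dec G x p = \<sigma> x)"
        by (rule someI_ex[OF dec_ex[OF st(1) that], symmetric])
      also have "\<dots> = \<tau> x"
        unfolding eq by (rule someI_ex[OF dec_ex[OF st(2) that]])
      finally show ?thesis .
    qed
    moreover have "\<sigma> \<in> extensional U" "\<tau> \<in> extensional U"
      using st by (auto simp: ext_def sheafify_def)
    ultimately show "\<sigma> = \<tau>" by (metis extensionalityI)
  qed
  then show ?thesis unfolding universe_embedding_def by blast
qed

datatype ('a, 'x, 'l) univ = Atom 'a | Node "'x \<Rightarrow> 'x set \<times> (int \<times> 'l \<times> ('a, 'x, 'l) univ) list"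

corollary univ_embedding_exists:
  "\<exists>e :: ('l, 'x, ('a, 'x, 'l) univ) sheaf_data \<Rightarrow> 'x set
      \<Rightarrow> ('l, 'x, ('a, 'x, 'l) univ) tensor_section \<Rightarrow> ('a, 'x, 'l) univ.
    universe_embedding L K X e"
  by (rule universe_embedding_exists[of Node]) (simp add: inj_def)

end

theory Submission
  imports Defs "HOL-Algebra.Finite_Extensions"
begin

text \<open>
  Everything rests on Galois coordinates: finitely many pairs \<open>x\<^sub>i, y\<^sub>i\<close> in \<open>L\<close> for which
  \<open>\<Sum>\<^sub>i x\<^sub>i g(y\<^sub>i)\<close> is \<open>1\<close> if the automorphism \<open>g\<close> is the identity and \<open>0\<close> otherwise
  (\<open>ex_galois_coordinates\<close>). If the Galois group acts semilinearly on an \<open>L\<close>-vector space \<open>M\<close> and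
  \<open>Tr w = \<Sum>\<^sub>g g(w)\<close>, interchanging the two sums gives \<open>v = \<Sum>\<^sub>i x\<^sub>i Tr(y\<^sub>i v)\<close> for all \<open>v\<close>
  (\<open>coord_expansion\<close>). This identity has three consequences.

  Applied to \<open>M = L\<close> it says that the functionals \<open>f\<^sub>i = tr(y\<^sub>i _)\<close> form a dual basis for the
  \<open>x\<^sub>i\<close>. So each \<open>t\<close> in \<open>L \<otimes> V\<close> is \<open>\<Sum>\<^sub>i x\<^sub>i \<otimes> (f\<^sub>i \<otimes> id)(t)\<close>, and for a sheaf
  \<open>G\<close> over \<open>K\<close> equality and gluing of sections of \<open>U \<mapsto> L \<otimes> G(U)\<close> reduce to equality and gluing
  in \<open>G\<close>. This presheaf is therefore already a sheaf (\<open>pre_ext_sheaf\<close>), its sheafification changes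
  nothing, and questions about \<open>L\<^sub>X \<otimes> G\<close> become linear algebra over single open sets.

  Applied to \<open>M = F(U)\<close> it shows that multiplication \<open>L \<otimes> Inv M \<rightarrow> M\<close>, where
  \<open>Inv M\<close> consists of the invariant elements, is bijective: the expansion exhibits a preimage
  of \<open>v\<close>, and the coordinates \<open>(f\<^sub>i \<otimes> id)(t) = Tr(y\<^sub>i v)\<close> of any preimage
  \<open>t\<close> are determined by \<open>v\<close> (\<open>mult_map_bij\<close>). The invariant sections form a sheaf over
  \<open>K\<close>, and the multiplications over all \<open>U\<close> are the isomorphism \<open>\<psi>\<close>. It is natural because an
  equivariant map preserves invariants.

  Finally, an element \<open>c\<close> with \<open>tr c = 1\<close> exists, and then an invariant \<open>t\<close> in \<open>L \<otimes> V\<close> equals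
  \<open>\<Sum>\<^sub>g g(c) t = \<Sum>\<^sub>g (g \<otimes> id)(c t) = 1 \<otimes> (tr(c _) \<otimes> id)(t)\<close>. Hence \<open>v \<mapsto> 1 \<otimes> v\<close> is a
  bijection from \<open>V\<close> onto the invariants of \<open>L \<otimes> V\<close> (\<open>gal_invariant_tensor\<close>). So taking
  invariants is quasi-inverse to extension of scalars, with \<open>v \<mapsto> 1 \<otimes> v\<close> as unit and \<open>\<psi>\<close> as
  counit (\<open>phi_equivalence\<close>).
\<close>

section \<open>Galois coordinates\<close>

text \<open>Summing over lists makes concatenation of coordinate systems an addition, and lets pairs repeat.\<close>

primrec msum :: "('a, 'm) ring_scheme \<Rightarrow> 'a list \<Rightarrow> 'a" where
  "msum M [] = \<zero>\<^bsub>M\<^esub>"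
| "msum M (x # xs) = x \<oplus>\<^bsub>M\<^esub> msum M xs"

lemma (in abelian_group) msum_closed [simp, intro]:
  "set xs \<subseteq> carrier G \<Longrightarrow> msum G xs \<in> carrier G"
  by (induction xs) auto

lemma (in abelian_group) msum_append:
  "set xs \<subseteq> carrier G \<Longrightarrow> set ys \<subseteq> carrier G \<Longrightarrow> msum G (xs @ ys) = msum G xs \<oplus> msum G ys"
  by (induction xs) (auto simp: a_assoc)

lemma msum_hom:
  assumes "h \<zero>\<^bsub>M\<^esub> = \<zero>\<^bsub>N\<^esub>" "abelian_group M" "set xs \<subseteq> carrier M"
    and "\<And>x y. x \<in> carrier M \<Longrightarrow> y \<in> carrier M \<Longrightarrow> h (x \<oplus>\<^bsub>M\<^esub> y) = h x \<oplus>\<^bsub>N\<^esub> h y"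
  shows "h (msum M xs) = msum N (map h xs)"
  using assms(3) by (induction xs) (auto simp: assms abelian_group.msum_closed)

locale galois = field L for L (structure) and K +
  assumes galois: "finite_galois_extension L K"
begin

abbreviation "Gal \<equiv> galois_group L K"

definition gal_one :: "'a \<Rightarrow> 'a" where "gal_one = (\<lambda>x\<in>carrier L. x)"

lemma gal_one_apply [simp]: "x \<in> carrier L \<Longrightarrow> gal_one x = x"
  by (simp add: gal_one_def)

lemma subfield_K: "subfield K L"
  using galois by (simp add: finite_galois_extension_def)

lemma K_subset: "K \<subseteq> carrier L"
  using subfieldE(3)[OF subfield_K] .

lemma K_closed: "k \<in> K \<Longrightarrow> k \<in> carrier L"
  using K_subset by blast

lemma cring_K: "cring (L\<lparr>carrier := K\<rparr>)"
  using subring_is_domain[OF subfieldE(1)[OF subfield_K]] domain.axioms(1) by blast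

lemma gal_hom: "g \<in> Gal \<Longrightarrow> g \<in> ring_hom L L"
  by (simp add: galois_group_def ring_iso_def)

lemma gal_closed [simp]: "g \<in> Gal \<Longrightarrow> x \<in> carrier L \<Longrightarrow> g x \<in> carrier L"
  using gal_hom ring_hom_closed by fastforce

lemma gal_add: "g \<in> Gal \<Longrightarrow> x \<in> carrier L \<Longrightarrow> y \<in> carrier L \<Longrightarrow> g (x \<oplus> y) = g x \<oplus> g y"
  using gal_hom ring_hom_add by fastforce

lemma gal_mult: "g \<in> Gal \<Longrightarrow> x \<in> carrier L \<Longrightarrow> y \<in> carrier L \<Longrightarrow> g (x \<otimes> y) = g x \<otimes> g y"
  using gal_hom ring_hom_mult by fastforce

lemma gal_ring_hom: "g \<in> Gal \<Longrightarrow> ring_hom_ring L L g"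
  by (simp add: gal_hom ring_hom_ringI2 ring_axioms)

lemma gal_zero [simp]: "g \<in> Gal \<Longrightarrow> g \<zero> = \<zero>"
  using ring_hom_zero[OF gal_hom] ring_axioms by blast

lemma gal_fixes: "g \<in> Gal \<Longrightarrow> k \<in> K \<Longrightarrow> g k = k"
  by (simp add: galois_group_def)

lemma gal_bij: "g \<in> Gal \<Longrightarrow> bij_betw g (carrier L) (carrier L)"
  by (simp add: galois_group_def ring_iso_def)

lemma gal_ext: "g \<in> Gal \<Longrightarrow> g \<in> extensional (carrier L)"
  by (simp add: galois_group_def)

lemma fixed_in_K: "x \<in> carrier L \<Longrightarrow> (\<And>g. g \<in> Gal \<Longrightarrow> g x = x) \<Longrightarrow> x \<in> K"
  using galois unfolding finite_galois_extension_def by blast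

lemma gal_one_in: "gal_one \<in> Gal"
proof -
  have "gal_one \<in> extensional (carrier L)" by (simp add: gal_one_def)
  moreover have "gal_one \<in> ring_hom L L" by (rule ring_hom_memI) auto
  moreover have "bij_betw gal_one (carrier L) (carrier L)"
    by (rule bij_betwI[where g = "\<lambda>x. x"]) auto
  ultimately show ?thesis using K_closed by (auto simp: galois_group_def ring_iso_def)
qed

lemma gal_comp:
  assumes "g \<in> Gal" "h \<in> Gal" shows "compose (carrier L) g h \<in> Gal"
proof -
  have "bij_betw (compose (carrier L) g h) (carrier L) (carrier L)"
    using bij_betw_trans[OF gal_bij[OF assms(2)] gal_bij[OF assms(1)]]
    by (rule bij_betw_cong[THEN iffD1, rotated]) (simp add: compose_def)
  moreover have "compose (carrier L) g h \<in> ring_hom L L"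
    by (rule ring_hom_memI)
       (use assms in \<open>auto simp: compose_def gal_add gal_mult ring_hom_one[OF gal_hom]\<close>)
  ultimately show ?thesis
    using assms K_subset by (auto simp: galois_group_def ring_iso_def compose_def)
qed

lemma gal_inv:
  assumes "g \<in> Gal"
  obtains h where "h \<in> Gal" "compose (carrier L) g h = gal_one" "compose (carrier L) h g = gal_one"
proof
  let ?h = "restrict (inv_into (carrier L) g) (carrier L)"
  have "inv_into (carrier L) g \<in> ring_iso L L"
    using ring_iso_set_sym[of L g L] assms by (simp add: galois_group_def ring_axioms)
  then have "?h \<in> ring_iso L L"
    by (rule ring_iso_restrict) simp
  moreover have "?h k = k" if "k \<in> K" for k
    using that K_subset gal_fixes[OF assms that] bij_betw_inv_into_left[OF gal_bij[OF assms], of k]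
    by auto
  ultimately show "?h \<in> Gal"
    by (simp add: galois_group_def)
  show "compose (carrier L) g ?h = gal_one"
    using gal_bij[OF assms] by (auto simp: compose_def bij_betw_def gal_one_def f_inv_into_f)
  show "compose (carrier L) ?h g = gal_one"
    using gal_bij[OF assms] assms by (auto simp: compose_def gal_one_def bij_betw_def)
qed

lemma gal_comp_bij:
  assumes "h \<in> Gal" shows "bij_betw (compose (carrier L) h) Gal Gal"
proof -
  obtain h' where h': "h' \<in> Gal" "compose (carrier L) h h' = gal_one" "compose (carrier L) h' h = gal_one"
    using gal_inv[OF assms] .
  have *: "compose (carrier L) a (compose (carrier L) b g) = g"
    if "a \<in> Gal" "b \<in> Gal" "g \<in> Gal" "compose (carrier L) a b = gal_one" for a b g
  proof (rule extensionalityI[of _ "carrier L"])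
    fix x assume x: "x \<in> carrier L"
    show "compose (carrier L) a (compose (carrier L) b g) x = g x"
      using fun_cong[OF that(4), of "g x"] that x by (simp add: compose_def)
  qed (use that in \<open>auto simp: gal_ext compose_def\<close>)
  show ?thesis
    by (rule bij_betw_byWitness[where f' = "compose (carrier L) h'"])
       (use assms h' gal_comp in \<open>auto simp: *\<close>)
qed

text \<open>An automorphism over \<open>K\<close> is determined by its values on a finite spanning list, and it sends each
  entry to a root of a fixed polynomial over \<open>K\<close> that annihilates the entry.\<close>

lemma finite_Gal: "finite Gal"
proof -
  obtain n where "dimension n K (carrier L)"
    using galois by (auto simp: finite_galois_extension_def finite_dimension_def)
  then obtain bs where bs: "set bs \<subseteq> carrier L" "Span K bs = carrier L"
    using exists_base[OF subfield_K] independent_in_carrier by metis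
  have fin: "finite ((\<lambda>g. g b) ` Gal)" if b: "b \<in> carrier L" for b
  proof -
    have "(algebraic over K) b"
      using finite_dimension_imp_algebraic[OF subfield_K carrier_is_subring] galois b
      by (simp add: finite_galois_extension_def)
    then obtain p where p: "p \<in> carrier (K[X])" "p \<noteq> []" "eval p b = \<zero>"
      using algebraicE[OF subfieldE(1)[OF subfield_K] b] by blast
    have setp: "set p \<subseteq> K"
      using p(1) by (metis polynomial_incl univ_poly_carrier)
    have "is_root p (g b)" if g: "g \<in> Gal" for g
    proof -
      have "map g p = p" using setp gal_fixes[OF g] by (simp add: map_idI subset_iff)
      then have "eval p (g b) = \<zero>"
        using ring_hom_ring.eval_hom[OF gal_ring_hom[OF g] subfieldE(1)[OF subfield_K] b p(1)] p(3) g
        by simp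
      with b g p(2) show ?thesis by (simp add: is_root_def)
    qed
    then have "(\<lambda>g. g b) ` Gal \<subseteq> {x. is_root p x}" by blast
    moreover have "p \<in> carrier (poly_ring L)"
      using p(1) carrier_polynomial_shell[OF subfieldE(1)[OF subfield_K]] by blast
    ultimately show ?thesis using finite_number_of_roots finite_subset by blast
  qed
  have "inj_on (\<lambda>g. map g bs) Gal"
  proof (rule inj_onI)
    fix g h assume gh: "g \<in> Gal" "h \<in> Gal" and eq: "map g bs = map h bs"
    have comb: "g (combine Ks cs) = h (combine Ks cs)"
      if "set Ks \<subseteq> K" "set cs \<subseteq> set bs" for Ks cs
      using that
    proof (induction Ks cs rule: combine.induct)
      case (1 k Ks u Us)
      then have "g u = h u" using eq by simp
      moreover have "combine Ks Us \<in> carrier L" "u \<in> carrier L" "k \<in> carrier L" "k \<in> K"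
        using 1 bs K_subset by (auto intro!: combine_in_carrier)
      ultimately show ?case using 1 gh by (simp add: gal_add gal_mult gal_fixes)
    qed (use gh in auto)
    show "g = h"
    proof (rule extensionalityI[OF gal_ext gal_ext, OF gh])
      fix x assume "x \<in> carrier L"
      then obtain Ks where "x = combine Ks bs" "set Ks \<subseteq> K"
        using Span_eq_combine_set[OF subfield_K bs(1)] bs(2) by blast
      then show "g x = h x" using comb by simp
    qed
  qed
  moreover have "(\<lambda>g. map g bs) ` Gal \<subseteq> {xs. set xs \<subseteq> (\<Union>b\<in>set bs. (\<lambda>g. g b) ` Gal) \<and> length xs = length bs}"
    by fastforce
  then have "finite ((\<lambda>g. map g bs) ` Gal)"
    by (rule finite_subset) (intro finite_lists_length_eq finite_UN_I finite_set fin, use bs in auto)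
  ultimately show ?thesis by (rule finite_imageD[rotated])
qed

definition tr :: "'a \<Rightarrow> 'a" where "tr x = (\<Oplus>g\<in>Gal. g x)"

lemma tr_closed [simp]: "x \<in> carrier L \<Longrightarrow> tr x \<in> carrier L"
  by (auto simp: tr_def intro: finsum_closed)

text \<open>Composition with \<open>h\<close> permutes the summands of the trace, so the trace lies in the fixed field.\<close>

lemma tr_in_K: assumes x: "x \<in> carrier L" shows "tr x \<in> K"
proof (rule fixed_in_K[OF tr_closed[OF x]])
  fix h assume h: "h \<in> Gal"
  have "h (tr x) = (\<Oplus>g\<in>Gal. h (g x))"
    unfolding tr_def
    using ring_hom_ring.hom_finsum[OF gal_ring_hom[OF h], of "\<lambda>g. g x" Gal] x by (simp add: comp_def)
  also have "\<dots> = (\<Oplus>g\<in>Gal. compose (carrier L) h g x)"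
    using x h by (intro finsum_cong') (auto simp: compose_def)
  also have "\<dots> = (\<Oplus>g\<in>compose (carrier L) h ` Gal. g x)"
    using gal_comp_bij[OF h] x h gal_comp
    by (intro finsum_reindex[symmetric]) (auto simp: bij_betw_def)
  also have "\<dots> = tr x" using gal_comp_bij[OF h] by (simp add: bij_betw_def tr_def)
  finally show "h (tr x) = tr x" .
qed

lemma tr_add: "x \<in> carrier L \<Longrightarrow> y \<in> carrier L \<Longrightarrow> tr (x \<oplus> y) = tr x \<oplus> tr y"
  unfolding tr_def
  by (subst finsum_addf[symmetric]) (auto intro!: finsum_cong' simp: gal_add simp del: finsum_addf)

lemma tr_scale: "k \<in> K \<Longrightarrow> x \<in> carrier L \<Longrightarrow> tr (k \<otimes> x) = k \<otimes> tr x"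
  unfolding tr_def using K_closed
  by (subst finsum_rdistr[OF finite_Gal]) (auto intro!: finsum_cong' simp: gal_mult gal_fixes)

text \<open>Read as functions of \<open>g\<close>, these sums form an algebra of functions on the Galois group. The
  coordinates sought are those of its indicator function of the identity.\<close>

definition coord_sum :: "('a \<times> 'a) list \<Rightarrow> ('a \<Rightarrow> 'a) \<Rightarrow> 'a" where
  "coord_sum ps g = msum L (map (\<lambda>(x, y). x \<otimes> g y) ps)"

lemma coord_sum_closed:
  "set ps \<subseteq> carrier L \<times> carrier L \<Longrightarrow> g \<in> Gal \<Longrightarrow> coord_sum ps g \<in> carrier L"
  unfolding coord_sum_def by (rule msum_closed) auto

lemma coord_sum_scale:
  assumes "set ps \<subseteq> carrier L \<times> carrier L" "g \<in> Gal" "a \<in> carrier L" "z \<in> carrier L"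
  shows "coord_sum (map (\<lambda>(x, y). (a \<otimes> x, z \<otimes> y)) ps) g = a \<otimes> g z \<otimes> coord_sum ps g"
  using assms(1)
proof (induction ps)
  case (Cons p ps)
  obtain x y where p: "p = (x, y)" by force
  have "coord_sum ps g \<in> carrier L" using Cons assms coord_sum_closed by simp
  moreover have "(a \<otimes> x) \<otimes> (g z \<otimes> g y) = a \<otimes> g z \<otimes> (x \<otimes> g y)"
    using Cons assms p by (simp add: m_ac)
  ultimately show ?case
    using Cons assms p by (simp add: coord_sum_def r_distr gal_mult)
qed (use assms in \<open>simp add: coord_sum_def\<close>)

text \<open>The indicator function of the identity is the product over all other \<open>g\<close> of the functions
  \<open>h \<mapsto> (h(z) - g(z)) / (z - g(z))\<close>, where \<open>z\<close> is moved by \<open>g\<close>. The induction multiplies in one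
  factor at a time.\<close>

lemma ex_galois_coordinates_aux:
  assumes "finite A" "A \<subseteq> Gal" "gal_one \<notin> A"
  shows "\<exists>ps. set ps \<subseteq> carrier L \<times> carrier L \<and> coord_sum ps gal_one = \<one> \<and> (\<forall>g\<in>A. coord_sum ps g = \<zero>)"
  using assms
proof (induction A rule: finite_induct)
  case empty
  have "coord_sum [(\<one>, \<one>)] gal_one = \<one>" by (simp add: coord_sum_def)
  then show ?case by (metis (no_types, lifting) SigmaI empty_iff empty_set empty_subsetI insert_subset list.simps(15) one_closed)
next
  case (insert g A)
  then obtain ps where ps: "set ps \<subseteq> carrier L \<times> carrier L" "coord_sum ps gal_one = \<one>"
    "\<forall>h\<in>A. coord_sum ps h = \<zero>" by auto
  have g: "g \<in> Gal" "g \<noteq> gal_one" using insert by auto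
  then obtain z where z: "z \<in> carrier L" "g z \<noteq> z"
    using extensionalityI[OF gal_ext[OF g(1)] gal_ext[OF gal_one_in]] by fastforce
  define d where "d = inv (z \<ominus> g z)"
  have nz: "z \<ominus> g z \<in> Units L"
    using z g by (metis gal_closed field_Units Diff_iff minus_closed r_right_minus_eq singletonD)
  have d: "d \<in> carrier L" unfolding d_def using nz by simp
  \<comment> \<open>Coordinates of the product of the previous function with \<open>h \<mapsto> d h(z) - d g(z)\<close>.\<close>
  define qs where "qs = map (\<lambda>(x, y). (d \<otimes> x, z \<otimes> y)) ps @ map (\<lambda>(x, y). (\<ominus> (d \<otimes> g z) \<otimes> x, \<one> \<otimes> y)) ps"
  have qs: "coord_sum qs h = d \<otimes> (h z \<ominus> g z) \<otimes> coord_sum ps h" if h: "h \<in> Gal" for h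
  proof -
    have c: "coord_sum ps h \<in> carrier L" using ps h coord_sum_closed by simp
    have "coord_sum (map (\<lambda>(x, y). (d \<otimes> x, z \<otimes> y)) ps) h = d \<otimes> h z \<otimes> coord_sum ps h"
         "coord_sum (map (\<lambda>(x, y). (\<ominus> (d \<otimes> g z) \<otimes> x, \<one> \<otimes> y)) ps) h
            = \<ominus> (d \<otimes> g z) \<otimes> h \<one> \<otimes> coord_sum ps h"
      using coord_sum_scale[OF ps(1) h] d z g by auto
    moreover have "coord_sum qs h = coord_sum (map (\<lambda>(x, y). (d \<otimes> x, z \<otimes> y)) ps) h
        \<oplus> coord_sum (map (\<lambda>(x, y). (\<ominus> (d \<otimes> g z) \<otimes> x, \<one> \<otimes> y)) ps) h"
      unfolding coord_sum_def qs_def map_append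
      by (rule msum_append) (use ps d z g h in auto)
    moreover have "h \<one> = \<one>" using ring_hom_one[OF gal_hom[OF h]] by simp
    moreover have "d \<otimes> u \<otimes> c \<oplus> \<ominus> (d \<otimes> v) \<otimes> c = d \<otimes> (u \<ominus> v) \<otimes> c"
      if "u \<in> carrier L" "v \<in> carrier L" "c \<in> carrier L" for u v c
      using that d by algebra
    ultimately show ?thesis using c d z g h by simp
  qed
  have "set qs \<subseteq> carrier L \<times> carrier L" using ps d z g unfolding qs_def by auto
  moreover have "coord_sum qs gal_one = \<one>"
    using qs[OF gal_one_in] ps nz z unfolding d_def by simp
  moreover have "coord_sum qs h = \<zero>" if "h \<in> insert g A" for h
  proof (cases "h = g")
    case True
    have "coord_sum ps g \<in> carrier L" using ps g coord_sum_closed by simp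
    moreover have "g z \<ominus> g z = \<zero>" using g z by (simp add: r_right_minus_eq)
    ultimately show ?thesis using qs[OF g(1)] True d by simp
  next
    case False
    then have "h \<in> A" "h \<in> Gal" using that insert by auto
    then show ?thesis using qs[of h] ps z g d by simp
  qed
  ultimately show ?case by blast
qed

lemma ex_galois_coordinates:
  "\<exists>ps. set ps \<subseteq> carrier L \<times> carrier L \<and> (\<forall>g\<in>Gal. coord_sum ps g = (if g = gal_one then \<one> else \<zero>))"
  using ex_galois_coordinates_aux[of "Gal - {gal_one}"] finite_Gal by auto

definition coords :: "('a \<times> 'a) list" where
  "coords = (SOME ps. set ps \<subseteq> carrier L \<times> carrier L
     \<and> (\<forall>g\<in>Gal. coord_sum ps g = (if g = gal_one then \<one> else \<zero>)))"

lemma coords_closed: "set coords \<subseteq> carrier L \<times> carrier L"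
  and coord_sum_coords: "g \<in> Gal \<Longrightarrow> coord_sum coords g = (if g = gal_one then \<one> else \<zero>)"
  using someI_ex[OF ex_galois_coordinates] unfolding coords_def by auto

end

section \<open>The tensor product\<close>

definition tens :: "('l, 'm) ring_scheme \<Rightarrow> 'l set \<Rightarrow> ('l, 'v) module \<Rightarrow> 'l \<Rightarrow> 'v \<Rightarrow> (('l \<times> 'v) \<Rightarrow>\<^sub>0 int) set" where
  "tens L K V l v = tensor_rel L K V #>\<^bsub>tensor_free L V\<^esub> frag_of (l, v)"

text \<open>The maps that factor through \<open>L \<otimes>\<^sub>K V\<close>.\<close>

definition balanced ::
    "('l, 'm) ring_scheme \<Rightarrow> 'l set \<Rightarrow> ('l, 'v) module \<Rightarrow> ('n, 'q) ring_scheme \<Rightarrow> ('l \<Rightarrow> 'v \<Rightarrow> 'n) \<Rightarrow> bool" where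
  "balanced L K V N f \<longleftrightarrow>
     (\<forall>a\<in>carrier L. \<forall>v\<in>carrier V. f a v \<in> carrier N) \<and>
     (\<forall>a\<in>carrier L. \<forall>b\<in>carrier L. \<forall>v\<in>carrier V. f (a \<oplus>\<^bsub>L\<^esub> b) v = f a v \<oplus>\<^bsub>N\<^esub> f b v) \<and>
     (\<forall>a\<in>carrier L. \<forall>v\<in>carrier V. \<forall>w\<in>carrier V. f a (v \<oplus>\<^bsub>V\<^esub> w) = f a v \<oplus>\<^bsub>N\<^esub> f a w) \<and>
     (\<forall>a\<in>carrier L. \<forall>k\<in>K. \<forall>v\<in>carrier V. f (a \<otimes>\<^bsub>L\<^esub> k) v = f a (k \<odot>\<^bsub>V\<^esub> v))"

text \<open>Additive maps of \<open>L\<close> commuting with multiplication by \<open>K\<close>: those \<open>\<alpha>\<close> for which \<open>\<alpha> \<otimes> r\<close> exists.\<close>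

definition scalar_linear :: "('l, 'm) ring_scheme \<Rightarrow> 'l set \<Rightarrow> ('l \<Rightarrow> 'l) \<Rightarrow> bool" where
  "scalar_linear L K \<alpha> \<longleftrightarrow> \<alpha> \<in> carrier L \<rightarrow> carrier L \<and>
     (\<forall>a\<in>carrier L. \<forall>b\<in>carrier L. \<alpha> (a \<oplus>\<^bsub>L\<^esub> b) = \<alpha> a \<oplus>\<^bsub>L\<^esub> \<alpha> b) \<and>
     (\<forall>a\<in>carrier L. \<forall>k\<in>K. \<alpha> (a \<otimes>\<^bsub>L\<^esub> k) = \<alpha> a \<otimes>\<^bsub>L\<^esub> k)"

lemma linear_maps_closed: "f \<in> linear_maps R M N \<Longrightarrow> v \<in> carrier M \<Longrightarrow> f v \<in> carrier N"
  by (auto simp: linear_maps_def hom_def)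

lemma linear_maps_add: "f \<in> linear_maps R M N \<Longrightarrow> v \<in> carrier M \<Longrightarrow> w \<in> carrier M
    \<Longrightarrow> f (v \<oplus>\<^bsub>M\<^esub> w) = f v \<oplus>\<^bsub>N\<^esub> f w"
  by (auto simp: linear_maps_def hom_def)

lemma linear_maps_smult: "f \<in> linear_maps R M N \<Longrightarrow> a \<in> carrier R \<Longrightarrow> v \<in> carrier M
    \<Longrightarrow> f (a \<odot>\<^bsub>M\<^esub> v) = a \<odot>\<^bsub>N\<^esub> f v"
  by (auto simp: linear_maps_def hom_def)

lemma linear_mapsI:
  assumes "\<And>v. v \<in> carrier M \<Longrightarrow> f v \<in> carrier N"
    and "\<And>v w. v \<in> carrier M \<Longrightarrow> w \<in> carrier M \<Longrightarrow> f (v \<oplus>\<^bsub>M\<^esub> w) = f v \<oplus>\<^bsub>N\<^esub> f w"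
    and "\<And>a v. a \<in> carrier R \<Longrightarrow> v \<in> carrier M \<Longrightarrow> f (a \<odot>\<^bsub>M\<^esub> v) = a \<odot>\<^bsub>N\<^esub> f v"
  shows "f \<in> linear_maps R M N"
  using assms by (auto simp: linear_maps_def hom_def)

lemma additive_zero:
  assumes "abelian_group M" "abelian_group N" "f \<zero>\<^bsub>M\<^esub> \<in> carrier N"
    and "f (\<zero>\<^bsub>M\<^esub> \<oplus>\<^bsub>M\<^esub> \<zero>\<^bsub>M\<^esub>) = f \<zero>\<^bsub>M\<^esub> \<oplus>\<^bsub>N\<^esub> f \<zero>\<^bsub>M\<^esub>"
  shows "f \<zero>\<^bsub>M\<^esub> = \<zero>\<^bsub>N\<^esub>"
proof -
  interpret M: abelian_group M by fact
  interpret N: abelian_group N by fact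
  show ?thesis using assms(3,4) by (metis M.r_zero M.zero_closed N.add.r_cancel_one')
qed

lemma linear_maps_zero:
  assumes "f \<in> linear_maps R M N" "abelian_group M" "abelian_group N"
  shows "f \<zero>\<^bsub>M\<^esub> = \<zero>\<^bsub>N\<^esub>"
proof -
  have z: "\<zero>\<^bsub>M\<^esub> \<in> carrier M" using assms(2) by (simp add: abelian_groupE)
  show ?thesis
    by (rule additive_zero[OF assms(2,3)])
       (use z assms(1) in \<open>auto simp: linear_maps_closed linear_maps_add\<close>)
qed

locale scalar_extension = cring L for L :: "('l, 'm) ring_scheme" (structure) and K and V :: "('l, 'v) module" +
  assumes scalars: "K \<subseteq> carrier L" and mod: "Module.module (L\<lparr>carrier := K\<rparr>) V"
begin

abbreviation "FV \<equiv> tensor_free L V"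
abbreviation "RV \<equiv> tensor_rel L K V"
abbreviation "T \<equiv> tensor L K V"

lemma scalar_closed: "k \<in> K \<Longrightarrow> k \<in> carrier L"
  using scalars by blast

lemma abelian_V: "abelian_group V"
  using mod by (simp add: Module.module_def)

lemma V_add_closed: "v \<in> carrier V \<Longrightarrow> w \<in> carrier V \<Longrightarrow> v \<oplus>\<^bsub>V\<^esub> w \<in> carrier V"
  using abelian_V by (rule abelian_groupE)

lemma V_zero_closed: "\<zero>\<^bsub>V\<^esub> \<in> carrier V"
  using abelian_V by (rule abelian_groupE)

lemma V_smult_closed: "k \<in> K \<Longrightarrow> v \<in> carrier V \<Longrightarrow> k \<odot>\<^bsub>V\<^esub> v \<in> carrier V"
  using Module.module.smult_closed[OF mod] by simp

lemma comm_group_free: "comm_group FV"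
  by (simp add: tensor_free_def abelian_free_Abelian_group)

lemma group_free: "group FV"
  by (simp add: tensor_free_def)

lemma free_carrier: "c \<in> carrier FV \<longleftrightarrow> Poly_Mapping.keys c \<subseteq> carrier L \<times> carrier V"
  by (simp add: tensor_free_def)

lemma free_mult [simp]: "c \<otimes>\<^bsub>FV\<^esub> d = c + d"
  by (simp add: tensor_free_def)

lemma free_one [simp]: "\<one>\<^bsub>FV\<^esub> = 0"
  by (simp add: tensor_free_def)

lemma free_of: "a \<in> carrier L \<Longrightarrow> v \<in> carrier V \<Longrightarrow> frag_of (a, v) \<in> carrier FV"
  by (simp add: free_carrier)

lemma free_add: "c \<in> carrier FV \<Longrightarrow> d \<in> carrier FV \<Longrightarrow> c + d \<in> carrier FV"
  using group.subgroupE(4)[OF group_free group.subgroup_self[OF group_free], of c d] by simp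

lemma free_diff: "c \<in> carrier FV \<Longrightarrow> d \<in> carrier FV \<Longrightarrow> c - d \<in> carrier FV"
  using keys_diff[of c d] by (auto simp: free_carrier)

lemma free_minus: "c \<in> carrier FV \<Longrightarrow> - c \<in> carrier FV"
  by (simp add: free_carrier)

definition "gens = {frag_of (a \<oplus> b, v) - frag_of (a, v) - frag_of (b, v) |a b v.
        a \<in> carrier L \<and> b \<in> carrier L \<and> v \<in> carrier V} \<union>
     {frag_of (a, v \<oplus>\<^bsub>V\<^esub> w) - frag_of (a, v) - frag_of (a, w) |a v w.
        a \<in> carrier L \<and> v \<in> carrier V \<and> w \<in> carrier V} \<union>
     {frag_of (a \<otimes> k, v) - frag_of (a, k \<odot>\<^bsub>V\<^esub> v) |a k v.
        a \<in> carrier L \<and> k \<in> K \<and> v \<in> carrier V}"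

lemma tensor_rel_generate: "RV = generate FV gens"
  by (simp add: tensor_rel_def gens_def)

lemma gens_cases [consumes 1, case_names left right scalar]:
  assumes "c \<in> gens"
  obtains a b v where "c = frag_of (a \<oplus> b, v) - frag_of (a, v) - frag_of (b, v)"
        "a \<in> carrier L" "b \<in> carrier L" "v \<in> carrier V"
    | a v w where "c = frag_of (a, v \<oplus>\<^bsub>V\<^esub> w) - frag_of (a, v) - frag_of (a, w)"
        "a \<in> carrier L" "v \<in> carrier V" "w \<in> carrier V"
    | a k v where "c = frag_of (a \<otimes> k, v) - frag_of (a, k \<odot>\<^bsub>V\<^esub> v)"
        "a \<in> carrier L" "k \<in> K" "v \<in> carrier V"
  using assms unfolding gens_def by blast

lemma gens_closed: "gens \<subseteq> carrier FV"
  unfolding gens_def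
  by (auto intro!: free_diff free_of V_add_closed V_smult_closed simp: scalar_closed)

lemma rel_subgroup: "subgroup RV FV"
  unfolding tensor_rel_generate by (rule group.generate_is_subgroup[OF group_free gens_closed])

lemma rel_normal: "RV \<lhd> FV"
  by (rule comm_group.subgroup_imp_normal[OF comm_group_free rel_subgroup])

lemma rel_gen: "c \<in> gens \<Longrightarrow> c \<in> RV"
  unfolding tensor_rel_generate by (rule generate.incl)

lemma coset_eqI:
  assumes "c \<in> carrier FV" "d \<in> carrier FV" "c - d \<in> RV"
  shows "RV #>\<^bsub>FV\<^esub> c = RV #>\<^bsub>FV\<^esub> d"
proof -
  have "c = (c - d) \<otimes>\<^bsub>FV\<^esub> d" by simp
  then have "c \<in> RV #>\<^bsub>FV\<^esub> d" using assms(3) unfolding r_coset_def by blast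
  then show ?thesis by (metis group.repr_independence[OF group_free _ assms(2) rel_subgroup])
qed

lemma coset_of_rel: assumes "c \<in> RV" shows "RV #>\<^bsub>FV\<^esub> c = RV"
  by (rule subgroup.rcos_const[OF rel_subgroup group_free assms])

lemma tensor_carrier: "carrier T = {RV #>\<^bsub>FV\<^esub> c |c. c \<in> carrier FV}"
  by (auto simp: tensor_def Let_def FactGroup_def RCOSETS_def)

lemma tensor_zero: "\<zero>\<^bsub>T\<^esub> = RV"
  by (simp add: tensor_def Let_def FactGroup_def)

lemma coset_closed: "c \<in> carrier FV \<Longrightarrow> RV #>\<^bsub>FV\<^esub> c \<in> carrier T"
  by (auto simp: tensor_carrier)

lemma tensor_add: "c \<in> carrier FV \<Longrightarrow> d \<in> carrier FV
    \<Longrightarrow> (RV #>\<^bsub>FV\<^esub> c) \<oplus>\<^bsub>T\<^esub> (RV #>\<^bsub>FV\<^esub> d) = RV #>\<^bsub>FV\<^esub> (c + d)"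
  using normal.rcos_sum[OF rel_normal] by (simp add: tensor_def Let_def FactGroup_def)

lemma tensor_smult: "a \<odot>\<^bsub>T\<^esub> C = tensor_map L K V (\<lambda>l. a \<otimes> l) (\<lambda>v. v) C"
  by (simp add: tensor_def Let_def)

lemma abelian_tensor: "abelian_group T"
proof -
  interpret Q: comm_group "FV Mod RV"
    by (rule comm_group.abelian_FactGroup[OF comm_group_free rel_subgroup])
  have eq: "carrier T = carrier (FV Mod RV)" "add T = monoid.mult (FV Mod RV)" "zero T = one (FV Mod RV)"
    by (auto simp: tensor_def Let_def)
  show ?thesis
    by (rule abelian_groupI; unfold eq)
       ((rule Q.m_assoc Q.m_comm Q.l_one; assumption) | blast intro: Q.m_closed Q.one_closed
         | metis Q.l_inv Q.inv_closed)+
qed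

lemma tens_closed: "a \<in> carrier L \<Longrightarrow> v \<in> carrier V \<Longrightarrow> tens L K V a v \<in> carrier T"
  by (auto simp: tens_def intro: coset_closed free_of)

lemma tens_add_left:
  assumes "a \<in> carrier L" "b \<in> carrier L" "v \<in> carrier V"
  shows "tens L K V (a \<oplus> b) v = tens L K V a v \<oplus>\<^bsub>T\<^esub> tens L K V b v"
proof -
  have "frag_of (a \<oplus> b, v) - frag_of (a, v) - frag_of (b, v) \<in> RV"
    using assms by (intro rel_gen) (unfold gens_def, blast)
  then have "RV #>\<^bsub>FV\<^esub> frag_of (a \<oplus> b, v) = RV #>\<^bsub>FV\<^esub> (frag_of (a, v) + frag_of (b, v))"
    using assms by (intro coset_eqI) (auto intro: free_of free_add simp: diff_diff_eq)
  then show ?thesis using assms by (simp add: tens_def tensor_add free_of)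
qed

lemma tens_add_right:
  assumes "a \<in> carrier L" "v \<in> carrier V" "w \<in> carrier V"
  shows "tens L K V a (v \<oplus>\<^bsub>V\<^esub> w) = tens L K V a v \<oplus>\<^bsub>T\<^esub> tens L K V a w"
proof -
  have "frag_of (a, v \<oplus>\<^bsub>V\<^esub> w) - frag_of (a, v) - frag_of (a, w) \<in> RV"
    using assms by (intro rel_gen) (unfold gens_def, blast)
  then have "RV #>\<^bsub>FV\<^esub> frag_of (a, v \<oplus>\<^bsub>V\<^esub> w) = RV #>\<^bsub>FV\<^esub> (frag_of (a, v) + frag_of (a, w))"
    using assms by (intro coset_eqI) (auto intro: free_of free_add V_add_closed simp: diff_diff_eq)
  then show ?thesis using assms by (simp add: tens_def tensor_add free_of)
qed

lemma tens_balanced: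
  assumes "a \<in> carrier L" "k \<in> K" "v \<in> carrier V"
  shows "tens L K V (a \<otimes> k) v = tens L K V a (k \<odot>\<^bsub>V\<^esub> v)"
proof -
  have "frag_of (a \<otimes> k, v) - frag_of (a, k \<odot>\<^bsub>V\<^esub> v) \<in> RV"
    using assms by (intro rel_gen) (unfold gens_def, blast)
  then show ?thesis unfolding tens_def
    using assms by (intro coset_eqI) (auto intro: free_of V_smult_closed simp: scalar_closed)
qed

lemma tens_zero_left: "v \<in> carrier V \<Longrightarrow> tens L K V \<zero> v = \<zero>\<^bsub>T\<^esub>"
  by (rule additive_zero[of L T "\<lambda>a. tens L K V a v"])
     (auto simp: abelian_tensor tens_closed tens_add_left[symmetric] is_abelian_group)

text \<open>Closure under addition suffices: negatives come for free, as \<open>- (a \<otimes> v) = (- a) \<otimes> v\<close>.\<close>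

lemma tensor_induct [consumes 1, case_names tens add]:
  assumes "t \<in> carrier T"
    and tens: "\<And>a v. a \<in> carrier L \<Longrightarrow> v \<in> carrier V \<Longrightarrow> P (tens L K V a v)"
    and add: "\<And>s t. s \<in> carrier T \<Longrightarrow> t \<in> carrier T \<Longrightarrow> P s \<Longrightarrow> P t \<Longrightarrow> P (s \<oplus>\<^bsub>T\<^esub> t)"
  shows "P t"
proof -
  interpret T: abelian_group T by (rule abelian_tensor)
  have "P (RV #>\<^bsub>FV\<^esub> c) \<and> P (RV #>\<^bsub>FV\<^esub> (- c))" (is "?P c")
    if "Poly_Mapping.keys c \<subseteq> carrier L \<times> carrier V" for c
    using that
  proof (rule free_Abelian_group_induct)
    have "P (\<zero>\<^bsub>T\<^esub>)" using tens[of \<zero> "\<zero>\<^bsub>V\<^esub>"] V_zero_closed by (simp add: tens_zero_left)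
    moreover have "RV #>\<^bsub>FV\<^esub> 0 = RV"
      using coset_of_rel[of 0] subgroup.one_closed[OF rel_subgroup] by simp
    ultimately show "?P 0" by (simp add: tensor_zero)
  next
    fix c d
    assume keys: "Poly_Mapping.keys c \<subseteq> carrier L \<times> carrier V" "Poly_Mapping.keys d \<subseteq> carrier L \<times> carrier V"
      and IH: "?P c" "?P d"
    from keys have cd: "c \<in> carrier FV" "d \<in> carrier FV" "- c \<in> carrier FV" "- d \<in> carrier FV"
      by (simp_all add: free_carrier)
    have "P (RV #>\<^bsub>FV\<^esub> (c + - d))" "P (RV #>\<^bsub>FV\<^esub> (d + - c))"
      using IH cd by (simp_all only: tensor_add[symmetric] add coset_closed)
    then show "?P (c - d)" by simp
  next
    fix p assume "p \<in> carrier L \<times> carrier V"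
    then obtain a v where p: "p = (a, v)" "a \<in> carrier L" "v \<in> carrier V" by auto
    have "tens L K V a v \<oplus>\<^bsub>T\<^esub> tens L K V (\<ominus> a) v = \<zero>\<^bsub>T\<^esub>"
      using p by (simp add: tens_add_left[symmetric] r_neg tens_zero_left)
    moreover have "tens L K V a v \<oplus>\<^bsub>T\<^esub> (RV #>\<^bsub>FV\<^esub> (- frag_of p)) = \<zero>\<^bsub>T\<^esub>"
      using p by (simp add: tens_def tensor_add free_of free_minus tensor_zero coset_of_rel
          subgroup.one_closed[OF rel_subgroup, simplified])
    ultimately have "RV #>\<^bsub>FV\<^esub> (- frag_of p) = tens L K V (\<ominus> a) v"
      using p T.add.l_cancel[of "tens L K V a v" "RV #>\<^bsub>FV\<^esub> (- frag_of p)" "tens L K V (\<ominus> a) v"]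
      by (simp add: coset_closed free_minus free_of tens_closed)
    then show "?P (frag_of p)" using tens p by (metis a_inv_closed tens_def)
  qed
  then show ?thesis using assms(1) by (auto simp: tensor_carrier free_carrier)
qed

text \<open>The universal property. The additive extension of \<open>f\<close> to formal sums kills the generators of the
  relations, since each is a difference of two elements with the same image.\<close>

lemma ex_tensor_lift:
  assumes N: "abelian_group N" and f: "balanced L K V N f"
  shows "\<exists>h\<in>hom (add_monoid T) (add_monoid N). \<forall>a\<in>carrier L. \<forall>v\<in>carrier V. h (tens L K V a v) = f a v"
proof -
  interpret N: abelian_group N by fact
  have fc: "(\<lambda>(a, v). f a v) ` (carrier L \<times> carrier V) \<subseteq> carrier (add_monoid N)"
    using f by (auto simp: balanced_def)
  obtain h where h: "h \<in> hom (free_Abelian_group (carrier L \<times> carrier V)) (add_monoid N)"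
    and h_of: "\<And>x. x \<in> carrier L \<times> carrier V \<Longrightarrow> h (frag_of x) = (\<lambda>(a, v). f a v) x"
    using comm_group.free_Abelian_group_universal[OF N.a_comm_group fc] by blast
  have hhom: "h \<in> hom FV (add_monoid N)" using h by (simp add: tensor_free_def)
  interpret gh: group_hom FV "add_monoid N" h
    by (intro group_hom.intro group_hom_axioms.intro group_free N.a_group hhom)
  have hc: "h c \<in> carrier N" if "c \<in> carrier FV" for c using gh.hom_closed[OF that] by simp
  have hadd: "h (c + d) = h c \<oplus>\<^bsub>N\<^esub> h d" if "c \<in> carrier FV" "d \<in> carrier FV" for c d
    using gh.hom_mult[OF that] by simp
  have hof: "h (frag_of (a, v)) = f a v" if "a \<in> carrier L" "v \<in> carrier V" for a v
    using h_of[of "(a, v)"] that by simp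
  have diff: "h (c - d) = \<zero>\<^bsub>N\<^esub>" if "c \<in> carrier FV" "d \<in> carrier FV" "h c = h d" for c d
  proof -
    have "h c = h (c - d) \<oplus>\<^bsub>N\<^esub> h d" using hadd[OF free_diff[OF that(1,2)] that(2)] by simp
    then show ?thesis
      using N.add.r_cancel_one'[OF hc[OF that(2)] hc[OF free_diff[OF that(1,2)]]] that(3) by simp
  qed
  have "h c = \<zero>\<^bsub>N\<^esub>" if c: "c \<in> gens" for c
    using c
  proof (cases rule: gens_cases)
    case left then show ?thesis using f unfolding diff_diff_eq
      by (auto intro!: diff free_of free_add simp: hof hadd free_of balanced_def)
  next
    case right then show ?thesis using f unfolding diff_diff_eq
      by (auto intro!: diff free_of free_add V_add_closed simp: hof hadd free_of V_add_closed balanced_def)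
  next
    case scalar then show ?thesis using f
      by (auto intro!: diff free_of V_smult_closed simp: hof V_smult_closed scalar_closed balanced_def)
  qed
  then have "gens \<subseteq> kernel FV (add_monoid N) h"
    using gens_closed unfolding kernel_def by auto
  then have "RV \<subseteq> kernel FV (add_monoid N) h"
    unfolding tensor_rel_generate
    by (intro group.generate_subgroup_incl[OF group_free] gh.subgroup_kernel)
  then obtain k where k: "k \<in> hom (FV Mod RV) (add_monoid N)"
    "\<And>x. x \<in> carrier FV \<Longrightarrow> k (RV #>\<^bsub>FV\<^esub> x) = h x"
    using gh.FactGroup_universal_kernel[OF rel_normal] by blast
  have "k \<in> hom (add_monoid T) (add_monoid N)"
    using k(1) by (simp add: hom_def tensor_def Let_def)
  moreover have "k (tens L K V a v) = f a v" if "a \<in> carrier L" "v \<in> carrier V" for a v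
    using that by (simp add: tens_def k(2) free_of hof)
  ultimately show ?thesis by blast
qed

end

definition tensor_lift ::
    "('l, 'm) ring_scheme \<Rightarrow> 'l set \<Rightarrow> ('l, 'v) module \<Rightarrow> ('n, 'q) ring_scheme \<Rightarrow> ('l \<Rightarrow> 'v \<Rightarrow> 'n)
      \<Rightarrow> (('l \<times> 'v) \<Rightarrow>\<^sub>0 int) set \<Rightarrow> 'n" where
  "tensor_lift L K V N f = (SOME h. h \<in> hom (add_monoid (tensor L K V)) (add_monoid N) \<and>
     (\<forall>a\<in>carrier L. \<forall>v\<in>carrier V. h (tens L K V a v) = f a v))"

context scalar_extension begin

lemma tensor_lift:
  assumes "abelian_group N" "balanced L K V N f"
  shows tensor_lift_hom: "tensor_lift L K V N f \<in> hom (add_monoid T) (add_monoid N)"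
    and tensor_lift_tens: "a \<in> carrier L \<Longrightarrow> v \<in> carrier V \<Longrightarrow> tensor_lift L K V N f (tens L K V a v) = f a v"
  using someI_ex[OF ex_tensor_lift[OF assms, unfolded Bex_def]] unfolding tensor_lift_def by auto

lemma tensor_lift_closed:
  assumes "abelian_group N" "balanced L K V N f" "t \<in> carrier T"
  shows "tensor_lift L K V N f t \<in> carrier N"
  using tensor_lift_hom[OF assms(1,2)] assms(3) by (auto simp: hom_def)

lemma tensor_lift_add:
  assumes "abelian_group N" "balanced L K V N f" "s \<in> carrier T" "t \<in> carrier T"
  shows "tensor_lift L K V N f (s \<oplus>\<^bsub>T\<^esub> t) = tensor_lift L K V N f s \<oplus>\<^bsub>N\<^esub> tensor_lift L K V N f t"
  using tensor_lift_hom[OF assms(1,2)] assms(3,4) by (auto simp: hom_def)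

context
  fixes W :: "('l, 'w) module" and \<alpha> r
  assumes W: "Module.module (L\<lparr>carrier := K\<rparr>) W" and \<alpha>: "scalar_linear L K \<alpha>"
    and r: "r \<in> linear_maps (L\<lparr>carrier := K\<rparr>) V W"
begin

interpretation W: scalar_extension L K W
  by (intro scalar_extension.intro scalar_extension_axioms.intro is_cring scalars W)

private abbreviation "ph \<equiv> frag_extend (\<lambda>(l, v). frag_of (\<alpha> l, r v))"

private lemma
  shows ac: "\<And>a. a \<in> carrier L \<Longrightarrow> \<alpha> a \<in> carrier L"
    and aa: "\<And>a b. a \<in> carrier L \<Longrightarrow> b \<in> carrier L \<Longrightarrow> \<alpha> (a \<oplus> b) = \<alpha> a \<oplus> \<alpha> b"
    and ak: "\<And>a k. a \<in> carrier L \<Longrightarrow> k \<in> K \<Longrightarrow> \<alpha> (a \<otimes> k) = \<alpha> a \<otimes> k"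
    and rc: "\<And>v. v \<in> carrier V \<Longrightarrow> r v \<in> carrier W"
    and ra: "\<And>v w. v \<in> carrier V \<Longrightarrow> w \<in> carrier V \<Longrightarrow> r (v \<oplus>\<^bsub>V\<^esub> w) = r v \<oplus>\<^bsub>W\<^esub> r w"
    and rk: "\<And>k v. k \<in> K \<Longrightarrow> v \<in> carrier V \<Longrightarrow> r (k \<odot>\<^bsub>V\<^esub> v) = k \<odot>\<^bsub>W\<^esub> r v"
  using \<alpha> linear_maps_closed[OF r] linear_maps_add[OF r] linear_maps_smult[OF r]
  unfolding scalar_linear_def by auto

private lemma ph_closed:
  assumes "c \<in> carrier FV" shows "ph c \<in> carrier W.FV"
  unfolding W.free_carrier
proof (rule order_trans[OF keys_frag_extend], rule UN_least)
  fix x assume "x \<in> Poly_Mapping.keys c"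
  then have "x \<in> carrier L \<times> carrier V" using assms by (auto simp: free_carrier)
  then show "Poly_Mapping.keys ((\<lambda>(l, v). frag_of (\<alpha> l, r v)) x) \<subseteq> carrier L \<times> carrier W"
    using ac rc by (auto simp: keys_frag_of)
qed

private lemma ph_gens: assumes "c \<in> gens" shows "ph c \<in> W.gens"
  using assms
proof (cases rule: gens_cases)
  case (left a b v)
  then have "ph c = frag_of (\<alpha> a \<oplus> \<alpha> b, r v) - frag_of (\<alpha> a, r v) - frag_of (\<alpha> b, r v)"
    by (simp add: frag_extend_diff aa)
  then show ?thesis using left ac rc unfolding W.gens_def by blast
next
  case (right a v w)
  then have "ph c = frag_of (\<alpha> a, r v \<oplus>\<^bsub>W\<^esub> r w) - frag_of (\<alpha> a, r v) - frag_of (\<alpha> a, r w)"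
    by (simp add: frag_extend_diff ra)
  then show ?thesis using right ac rc unfolding W.gens_def by blast
next
  case (scalar a k v)
  then have "ph c = frag_of (\<alpha> a \<otimes> k, r v) - frag_of (\<alpha> a, k \<odot>\<^bsub>W\<^esub> r v)"
    by (simp add: frag_extend_diff ak rk)
  then show ?thesis using scalar ac rc unfolding W.gens_def by blast
qed

private lemma ph_rel: assumes "c \<in> RV" shows "ph c \<in> W.RV"
proof -
  have "c \<in> generate FV gens" using assms by (simp add: tensor_rel_generate)
  then show ?thesis
  proof (induction rule: generate.induct)
    case one
    then show ?case using subgroup.one_closed[OF W.rel_subgroup] by simp
  next
    case (incl c)
    then show ?case using ph_gens W.rel_gen by blast
  next
    case (inv c)
    then have "c \<in> carrier FV" using gens_closed by blast
    then have "inv\<^bsub>FV\<^esub> c = - c" by (simp add: tensor_free_def)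
    moreover have "inv\<^bsub>W.FV\<^esub> (ph c) = - ph c"
      using ph_closed[OF \<open>c \<in> carrier FV\<close>] by (simp add: tensor_free_def)
    moreover have "inv\<^bsub>W.FV\<^esub> (ph c) \<in> W.RV"
      by (rule subgroup.m_inv_closed[OF W.rel_subgroup W.rel_gen[OF ph_gens[OF inv]]])
    ultimately show ?case by (simp add: frag_extend_minus)
  next
    case (eng c d)
    then show ?case using subgroup.m_closed[OF W.rel_subgroup] by (simp add: frag_extend_add)
  qed
qed

text \<open>As \<open>\<alpha> \<otimes> r\<close> maps relations to relations, all representatives of a coset contribute the same coset
  to the union that defines \<open>tensor_map\<close>.\<close>

private lemma tensor_map_coset:
  assumes c: "c \<in> carrier FV"
  shows "tensor_map L K W \<alpha> r (RV #>\<^bsub>FV\<^esub> c) = W.RV #>\<^bsub>W.FV\<^esub> ph c"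
proof -
  have "W.RV #>\<^bsub>W.FV\<^esub> ph d = W.RV #>\<^bsub>W.FV\<^esub> ph c" if d: "d \<in> RV #>\<^bsub>FV\<^esub> c" for d
  proof -
    obtain s where s: "s \<in> RV" "d = s + c" using d by (auto simp: r_coset_def)
    have sF: "s \<in> carrier FV" using s(1) subgroup.mem_carrier[OF rel_subgroup] by blast
    show ?thesis
      using s ph_rel[OF s(1)] free_add[OF sF c] c
      by (intro W.coset_eqI ph_closed) (auto simp: frag_extend_add)
  qed
  moreover have "c \<in> RV #>\<^bsub>FV\<^esub> c"
    by (rule group.rcos_self[OF group_free c rel_subgroup])
  ultimately show ?thesis unfolding tensor_map_def by blast
qed

lemma tensor_map_tens:
  "a \<in> carrier L \<Longrightarrow> v \<in> carrier V \<Longrightarrow> tensor_map L K W \<alpha> r (tens L K V a v) = tens L K W (\<alpha> a) (r v)"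
  by (simp add: tens_def tensor_map_coset free_of)

lemma tensor_map_closed: "t \<in> carrier T \<Longrightarrow> tensor_map L K W \<alpha> r t \<in> carrier (tensor L K W)"
  unfolding tensor_carrier by (auto simp: tensor_map_coset intro!: W.coset_closed ph_closed)

lemma tensor_map_add: "s \<in> carrier T \<Longrightarrow> t \<in> carrier T \<Longrightarrow>
    tensor_map L K W \<alpha> r (s \<oplus>\<^bsub>T\<^esub> t) = tensor_map L K W \<alpha> r s \<oplus>\<^bsub>tensor L K W\<^esub> tensor_map L K W \<alpha> r t"
  by (auto simp: tensor_carrier tensor_map_coset tensor_add W.tensor_add ph_closed free_add frag_extend_add)

end

lemma scalar_linear_mult: "a \<in> carrier L \<Longrightarrow> scalar_linear L K (\<lambda>l. a \<otimes> l)"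
  by (auto simp: scalar_linear_def r_distr m_assoc scalar_closed)

lemma scalar_linear_id: "scalar_linear L K (\<lambda>l. l)"
  by (auto simp: scalar_linear_def)

lemma linear_maps_id: "(\<lambda>v. v) \<in> linear_maps R V V"
  by (rule linear_mapsI) auto

lemma smult_tens:
  "a \<in> carrier L \<Longrightarrow> b \<in> carrier L \<Longrightarrow> v \<in> carrier V \<Longrightarrow> a \<odot>\<^bsub>T\<^esub> tens L K V b v = tens L K V (a \<otimes> b) v"
  by (simp add: tensor_smult tensor_map_tens[OF mod scalar_linear_mult linear_maps_id])

lemma smult_closed: "a \<in> carrier L \<Longrightarrow> t \<in> carrier T \<Longrightarrow> a \<odot>\<^bsub>T\<^esub> t \<in> carrier T"
  by (simp add: tensor_smult tensor_map_closed[OF mod scalar_linear_mult linear_maps_id])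

lemma smult_add: "a \<in> carrier L \<Longrightarrow> s \<in> carrier T \<Longrightarrow> t \<in> carrier T
    \<Longrightarrow> a \<odot>\<^bsub>T\<^esub> (s \<oplus>\<^bsub>T\<^esub> t) = a \<odot>\<^bsub>T\<^esub> s \<oplus>\<^bsub>T\<^esub> a \<odot>\<^bsub>T\<^esub> t"
  by (simp add: tensor_smult tensor_map_add[OF mod scalar_linear_mult linear_maps_id])

lemma tensor_module: "Module.module L T"
proof (rule moduleI[OF is_cring abelian_tensor])
  interpret T: abelian_group T by (rule abelian_tensor)
  fix a b t assume ab: "a \<in> carrier L" "b \<in> carrier L" and t: "t \<in> carrier T"
  show "(a \<oplus> b) \<odot>\<^bsub>T\<^esub> t = a \<odot>\<^bsub>T\<^esub> t \<oplus>\<^bsub>T\<^esub> b \<odot>\<^bsub>T\<^esub> t"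
    using t
  proof (induction rule: tensor_induct)
    case (add s t)
    have "(a \<oplus> b) \<odot>\<^bsub>T\<^esub> (s \<oplus>\<^bsub>T\<^esub> t) = (a \<odot>\<^bsub>T\<^esub> s \<oplus>\<^bsub>T\<^esub> b \<odot>\<^bsub>T\<^esub> s) \<oplus>\<^bsub>T\<^esub> (a \<odot>\<^bsub>T\<^esub> t \<oplus>\<^bsub>T\<^esub> b \<odot>\<^bsub>T\<^esub> t)"
      using add ab by (simp add: smult_add)
    also have "\<dots> = (a \<odot>\<^bsub>T\<^esub> s \<oplus>\<^bsub>T\<^esub> a \<odot>\<^bsub>T\<^esub> t) \<oplus>\<^bsub>T\<^esub> (b \<odot>\<^bsub>T\<^esub> s \<oplus>\<^bsub>T\<^esub> b \<odot>\<^bsub>T\<^esub> t)"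
      using add ab by (simp add: smult_closed T.a_ac)
    finally show ?case using add ab by (simp add: smult_add)
  qed (use ab in \<open>simp add: smult_tens tens_add_left l_distr\<close>)
  show "(a \<otimes> b) \<odot>\<^bsub>T\<^esub> t = a \<odot>\<^bsub>T\<^esub> (b \<odot>\<^bsub>T\<^esub> t)"
    using t by (induction rule: tensor_induct)
      (use ab in \<open>auto simp: smult_tens m_assoc smult_add smult_closed\<close>)
next
  fix t assume "t \<in> carrier T"
  then show "\<one> \<odot>\<^bsub>T\<^esub> t = t"
    by (induction rule: tensor_induct) (auto simp: smult_tens smult_add)
qed (auto simp: smult_closed smult_add)

end

section \<open>Descent of vector spaces\<close>

lemma (in abelian_group) msum_map_add:
  assumes "\<And>p. p \<in> set ps \<Longrightarrow> f p \<in> carrier G" "\<And>p. p \<in> set ps \<Longrightarrow> h p \<in> carrier G"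
  shows "msum G (map (\<lambda>p. f p \<oplus> h p) ps) = msum G (map f ps) \<oplus> msum G (map h ps)"
  using assms
proof (induction ps)
  case (Cons p ps)
  have "msum G (map f ps) \<in> carrier G" "msum G (map h ps) \<in> carrier G"
    using Cons.prems by (auto intro!: msum_closed)
  then show ?case using Cons by (simp add: a_ac)
qed simp

text \<open>Stated for additive maps, so that it serves scalar multiplication, the Galois action, and the maps
  \<open>a \<mapsto> a v\<close> and \<open>a \<mapsto> a \<otimes> v\<close> alike.\<close>

lemma additive_finsum:
  assumes "abelian_group M" "abelian_group N" "finite A" "f \<in> A \<rightarrow> carrier M"
    and closed: "\<And>v. v \<in> carrier M \<Longrightarrow> h v \<in> carrier N"
    and add: "\<And>v w. v \<in> carrier M \<Longrightarrow> w \<in> carrier M \<Longrightarrow> h (v \<oplus>\<^bsub>M\<^esub> w) = h v \<oplus>\<^bsub>N\<^esub> h w"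
  shows "h (finsum M f A) = finsum N (\<lambda>x. h (f x)) A"
proof -
  interpret M: abelian_group M by fact
  interpret N: abelian_group N by fact
  have zero: "h \<zero>\<^bsub>M\<^esub> = \<zero>\<^bsub>N\<^esub>"
    by (rule additive_zero[OF assms(1,2) closed[OF M.zero_closed] add[OF M.zero_closed M.zero_closed]])
  show ?thesis using assms(3,4)
  proof (induction A rule: finite_induct)
    case (insert a A)
    then have "f a \<in> carrier M" "f \<in> A \<rightarrow> carrier M" "(\<lambda>x. h (f x)) \<in> A \<rightarrow> carrier N" "h (f a) \<in> carrier N"
      using closed by auto
    then show ?case using insert by (simp add: add)
  qed (simp add: zero)
qed

context galois begin

text \<open>Semilinearity turns \<open>\<Sum>\<^sub>i x\<^sub>i \<Sum>\<^sub>g g(y\<^sub>i v)\<close> into \<open>\<Sum>\<^sub>g (\<Sum>\<^sub>i x\<^sub>i g(y\<^sub>i)) g(v)\<close>,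
  where only the identity survives. The scalar multiplication \<open>sm\<close> is a variable so that \<open>L\<close>, which is
  a ring record and not a module record, can play the part of \<open>M\<close>.\<close>

lemma coord_expansion:
  fixes M :: "('w, 'q) ring_scheme"
  assumes M: "abelian_group M"
    and sm_closed: "\<And>a v. a \<in> carrier L \<Longrightarrow> v \<in> carrier M \<Longrightarrow> sm a v \<in> carrier M"
    and sm_add_l: "\<And>a b v. a \<in> carrier L \<Longrightarrow> b \<in> carrier L \<Longrightarrow> v \<in> carrier M \<Longrightarrow> sm (a \<oplus> b) v = sm a v \<oplus>\<^bsub>M\<^esub> sm b v"
    and sm_add_r: "\<And>a v w. a \<in> carrier L \<Longrightarrow> v \<in> carrier M \<Longrightarrow> w \<in> carrier M \<Longrightarrow> sm a (v \<oplus>\<^bsub>M\<^esub> w) = sm a v \<oplus>\<^bsub>M\<^esub> sm a w"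
    and sm_mult: "\<And>a b v. a \<in> carrier L \<Longrightarrow> b \<in> carrier L \<Longrightarrow> v \<in> carrier M \<Longrightarrow> sm (a \<otimes> b) v = sm a (sm b v)"
    and sm_one: "\<And>v. v \<in> carrier M \<Longrightarrow> sm \<one> v = v"
    and rho_closed: "\<And>g v. g \<in> Gal \<Longrightarrow> v \<in> carrier M \<Longrightarrow> \<rho> g v \<in> carrier M"
    and rho_sm: "\<And>g a v. g \<in> Gal \<Longrightarrow> a \<in> carrier L \<Longrightarrow> v \<in> carrier M \<Longrightarrow> \<rho> g (sm a v) = sm (g a) (\<rho> g v)"
    and rho_one: "\<And>v. v \<in> carrier M \<Longrightarrow> \<rho> gal_one v = v"
    and v: "v \<in> carrier M"
  shows "msum M (map (\<lambda>(x, y). sm x (finsum M (\<lambda>g. \<rho> g (sm y v)) Gal)) coords) = v"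
proof -
  interpret M: abelian_group M by fact
  have sm_zero: "sm \<zero> w = \<zero>\<^bsub>M\<^esub>" if "w \<in> carrier M" for w
    by (rule additive_zero[of L M "\<lambda>a. sm a w"])
       (use that M in \<open>auto simp: sm_closed sm_add_l[symmetric] is_abelian_group\<close>)
  have "msum M (map (\<lambda>(x, y). sm x (finsum M (\<lambda>g. \<rho> g (sm y v)) Gal)) ps)
      = finsum M (\<lambda>g. sm (coord_sum ps g) (\<rho> g v)) Gal" if "set ps \<subseteq> carrier L \<times> carrier L" for ps
    using that
  proof (induction ps)
    case Nil
    have "finsum M (\<lambda>g. sm (coord_sum [] g) (\<rho> g v)) Gal = finsum M (\<lambda>g. \<zero>\<^bsub>M\<^esub>) Gal"
      using v by (intro M.finsum_cong') (auto simp: coord_sum_def sm_zero rho_closed)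
    then show ?case by simp
  next
    case (Cons p ps)
    obtain x y where p: "p = (x, y)" by force
    have xy: "x \<in> carrier L" "y \<in> carrier L" and ps: "set ps \<subseteq> carrier L \<times> carrier L" using Cons p by auto
    have "sm x (finsum M (\<lambda>g. \<rho> g (sm y v)) Gal) = finsum M (\<lambda>g. sm x (\<rho> g (sm y v))) Gal"
      using xy v by (intro additive_finsum M finite_Gal) (auto simp: sm_closed rho_closed sm_add_r)
    also have "\<dots> = finsum M (\<lambda>g. sm (x \<otimes> g y) (\<rho> g v)) Gal"
      using xy v by (intro M.finsum_cong') (auto simp: sm_closed rho_closed rho_sm sm_mult)
    finally have "msum M (map (\<lambda>(x, y). sm x (finsum M (\<lambda>g. \<rho> g (sm y v)) Gal)) (p # ps))
        = finsum M (\<lambda>g. sm (x \<otimes> g y) (\<rho> g v)) Gal \<oplus>\<^bsub>M\<^esub> finsum M (\<lambda>g. sm (coord_sum ps g) (\<rho> g v)) Gal"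
      using Cons.IH[OF ps] p by simp
    also have "\<dots> = finsum M (\<lambda>g. sm (x \<otimes> g y) (\<rho> g v) \<oplus>\<^bsub>M\<^esub> sm (coord_sum ps g) (\<rho> g v)) Gal"
      using xy v ps by (intro M.finsum_addf[symmetric]) (auto simp: sm_closed rho_closed coord_sum_closed)
    also have "\<dots> = finsum M (\<lambda>g. sm (coord_sum (p # ps) g) (\<rho> g v)) Gal"
      using xy v ps coord_sum_closed[OF ps] p
      by (intro M.finsum_cong') (auto simp: sm_closed rho_closed sm_add_l coord_sum_def)
    finally show ?case .
  qed
  then have "msum M (map (\<lambda>(x, y). sm x (finsum M (\<lambda>g. \<rho> g (sm y v)) Gal)) coords)
      = finsum M (\<lambda>g. sm (coord_sum coords g) (\<rho> g v)) Gal"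
    using coords_closed by blast
  also have "\<dots> = finsum M (\<lambda>g. if gal_one = g then \<rho> g v else \<zero>\<^bsub>M\<^esub>) Gal"
    using v by (intro M.finsum_cong') (auto simp: coord_sum_coords rho_closed sm_zero sm_one)
  also have "\<dots> = \<rho> gal_one v"
    using v by (intro M.finsum_singleton gal_one_in finite_Gal) (auto simp: rho_closed)
  finally show ?thesis using v rho_one by simp
qed

lemma tr_expansion:
  assumes "l \<in> carrier L" shows "msum L (map (\<lambda>(x, y). x \<otimes> tr (y \<otimes> l)) coords) = l"
  unfolding tr_def
  by (rule coord_expansion[where sm = "(\<otimes>)" and \<rho> = "\<lambda>g. g"])
     (use assms in \<open>auto simp: l_distr r_distr m_assoc gal_mult is_abelian_group\<close>)

text \<open>If the traces of all \<open>y\<^sub>i\<close> vanished, the expansion of \<open>1\<close> would be \<open>0\<close>. A non-zero trace can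
  be scaled to \<open>1\<close> because it lies in \<open>K\<close>.\<close>

lemma ex_tr_one: "\<exists>c\<in>carrier L. tr c = \<one>"
proof -
  have "\<exists>(x, y)\<in>set coords. tr (y \<otimes> \<one>) \<noteq> \<zero>"
  proof (rule ccontr)
    assume neg: "\<not> ?thesis"
    have "msum L (map (\<lambda>(x, y). x \<otimes> tr (y \<otimes> \<one>)) ps) = \<zero>"
      if "set ps \<subseteq> set coords" for ps
      using that by (induction ps) (use neg coords_closed in \<open>auto 0 3\<close>)
    then show False using tr_expansion[OF one_closed] by simp
  qed
  then obtain x y where xy: "(x, y) \<in> set coords" "tr (y \<otimes> \<one>) \<noteq> \<zero>" by blast
  then have y: "y \<in> carrier L" "tr y \<noteq> \<zero>" using coords_closed by auto
  then have k: "tr y \<in> K - {\<zero>}" using tr_in_K by simp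
  then have "tr (inv (tr y) \<otimes> y) = \<one>"
    using tr_scale subfield_m_inv[OF subfield_K k] y by simp
  moreover have "inv (tr y) \<otimes> y \<in> carrier L"
    using subfield_m_inv(1)[OF subfield_K k] K_closed y by simp
  ultimately show ?thesis by blast
qed

definition unit_trace :: 'a where "unit_trace = (SOME c. c \<in> carrier L \<and> tr c = \<one>)"

lemma unit_trace: "unit_trace \<in> carrier L" "tr unit_trace = \<one>"
  using someI_ex[of "\<lambda>c. c \<in> carrier L \<and> tr c = \<one>"] ex_tr_one unfolding unit_trace_def by auto

lemma scalar_linear_gal: "g \<in> Gal \<Longrightarrow> scalar_linear L K g"
  by (auto simp: scalar_linear_def gal_add gal_mult gal_fixes K_closed)

end

locale galois_space = galois L K for L :: "('l, 'm) ring_scheme" (structure) and K +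
  fixes V :: "('l, 'v) module"
  assumes modV: "Module.module (L\<lparr>carrier := K\<rparr>) V"
begin

sublocale scalar_extension L K V
  by (intro scalar_extension.intro scalar_extension_axioms.intro is_cring K_subset modV)

text \<open>This is \<open>tr(y _) \<otimes> id: L \<otimes> V \<rightarrow> K \<otimes> V = V\<close>.\<close>

definition tr_func :: "'l \<Rightarrow> (('l \<times> 'v) \<Rightarrow>\<^sub>0 int) set \<Rightarrow> 'v" where
  "tr_func y = tensor_lift L K V V (\<lambda>l v. tr (y \<otimes> l) \<odot>\<^bsub>V\<^esub> v)"

lemma V_smult_assoc: "k \<in> K \<Longrightarrow> j \<in> K \<Longrightarrow> v \<in> carrier V \<Longrightarrow> (k \<otimes> j) \<odot>\<^bsub>V\<^esub> v = k \<odot>\<^bsub>V\<^esub> (j \<odot>\<^bsub>V\<^esub> v)"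
  using Module.module.smult_assoc1[OF modV] by simp

lemma V_smult_one: "v \<in> carrier V \<Longrightarrow> \<one> \<odot>\<^bsub>V\<^esub> v = v"
  using Module.module.smult_one[OF modV] by simp

lemma V_smult_add_left: "k \<in> K \<Longrightarrow> j \<in> K \<Longrightarrow> v \<in> carrier V \<Longrightarrow> (k \<oplus> j) \<odot>\<^bsub>V\<^esub> v = k \<odot>\<^bsub>V\<^esub> v \<oplus>\<^bsub>V\<^esub> j \<odot>\<^bsub>V\<^esub> v"
  using Module.module.smult_l_distr[OF modV] by simp

lemma V_smult_add_right: "k \<in> K \<Longrightarrow> v \<in> carrier V \<Longrightarrow> w \<in> carrier V \<Longrightarrow> k \<odot>\<^bsub>V\<^esub> (v \<oplus>\<^bsub>V\<^esub> w) = k \<odot>\<^bsub>V\<^esub> v \<oplus>\<^bsub>V\<^esub> k \<odot>\<^bsub>V\<^esub> w"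
  using Module.module.smult_r_distr[OF modV] by simp

lemma balanced_tr:
  assumes y: "y \<in> carrier L" shows "balanced L K V V (\<lambda>l v. tr (y \<otimes> l) \<odot>\<^bsub>V\<^esub> v)"
  unfolding balanced_def
proof (intro conjI ballI)
  fix a k v assume *: "a \<in> carrier L" "k \<in> K" "v \<in> carrier V"
  have "tr (y \<otimes> (a \<otimes> k)) = tr (k \<otimes> (y \<otimes> a))"
    using * y by (simp add: m_ac K_closed)
  also have "\<dots> = tr (y \<otimes> a) \<otimes> k"
    using * y by (simp add: tr_scale m_comm K_closed)
  finally show "tr (y \<otimes> (a \<otimes> k)) \<odot>\<^bsub>V\<^esub> v = tr (y \<otimes> a) \<odot>\<^bsub>V\<^esub> (k \<odot>\<^bsub>V\<^esub> v)"
    using * y by (simp add: V_smult_assoc tr_in_K)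
qed (use y in \<open>auto simp: V_smult_closed V_add_closed tr_in_K r_distr tr_add
      V_smult_add_left V_smult_add_right\<close>)

lemma tr_func_tens:
  "y \<in> carrier L \<Longrightarrow> a \<in> carrier L \<Longrightarrow> v \<in> carrier V \<Longrightarrow> tr_func y (tens L K V a v) = tr (y \<otimes> a) \<odot>\<^bsub>V\<^esub> v"
  unfolding tr_func_def by (rule tensor_lift_tens[OF abelian_V balanced_tr])

lemma tr_func_closed: "y \<in> carrier L \<Longrightarrow> t \<in> carrier T \<Longrightarrow> tr_func y t \<in> carrier V"
  unfolding tr_func_def by (rule tensor_lift_closed[OF abelian_V balanced_tr])

lemma tr_func_add: "y \<in> carrier L \<Longrightarrow> s \<in> carrier T \<Longrightarrow> t \<in> carrier T
    \<Longrightarrow> tr_func y (s \<oplus>\<^bsub>T\<^esub> t) = tr_func y s \<oplus>\<^bsub>V\<^esub> tr_func y t"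
  unfolding tr_func_def by (rule tensor_lift_add[OF abelian_V balanced_tr])

text \<open>The dual basis property of the coordinates, tensored with \<open>V\<close>.\<close>

lemma tensor_expansion:
  assumes "t \<in> carrier T"
  shows "msum T (map (\<lambda>(x, y). tens L K V x (tr_func y t)) coords) = t"
  using assms
proof (induction rule: tensor_induct)
  case (tens a v)
  have "msum T (map (\<lambda>(x, y). tens L K V x (tr_func y (tens L K V a v))) ps)
      = tens L K V (msum L (map (\<lambda>(x, y). x \<otimes> tr (y \<otimes> a)) ps)) v"
    if "set ps \<subseteq> carrier L \<times> carrier L" for ps
    using that
  proof (induction ps)
    case Nil
    then show ?case using tens by (simp add: tens_zero_left)
  next
    case (Cons p ps)
    obtain x y where p: "p = (x, y)" by force
    have "msum L (map (\<lambda>(x, y). x \<otimes> tr (y \<otimes> a)) ps) \<in> carrier L"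
      using Cons.prems tens by (intro msum_closed) auto
    then show ?case using Cons p tens
      by (auto simp: tr_func_tens tens_balanced[symmetric] tr_in_K tens_add_left)
  qed
  then show ?case using coords_closed tr_expansion[OF tens(1)] by simp
next
  case (add s t)
  interpret T: abelian_group T by (rule abelian_tensor)
  have "msum T (map (\<lambda>(x, y). tens L K V x (tr_func y (s \<oplus>\<^bsub>T\<^esub> t))) coords)
      = msum T (map (\<lambda>p. (case p of (x, y) \<Rightarrow> tens L K V x (tr_func y s))
           \<oplus>\<^bsub>T\<^esub> (case p of (x, y) \<Rightarrow> tens L K V x (tr_func y t))) coords)"
    using add coords_closed
    by (intro arg_cong[where f = "msum T"] map_cong)
       (auto simp: tr_func_add tr_func_closed tens_add_right)
  also have "\<dots> = s \<oplus>\<^bsub>T\<^esub> t"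
    using coords_closed add
    by (subst T.msum_map_add) (auto intro!: tens_closed tr_func_closed)
  finally show ?case .
qed

lemma tensor_eqI:
  assumes "s \<in> carrier T" "t \<in> carrier T" "\<And>y. y \<in> carrier L \<Longrightarrow> tr_func y s = tr_func y t"
  shows "s = t"
proof -
  have "map (\<lambda>(x, y). tens L K V x (tr_func y s)) coords = map (\<lambda>(x, y). tens L K V x (tr_func y t)) coords"
    using assms(3) coords_closed by (intro map_cong) auto
  then show ?thesis using tensor_expansion assms(1,2) by metis
qed

subsection \<open>The Galois action on a tensor product\<close>

abbreviation gal_tensor :: "('l \<Rightarrow> 'l) \<Rightarrow> (('l \<times> 'v) \<Rightarrow>\<^sub>0 int) set \<Rightarrow> (('l \<times> 'v) \<Rightarrow>\<^sub>0 int) set" where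
  "gal_tensor g \<equiv> tensor_map L K V g (\<lambda>v. v)"

lemma gal_tensor_tens:
  "g \<in> Gal \<Longrightarrow> a \<in> carrier L \<Longrightarrow> v \<in> carrier V \<Longrightarrow> gal_tensor g (tens L K V a v) = tens L K V (g a) v"
  by (rule tensor_map_tens[OF modV scalar_linear_gal linear_maps_id])

lemma gal_tensor_closed: "g \<in> Gal \<Longrightarrow> t \<in> carrier T \<Longrightarrow> gal_tensor g t \<in> carrier T"
  by (rule tensor_map_closed[OF modV scalar_linear_gal linear_maps_id])

lemma gal_tensor_add: "g \<in> Gal \<Longrightarrow> s \<in> carrier T \<Longrightarrow> t \<in> carrier T
    \<Longrightarrow> gal_tensor g (s \<oplus>\<^bsub>T\<^esub> t) = gal_tensor g s \<oplus>\<^bsub>T\<^esub> gal_tensor g t"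
  by (rule tensor_map_add[OF modV scalar_linear_gal linear_maps_id])

lemma gal_tensor_smult:
  assumes g: "g \<in> Gal" and a: "a \<in> carrier L" and t: "t \<in> carrier T"
  shows "gal_tensor g (a \<odot>\<^bsub>T\<^esub> t) = g a \<odot>\<^bsub>T\<^esub> gal_tensor g t"
  using t by (induction rule: tensor_induct)
    (use g a in \<open>auto simp: smult_tens gal_tensor_tens gal_mult smult_add gal_tensor_add smult_closed gal_tensor_closed\<close>)

lemma gal_tensor_comp:
  assumes g: "g \<in> Gal" and h: "h \<in> Gal" and t: "t \<in> carrier T"
  shows "gal_tensor (compose (carrier L) g h) t = gal_tensor g (gal_tensor h t)"
  using t by (induction rule: tensor_induct)
    (use gal_comp[OF g h] g h in \<open>auto simp: gal_tensor_tens compose_eq gal_tensor_add gal_tensor_closed\<close>)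

lemma gal_tensor_one:
  assumes t: "t \<in> carrier T" shows "gal_tensor gal_one t = t"
  using t by (induction rule: tensor_induct)
    (auto simp: gal_tensor_tens gal_one_in gal_tensor_add)

text \<open>On pure tensors both sides are \<open>tr(c a) \<otimes> v\<close>, because the trace lies in \<open>K\<close> and moves across the
  tensor sign.\<close>

lemma tens_one_tr_func:
  assumes c: "c \<in> carrier L" and t: "t \<in> carrier T"
  shows "tens L K V \<one> (tr_func c t) = finsum T (\<lambda>g. gal_tensor g (c \<odot>\<^bsub>T\<^esub> t)) Gal"
proof -
  interpret T: abelian_group T by (rule abelian_tensor)
  show ?thesis using t
  proof (induction rule: tensor_induct)
    case (tens a v)
    have "tens L K V \<one> (tr_func c (tens L K V a v)) = tens L K V (tr (c \<otimes> a)) v"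
      using tens c by (simp add: tr_func_tens tens_balanced[symmetric] tr_in_K)
    also have "\<dots> = finsum T (\<lambda>g. tens L K V (g (c \<otimes> a)) v) Gal"
      unfolding tr_def using tens c
      by (intro additive_finsum is_abelian_group abelian_tensor finite_Gal)
         (auto simp: tens_closed tens_add_left)
    also have "\<dots> = finsum T (\<lambda>g. gal_tensor g (c \<odot>\<^bsub>T\<^esub> tens L K V a v)) Gal"
      using tens c by (intro T.finsum_cong') (auto simp: smult_tens gal_tensor_tens tens_closed)
    finally show ?case .
  next
    case (add s t)
    have "finsum T (\<lambda>g. gal_tensor g (c \<odot>\<^bsub>T\<^esub> (s \<oplus>\<^bsub>T\<^esub> t))) Gal
        = finsum T (\<lambda>g. gal_tensor g (c \<odot>\<^bsub>T\<^esub> s) \<oplus>\<^bsub>T\<^esub> gal_tensor g (c \<odot>\<^bsub>T\<^esub> t)) Gal"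
      using add c by (intro T.finsum_cong') (auto simp: smult_add gal_tensor_add smult_closed gal_tensor_closed)
    also have "\<dots> = finsum T (\<lambda>g. gal_tensor g (c \<odot>\<^bsub>T\<^esub> s)) Gal \<oplus>\<^bsub>T\<^esub> finsum T (\<lambda>g. gal_tensor g (c \<odot>\<^bsub>T\<^esub> t)) Gal"
      using add c by (intro T.finsum_addf) (auto simp: smult_closed gal_tensor_closed)
    finally show ?case using add c by (simp add: tr_func_add tens_add_right tr_func_closed)
  qed
qed

text \<open>For invariant \<open>t\<close> the sum of all \<open>g(c t) = g(c) t\<close> is \<open>tr(c) t\<close>, and the preceding identity
  rewrites that sum as a tensor with first factor \<open>1\<close>.\<close>

lemma gal_invariant_tensor:
  assumes t: "t \<in> carrier T" and inv: "\<And>g. g \<in> Gal \<Longrightarrow> gal_tensor g t = t"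
  shows "tens L K V \<one> (tr_func unit_trace t) = t"
proof -
  interpret T: Module.module L T by (rule tensor_module)
  have "tens L K V \<one> (tr_func unit_trace t) = finsum T (\<lambda>g. g unit_trace \<odot>\<^bsub>T\<^esub> t) Gal"
    unfolding tens_one_tr_func[OF unit_trace(1) t]
    using unit_trace(1) t by (intro T.M.finsum_cong') (auto simp: gal_tensor_smult inv smult_closed)
  also have "\<dots> = finsum L (\<lambda>g. g unit_trace) Gal \<odot>\<^bsub>T\<^esub> t"
    using unit_trace(1) t
    by (intro additive_finsum[symmetric, of L T Gal "\<lambda>g. g unit_trace" "\<lambda>a. a \<odot>\<^bsub>T\<^esub> t"]
          is_abelian_group abelian_tensor finite_Gal)
       (auto simp: smult_closed T.smult_l_distr)
  finally show ?thesis using unit_trace(2) t by (simp add: tr_def)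
qed

lemma tr_func_tens_one: "v \<in> carrier V \<Longrightarrow> tr_func unit_trace (tens L K V \<one> v) = v"
  using unit_trace by (simp add: tr_func_tens V_smult_one)

end

subsection \<open>Semilinear actions\<close>

locale semilinear_action = galois L K for L :: "('l, 'm) ring_scheme" (structure) and K +
  fixes M :: "('l, 'v) module" and \<rho> :: "('l \<Rightarrow> 'l) \<Rightarrow> 'v \<Rightarrow> 'v"
  assumes modM: "Module.module L M"
    and act_closed: "g \<in> Gal \<Longrightarrow> v \<in> carrier M \<Longrightarrow> \<rho> g v \<in> carrier M"
    and act_add: "g \<in> Gal \<Longrightarrow> v \<in> carrier M \<Longrightarrow> w \<in> carrier M \<Longrightarrow> \<rho> g (v \<oplus>\<^bsub>M\<^esub> w) = \<rho> g v \<oplus>\<^bsub>M\<^esub> \<rho> g w"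
    and act_smult: "g \<in> Gal \<Longrightarrow> a \<in> carrier L \<Longrightarrow> v \<in> carrier M \<Longrightarrow> \<rho> g (a \<odot>\<^bsub>M\<^esub> v) = g a \<odot>\<^bsub>M\<^esub> \<rho> g v"
    and act_comp: "g \<in> Gal \<Longrightarrow> h \<in> Gal \<Longrightarrow> v \<in> carrier M \<Longrightarrow> \<rho> (compose (carrier L) g h) v = \<rho> g (\<rho> h v)"
    and act_one: "v \<in> carrier M \<Longrightarrow> \<rho> gal_one v = v"
begin

interpretation M: Module.module L M by (rule modM)

definition invariants :: "('l, 'v) module" where
  "invariants = M\<lparr>carrier := {v \<in> carrier M. \<forall>g\<in>Gal. \<rho> g v = v}\<rparr>"

lemma invariants_carrier: "v \<in> carrier invariants \<longleftrightarrow> v \<in> carrier M \<and> (\<forall>g\<in>Gal. \<rho> g v = v)"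
  by (simp add: invariants_def)

lemma invariants_ops [simp]:
  "add invariants = add M" "zero invariants = zero M" "smult invariants = smult M"
  by (simp_all add: invariants_def)

lemma act_zero: "g \<in> Gal \<Longrightarrow> \<rho> g \<zero>\<^bsub>M\<^esub> = \<zero>\<^bsub>M\<^esub>"
  by (rule additive_zero[of M M]) (auto simp: act_closed act_add[symmetric] M.abelian_group_axioms)

lemma invariants_module: "Module.module (L\<lparr>carrier := K\<rparr>) invariants"
proof (rule moduleI[OF cring_K])
  show "abelian_group invariants"
  proof (rule abelian_groupI, goal_cases)
    case (6 v)
    then have v: "v \<in> carrier M" "\<And>g. g \<in> Gal \<Longrightarrow> \<rho> g v = v" by (auto simp: invariants_carrier)
    let ?w = "(\<ominus> \<one>) \<odot>\<^bsub>M\<^esub> v"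
    have m1: "g (\<ominus> \<one>) = \<ominus> \<one>" if "g \<in> Gal" for g
      using gal_fixes[OF that] subringE(3,5)[OF subfieldE(1)[OF subfield_K]] by blast
    have "\<rho> g ?w = ?w" if g: "g \<in> Gal" for g
    proof -
      have "\<rho> g ?w = g (\<ominus> \<one>) \<odot>\<^bsub>M\<^esub> \<rho> g v" by (rule act_smult[OF g _ v(1)]) simp
      then show ?thesis by (simp only: v(2)[OF g] m1[OF g])
    qed
    then have "?w \<in> carrier invariants" using v by (simp add: invariants_carrier)
    moreover have "?w \<oplus>\<^bsub>M\<^esub> v = \<zero>\<^bsub>M\<^esub>"
      using v by (simp add: M.smult_l_minus M.M.l_neg)
    ultimately show ?case by auto
  qed (auto simp: invariants_carrier act_add act_zero M.a_ac)
qed (auto simp: invariants_carrier act_smult gal_fixes K_closed M.smult_l_distr M.smult_r_distr M.smult_assoc1)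

sublocale inv: galois_space L K invariants
  by (intro galois_space.intro galois_axioms galois_space_axioms.intro invariants_module)

definition trace :: "'v \<Rightarrow> 'v" where "trace v = finsum M (\<lambda>g. \<rho> g v) Gal"

lemma trace_closed: assumes v: "v \<in> carrier M" shows "trace v \<in> carrier invariants"
proof -
  have c: "trace v \<in> carrier M" unfolding trace_def using v by (auto simp: act_closed)
  moreover have "\<rho> h (trace v) = trace v" if h: "h \<in> Gal" for h
  proof -
    have "\<rho> h (trace v) = finsum M (\<lambda>g. \<rho> h (\<rho> g v)) Gal"
      unfolding trace_def using h v
      by (intro additive_finsum M.abelian_group_axioms finite_Gal) (auto simp: act_closed act_add)
    also have "\<dots> = finsum M (\<lambda>g. \<rho> (compose (carrier L) h g) v) Gal"
      using v h by (intro M.finsum_cong') (auto simp: act_closed act_comp)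
    also have "\<dots> = finsum M (\<lambda>g. \<rho> g v) (compose (carrier L) h ` Gal)"
      using gal_comp_bij[OF h] v h gal_comp
      by (intro M.finsum_reindex[symmetric]) (auto simp: bij_betw_def act_closed)
    also have "\<dots> = trace v" using gal_comp_bij[OF h] by (simp add: bij_betw_def trace_def)
    finally show ?thesis .
  qed
  ultimately show ?thesis by (simp add: invariants_carrier)
qed

lemma trace_expansion:
  assumes "v \<in> carrier M"
  shows "msum M (map (\<lambda>(x, y). x \<odot>\<^bsub>M\<^esub> trace (y \<odot>\<^bsub>M\<^esub> v)) coords) = v"
  unfolding trace_def
  by (rule coord_expansion[where \<rho> = \<rho> and sm = "smult M"])
     (use assms in \<open>auto simp: M.abelian_group_axioms act_closed act_smult act_one
        M.smult_l_distr M.smult_r_distr M.smult_assoc1\<close>)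

definition mult_map :: "(('l \<times> 'v) \<Rightarrow>\<^sub>0 int) set \<Rightarrow> 'v" where
  "mult_map = tensor_lift L K invariants M (smult M)"

lemma balanced_smult: "balanced L K invariants M (smult M)"
  by (auto simp: balanced_def invariants_carrier M.smult_l_distr M.smult_r_distr M.smult_assoc1 K_closed)

lemma mult_map_tens: "a \<in> carrier L \<Longrightarrow> v \<in> carrier invariants \<Longrightarrow> mult_map (tens L K invariants a v) = a \<odot>\<^bsub>M\<^esub> v"
  unfolding mult_map_def by (rule inv.tensor_lift_tens[OF M.abelian_group_axioms balanced_smult])

lemma mult_map_closed: "t \<in> carrier inv.T \<Longrightarrow> mult_map t \<in> carrier M"
  unfolding mult_map_def by (rule inv.tensor_lift_closed[OF M.abelian_group_axioms balanced_smult])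

lemma mult_map_add: "s \<in> carrier inv.T \<Longrightarrow> t \<in> carrier inv.T
    \<Longrightarrow> mult_map (s \<oplus>\<^bsub>inv.T\<^esub> t) = mult_map s \<oplus>\<^bsub>M\<^esub> mult_map t"
  unfolding mult_map_def by (rule inv.tensor_lift_add[OF M.abelian_group_axioms balanced_smult])

lemma mult_map_smult:
  assumes a: "a \<in> carrier L" and t: "t \<in> carrier inv.T"
  shows "mult_map (a \<odot>\<^bsub>inv.T\<^esub> t) = a \<odot>\<^bsub>M\<^esub> mult_map t"
  using t
  by (induction rule: inv.tensor_induct)
     (use a in \<open>auto simp: inv.smult_tens mult_map_tens invariants_carrier M.smult_assoc1 inv.smult_add
        mult_map_add inv.smult_closed M.smult_r_distr mult_map_closed\<close>)

lemma mult_map_act: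
  assumes g: "g \<in> Gal" and t: "t \<in> carrier inv.T"
  shows "mult_map (inv.gal_tensor g t) = \<rho> g (mult_map t)"
  using t
proof (induction rule: inv.tensor_induct)
  case (tens a v)
  then have "v \<in> carrier M" "\<rho> g v = v" using g by (auto simp: invariants_carrier)
  then show ?case using tens g by (simp add: inv.gal_tensor_tens mult_map_tens act_smult)
qed (use g in \<open>auto simp: inv.gal_tensor_add mult_map_add inv.gal_tensor_closed mult_map_closed act_add\<close>)

text \<open>The coordinates of \<open>t\<close> depend on its product only, whence multiplication is injective.\<close>

lemma tr_func_eq_trace:
  assumes y: "y \<in> carrier L" and t: "t \<in> carrier inv.T"
  shows "inv.tr_func y t = trace (y \<odot>\<^bsub>M\<^esub> mult_map t)"
  using t
proof (induction rule: inv.tensor_induct)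
  case (tens a v)
  then have v: "v \<in> carrier M" "\<And>g. g \<in> Gal \<Longrightarrow> \<rho> g v = v" by (auto simp: invariants_carrier)
  have "trace (y \<odot>\<^bsub>M\<^esub> (a \<odot>\<^bsub>M\<^esub> v)) = finsum M (\<lambda>g. g (y \<otimes> a) \<odot>\<^bsub>M\<^esub> v) Gal"
    unfolding trace_def using v tens y
    by (intro M.finsum_cong') (auto simp: M.smult_assoc1[symmetric] act_smult)
  also have "\<dots> = finsum L (\<lambda>g. g (y \<otimes> a)) Gal \<odot>\<^bsub>M\<^esub> v"
    using v y tens
    by (intro additive_finsum[symmetric, of L M Gal "\<lambda>g. g (y \<otimes> a)" "\<lambda>a. a \<odot>\<^bsub>M\<^esub> v"]
          is_abelian_group M.abelian_group_axioms finite_Gal)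
       (auto simp: M.smult_l_distr)
  finally show ?case using tens y by (simp add: inv.tr_func_tens mult_map_tens tr_def)
next
  case (add s t)
  have "trace (v \<oplus>\<^bsub>M\<^esub> w) = trace v \<oplus>\<^bsub>M\<^esub> trace w" if vw: "v \<in> carrier M" "w \<in> carrier M" for v w
  proof -
    have "trace (v \<oplus>\<^bsub>M\<^esub> w) = finsum M (\<lambda>g. \<rho> g v \<oplus>\<^bsub>M\<^esub> \<rho> g w) Gal"
      unfolding trace_def using vw by (intro M.finsum_cong') (auto simp: act_closed act_add)
    then show ?thesis unfolding trace_def using vw by (simp add: M.finsum_addf act_closed)
  qed
  then show ?case using add y
    by (simp add: inv.tr_func_add mult_map_add mult_map_closed M.smult_r_distr)
qed

lemma mult_map_bij: "bij_betw mult_map (carrier inv.T) (carrier M)"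
proof (rule bij_betw_imageI)
  show "inj_on mult_map (carrier inv.T)"
    by (rule inj_onI, rule inv.tensor_eqI) (simp_all add: tr_func_eq_trace)
  show "mult_map ` carrier inv.T = carrier M"
  proof (intro equalityI subsetI)
    fix v assume v: "v \<in> carrier M"
    let ?ts = "map (\<lambda>(x, y). tens L K invariants x (trace (y \<odot>\<^bsub>M\<^esub> v))) coords"
    interpret T: Module.module L inv.T by (rule inv.tensor_module)
    have ts: "set ?ts \<subseteq> carrier inv.T"
      using coords_closed v by (auto intro!: inv.tens_closed trace_closed)
    have zero: "mult_map \<zero>\<^bsub>inv.T\<^esub> = \<zero>\<^bsub>M\<^esub>"
      by (rule additive_zero[OF T.M.abelian_group_axioms M.abelian_group_axioms
            mult_map_closed[OF T.M.zero_closed] mult_map_add[OF T.M.zero_closed T.M.zero_closed]])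
    have "mult_map (msum inv.T ?ts) = msum M (map mult_map ?ts)"
      by (rule msum_hom[OF zero T.M.abelian_group_axioms ts mult_map_add])
    also have "map mult_map ?ts = map (\<lambda>(x, y). x \<odot>\<^bsub>M\<^esub> trace (y \<odot>\<^bsub>M\<^esub> v)) coords"
      using coords_closed v by (auto simp: mult_map_tens trace_closed)
    finally have "mult_map (msum inv.T ?ts) = v" using trace_expansion[OF v] by simp
    moreover have "msum inv.T ?ts \<in> carrier inv.T" using ts by (rule T.M.msum_closed)
    ultimately show "v \<in> mult_map ` carrier inv.T" by (intro image_eqI[OF sym])
  qed (auto simp: mult_map_closed)
qed

end

\<comment> \<open>The letter \<open>X\<close> denotes the space from here on, not a polynomial variable.\<close>
no_notation var (\<open>X\<index>\<close>)


section \<open>Sheaves and their morphisms\<close>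

text \<open>All identities, composites and induced maps of sheaves are of this form, so that two of them are equal
  once they agree on sections.\<close>

definition mk_hom ::
    "'x topology \<Rightarrow> ('l, 'x, 'v) sheaf_data \<Rightarrow> ('x set \<Rightarrow> 'v \<Rightarrow> 'w) \<Rightarrow> 'x set \<Rightarrow> 'v \<Rightarrow> 'w" where
  "mk_hom X F h = (\<lambda>U\<in>{U. openin X U}. \<lambda>s\<in>carrier (sec F U). h U s)"

lemma mk_hom_apply [simp]:
  "openin X U \<Longrightarrow> s \<in> carrier (sec F U) \<Longrightarrow> mk_hom X F h U s = h U s"
  by (simp add: mk_hom_def)

lemma mk_hom_eqI:
  assumes "\<And>U s. openin X U \<Longrightarrow> s \<in> carrier (sec F U) \<Longrightarrow> h U s = h' U s"
  shows "mk_hom X F h = mk_hom X F h'"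
  using assms unfolding mk_hom_def by (intro restrict_ext) auto

lemma sheaf_id_mk_hom: "sheaf_id X F = mk_hom X F (\<lambda>U s. s)"
  by (simp add: sheaf_id_def mk_hom_def)

lemma sheaf_comp_mk_hom: "sheaf_comp X F g f = mk_hom X F (\<lambda>U s. g U (f U s))"
  by (simp add: sheaf_comp_def mk_hom_def compose_def)

lemma presheaf_module: "presheaf R X F \<Longrightarrow> openin X U \<Longrightarrow> Module.module R (sec F U)"
  by (simp add: presheaf_def)

lemmas presheaf_abelian = Module.module.axioms(2)[OF presheaf_module]
lemmas presheaf_add_closed = abelian_groupE(1)[OF presheaf_abelian]
lemmas presheaf_zero_closed = abelian_groupE(2)[OF presheaf_abelian]
lemmas presheaf_smult_closed = Module.module.smult_closed[OF presheaf_module]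

lemma presheaf_res_id:
  "presheaf R X F \<Longrightarrow> openin X U \<Longrightarrow> s \<in> carrier (sec F U) \<Longrightarrow> res F U U s = s"
  by (simp add: presheaf_def)

lemma presheaf_res_linear:
  "presheaf R X F \<Longrightarrow> openin X U \<Longrightarrow> openin X V \<Longrightarrow> V \<subseteq> U
    \<Longrightarrow> res F U V \<in> linear_maps R (sec F U) (sec F V)"
  by (simp add: presheaf_def)

lemmas presheaf_res_closed = linear_maps_closed[OF presheaf_res_linear]
lemmas presheaf_res_add = linear_maps_add[OF presheaf_res_linear]
lemmas presheaf_res_smult = linear_maps_smult[OF presheaf_res_linear]

lemma presheaf_res_zero:
  assumes "presheaf R X F" "openin X U" "openin X V" "V \<subseteq> U"
  shows "res F U V \<zero>\<^bsub>sec F U\<^esub> = \<zero>\<^bsub>sec F V\<^esub>"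
  by (rule linear_maps_zero[OF presheaf_res_linear presheaf_abelian presheaf_abelian]) (use assms in auto)

lemma presheaf_res_comp:
  assumes "presheaf R X F" "openin X U" "openin X V" "V \<subseteq> U" "openin X W" "W \<subseteq> V" "s \<in> carrier (sec F U)"
  shows "res F V W (res F U V s) = res F U W s"
  using assms(1)[unfolded presheaf_def, THEN conjunct2, THEN conjunct2, THEN conjunct2, rule_format, of U V W s]
    assms(2-) by simp

lemma sheaf_homI:
  assumes "\<And>U s. openin X U \<Longrightarrow> s \<in> carrier (sec F U) \<Longrightarrow> h U s \<in> carrier (sec F' U)"
    and "\<And>U s t. openin X U \<Longrightarrow> s \<in> carrier (sec F U) \<Longrightarrow> t \<in> carrier (sec F U)
          \<Longrightarrow> h U (s \<oplus>\<^bsub>sec F U\<^esub> t) = h U s \<oplus>\<^bsub>sec F' U\<^esub> h U t"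
    and "\<And>U a s. openin X U \<Longrightarrow> a \<in> carrier R \<Longrightarrow> s \<in> carrier (sec F U)
          \<Longrightarrow> h U (a \<odot>\<^bsub>sec F U\<^esub> s) = a \<odot>\<^bsub>sec F' U\<^esub> h U s"
    and "\<And>U V s. openin X U \<Longrightarrow> openin X V \<Longrightarrow> V \<subseteq> U \<Longrightarrow> s \<in> carrier (sec F U)
          \<Longrightarrow> h V (res F U V s) = res F' U V (h U s)"
    and F: "presheaf R X F"
  shows "mk_hom X F h \<in> sheaf_hom R X F F'"
proof -
  have "mk_hom X F h U \<in> linear_maps R (sec F U) (sec F' U)" if U: "openin X U" for U
    by (rule linear_mapsI)
       (use U assms presheaf_add_closed[OF F U] presheaf_smult_closed[OF F U] in auto)
  then show ?thesis
    using assms(4) presheaf_res_closed[OF F] unfolding sheaf_hom_def by (auto simp: mk_hom_def)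
qed

lemma sheaf_hom_linear:
  "f \<in> sheaf_hom R X F F' \<Longrightarrow> openin X U \<Longrightarrow> f U \<in> linear_maps R (sec F U) (sec F' U)"
  by (auto simp: sheaf_hom_def)

lemmas sheaf_hom_closed = linear_maps_closed[OF sheaf_hom_linear]
lemmas sheaf_hom_add = linear_maps_add[OF sheaf_hom_linear]
lemmas sheaf_hom_smult = linear_maps_smult[OF sheaf_hom_linear]

lemma sheaf_hom_res:
  "f \<in> sheaf_hom R X F F' \<Longrightarrow> openin X U \<Longrightarrow> openin X V \<Longrightarrow> V \<subseteq> U \<Longrightarrow> s \<in> carrier (sec F U)
    \<Longrightarrow> f V (res F U V s) = res F' U V (f U s)"
  by (auto simp: sheaf_hom_def)

lemma sheaf_hom_mk_hom:
  assumes "f \<in> sheaf_hom R X F F'" shows "mk_hom X F f = f"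
proof -
  have "f \<in> extensional {U. openin X U}" "\<And>U. openin X U \<Longrightarrow> f U \<in> extensional (carrier (sec F U))"
    using assms by (auto simp: sheaf_hom_def)
  then show ?thesis unfolding mk_hom_def
    by (intro extensionalityI[of _ "{U. openin X U}"]) (auto simp: extensional_restrict)
qed

lemma sheaf_presheaf: "sheaf R X F \<Longrightarrow> presheaf R X F"
  by (simp add: sheaf_def)

lemma sheaf_separated:
  assumes "sheaf R X F" "\<And>U. U \<in> \<U> \<Longrightarrow> openin X U"
    and "s \<in> carrier (sec F (\<Union>\<U>))" "t \<in> carrier (sec F (\<Union>\<U>))"
    and "\<And>U. U \<in> \<U> \<Longrightarrow> res F (\<Union>\<U>) U s = res F (\<Union>\<U>) U t"
  shows "s = t"
proof -
  have op: "\<forall>U\<in>\<U>. openin X U" using assms(2) by blast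
  note * = assms(1)[unfolded sheaf_def, THEN conjunct2, THEN spec[of _ \<U>], THEN mp, OF op, THEN conjunct1]
  show ?thesis using *[THEN bspec, OF assms(3), THEN bspec, OF assms(4)] assms(5) by blast
qed

lemma sheaf_glue:
  assumes "sheaf R X F" "\<And>U. U \<in> \<U> \<Longrightarrow> openin X U"
    and "\<And>U. U \<in> \<U> \<Longrightarrow> \<sigma> U \<in> carrier (sec F U)"
    and "\<And>U V. U \<in> \<U> \<Longrightarrow> V \<in> \<U> \<Longrightarrow> res F U (U \<inter> V) (\<sigma> U) = res F V (U \<inter> V) (\<sigma> V)"
  shows "\<exists>s\<in>carrier (sec F (\<Union>\<U>)). \<forall>U\<in>\<U>. res F (\<Union>\<U>) U s = \<sigma> U"
proof -
  have op: "\<forall>U\<in>\<U>. openin X U" using assms(2) by blast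
  note * = assms(1)[unfolded sheaf_def, THEN conjunct2, THEN spec[of _ \<U>], THEN mp, OF op, THEN conjunct2]
  show ?thesis using *[THEN spec[of _ \<sigma>], THEN mp] assms(3,4) by blast
qed

lemma sheafI:
  assumes "presheaf R X F"
    and "\<And>\<U> s t. (\<And>U. U \<in> \<U> \<Longrightarrow> openin X U) \<Longrightarrow> s \<in> carrier (sec F (\<Union>\<U>)) \<Longrightarrow> t \<in> carrier (sec F (\<Union>\<U>))
      \<Longrightarrow> (\<And>U. U \<in> \<U> \<Longrightarrow> res F (\<Union>\<U>) U s = res F (\<Union>\<U>) U t) \<Longrightarrow> s = t"
    and "\<And>\<U> \<sigma>. (\<And>U. U \<in> \<U> \<Longrightarrow> openin X U) \<Longrightarrow> (\<And>U. U \<in> \<U> \<Longrightarrow> \<sigma> U \<in> carrier (sec F U))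
      \<Longrightarrow> (\<And>U V. U \<in> \<U> \<Longrightarrow> V \<in> \<U> \<Longrightarrow> res F U (U \<inter> V) (\<sigma> U) = res F V (U \<inter> V) (\<sigma> V))
      \<Longrightarrow> \<exists>s\<in>carrier (sec F (\<Union>\<U>)). \<forall>U\<in>\<U>. res F (\<Union>\<U>) U s = \<sigma> U"
  shows "sheaf R X F"
  unfolding sheaf_def
proof (intro conjI allI impI ballI, goal_cases)
  case 1 then show ?case using assms(1) .
next
  case (2 \<U> s t) then show ?case using assms(2)[of \<U> s t] by blast
next
  case (3 \<U> \<sigma>) then show ?case using assms(3)[of \<U> \<sigma>] by blast
qed

lemma sheaf_id_hom: "presheaf R X F \<Longrightarrow> sheaf_id X F \<in> sheaf_hom R X F F"
  unfolding sheaf_id_mk_hom by (rule sheaf_homI) auto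

lemma sheaf_comp_hom:
  assumes "presheaf R X F" "f \<in> sheaf_hom R X F F'" "g \<in> sheaf_hom R X F' F''"
  shows "sheaf_comp X F g f \<in> sheaf_hom R X F F''"
  unfolding sheaf_comp_mk_hom
  by (rule sheaf_homI)
     (use assms in \<open>auto simp: sheaf_hom_closed sheaf_hom_add sheaf_hom_smult sheaf_hom_res\<close>)

text \<open>The inverse is a morphism because additivity, linearity and compatibility with restriction can be
  checked after applying the injective maps \<open>f U\<close>.\<close>

lemma sheaf_isoI:
  assumes "presheaf R X F" "presheaf R X F'" "f \<in> sheaf_hom R X F F'"
    and bij: "\<And>U. openin X U \<Longrightarrow> bij_betw (f U) (carrier (sec F U)) (carrier (sec F' U))"
  shows "f \<in> sheaf_iso R X F F'"
proof -
  define h where "h U = inv_into (carrier (sec F U)) (f U)" for U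
  have hc: "h U t \<in> carrier (sec F U)" and fh: "f U (h U t) = t"
    if "openin X U" "t \<in> carrier (sec F' U)" for U t
    using bij[OF that(1)] that(2) unfolding h_def
    by (auto simp: bij_betw_def inv_into_into f_inv_into_f)
  have hf: "h U (f U s) = s" if "openin X U" "s \<in> carrier (sec F U)" for U s
    using bij[OF that(1)] that(2) unfolding h_def by (auto simp: bij_betw_def)
  have hI: "h U t = s" if "openin X U" "s \<in> carrier (sec F U)" "f U s = t" for U s t
    using hf that by blast
  have "mk_hom X F' h \<in> sheaf_hom R X F' F"
  proof (rule sheaf_homI)
    fix U s t assume U: "openin X U" and st: "s \<in> carrier (sec F' U)" "t \<in> carrier (sec F' U)"
    then show "h U (s \<oplus>\<^bsub>sec F' U\<^esub> t) = h U s \<oplus>\<^bsub>sec F U\<^esub> h U t"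
      by (intro hI) (auto simp: presheaf_add_closed[OF assms(1)] hc sheaf_hom_add[OF assms(3)] fh)
  next
    fix U a s assume U: "openin X U" and s: "a \<in> carrier R" "s \<in> carrier (sec F' U)"
    then show "h U (a \<odot>\<^bsub>sec F' U\<^esub> s) = a \<odot>\<^bsub>sec F U\<^esub> h U s"
      by (intro hI) (auto simp: presheaf_smult_closed[OF assms(1)] hc sheaf_hom_smult[OF assms(3)] fh)
  next
    fix U V s assume "openin X U" "openin X V" "V \<subseteq> U" "s \<in> carrier (sec F' U)"
    then show "h V (res F' U V s) = res F U V (h U s)"
      by (intro hI) (auto simp: presheaf_res_closed[OF assms(1)] hc sheaf_hom_res[OF assms(3)] fh)
  qed (use assms(2) in \<open>auto simp: hc\<close>)
  moreover have "sheaf_comp X F (mk_hom X F' h) f = sheaf_id X F"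
    unfolding sheaf_comp_mk_hom sheaf_id_mk_hom
    by (rule mk_hom_eqI) (simp add: sheaf_hom_closed[OF assms(3)] hf)
  moreover have "sheaf_comp X F' f (mk_hom X F' h) = sheaf_id X F'"
    unfolding sheaf_comp_mk_hom sheaf_id_mk_hom
    by (rule mk_hom_eqI) (simp add: hc fh)
  ultimately show ?thesis using assms(3) unfolding sheaf_iso_def by blast
qed

lemma sheaf_iso_hom: "f \<in> sheaf_iso R X F F' \<Longrightarrow> f \<in> sheaf_hom R X F F'"
  by (simp add: sheaf_iso_def)

lemma sheaf_comp_apply:
  "openin X U \<Longrightarrow> s \<in> carrier (sec F U) \<Longrightarrow> sheaf_comp X F g f U s = g U (f U s)"
  by (simp add: sheaf_comp_mk_hom)

lemma sheaf_id_apply: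
  "openin X U \<Longrightarrow> s \<in> carrier (sec F U) \<Longrightarrow> sheaf_id X F U s = s"
  by (simp add: sheaf_id_mk_hom)

lemma sheaf_iso_bij:
  assumes "f \<in> sheaf_iso R X F F'" "openin X U"
  shows "bij_betw (f U) (carrier (sec F U)) (carrier (sec F' U))"
proof -
  obtain h where h: "h \<in> sheaf_hom R X F' F" "sheaf_comp X F h f = sheaf_id X F"
    "sheaf_comp X F' f h = sheaf_id X F'"
    using assms(1) unfolding sheaf_iso_def by blast
  have f: "f \<in> sheaf_hom R X F F'" using assms(1) by (rule sheaf_iso_hom)
  show ?thesis
  proof (rule bij_betw_byWitness[where f' = "h U"])
    show "\<forall>s\<in>carrier (sec F U). h U (f U s) = s"
      using sheaf_comp_apply[OF assms(2), of _ F h f] h(2) sheaf_id_apply[OF assms(2), of _ F] by metis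
    show "\<forall>s\<in>carrier (sec F' U). f U (h U s) = s"
      using sheaf_comp_apply[OF assms(2), of _ F' f h] h(3) sheaf_id_apply[OF assms(2), of _ F'] by metis
  qed (use sheaf_hom_closed[OF f assms(2)] sheaf_hom_closed[OF h(1) assms(2)] in auto)
qed

subsection \<open>Transfer of the sheaf property along bijections\<close>

text \<open>Unlike a member of \<open>sheaf_iso\<close>, such a family need not be extensional, and the target is only known to
  carry the operations of a module: that it is a sheaf is the conclusion of \<open>sheaf_bij_sheaf\<close>. The zero
  element is mentioned separately because it cannot be recovered from addition before that.\<close>

definition sheaf_bij ::
    "('l, 'm) ring_scheme \<Rightarrow> 'x topology \<Rightarrow> ('l, 'x, 'v) sheaf_data \<Rightarrow> ('l, 'x, 'w) sheaf_data
      \<Rightarrow> ('x set \<Rightarrow> 'v \<Rightarrow> 'w) \<Rightarrow> bool" where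
  "sheaf_bij R X F F' i \<longleftrightarrow>
     (\<forall>U. openin X U \<longrightarrow> bij_betw (i U) (carrier (sec F U)) (carrier (sec F' U)) \<and>
        i U \<zero>\<^bsub>sec F U\<^esub> = \<zero>\<^bsub>sec F' U\<^esub> \<and>
        (\<forall>s\<in>carrier (sec F U). \<forall>t\<in>carrier (sec F U). i U (s \<oplus>\<^bsub>sec F U\<^esub> t) = i U s \<oplus>\<^bsub>sec F' U\<^esub> i U t) \<and>
        (\<forall>a\<in>carrier R. \<forall>s\<in>carrier (sec F U). i U (a \<odot>\<^bsub>sec F U\<^esub> s) = a \<odot>\<^bsub>sec F' U\<^esub> i U s)) \<and>
     (\<forall>U V. openin X U \<and> openin X V \<and> V \<subseteq> U \<longrightarrow>
        (\<forall>s\<in>carrier (sec F U). i V (res F U V s) = res F' U V (i U s)))"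

lemma sheaf_bijI:
  assumes "\<And>U. openin X U \<Longrightarrow> bij_betw (i U) (carrier (sec F U)) (carrier (sec F' U))"
    and "\<And>U. openin X U \<Longrightarrow> i U \<zero>\<^bsub>sec F U\<^esub> = \<zero>\<^bsub>sec F' U\<^esub>"
    and "\<And>U s t. openin X U \<Longrightarrow> s \<in> carrier (sec F U) \<Longrightarrow> t \<in> carrier (sec F U)
          \<Longrightarrow> i U (s \<oplus>\<^bsub>sec F U\<^esub> t) = i U s \<oplus>\<^bsub>sec F' U\<^esub> i U t"
    and "\<And>U a s. openin X U \<Longrightarrow> a \<in> carrier R \<Longrightarrow> s \<in> carrier (sec F U)
          \<Longrightarrow> i U (a \<odot>\<^bsub>sec F U\<^esub> s) = a \<odot>\<^bsub>sec F' U\<^esub> i U s"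
    and "\<And>U V s. openin X U \<Longrightarrow> openin X V \<Longrightarrow> V \<subseteq> U \<Longrightarrow> s \<in> carrier (sec F U)
          \<Longrightarrow> i V (res F U V s) = res F' U V (i U s)"
  shows "sheaf_bij R X F F' i"
  unfolding sheaf_bij_def using assms by simp

context
  fixes R :: "('l, 'm) ring_scheme" and X :: "'x topology" and F F' i U
  assumes b: "sheaf_bij R X F F' i" and U: "openin X U"
begin

lemma sheaf_bij_bij: "bij_betw (i U) (carrier (sec F U)) (carrier (sec F' U))"
  and sheaf_bij_zero: "i U \<zero>\<^bsub>sec F U\<^esub> = \<zero>\<^bsub>sec F' U\<^esub>"
  and sheaf_bij_add: "s \<in> carrier (sec F U) \<Longrightarrow> t \<in> carrier (sec F U)
    \<Longrightarrow> i U (s \<oplus>\<^bsub>sec F U\<^esub> t) = i U s \<oplus>\<^bsub>sec F' U\<^esub> i U t"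
  and sheaf_bij_smult: "a \<in> carrier R \<Longrightarrow> s \<in> carrier (sec F U)
    \<Longrightarrow> i U (a \<odot>\<^bsub>sec F U\<^esub> s) = a \<odot>\<^bsub>sec F' U\<^esub> i U s"
  using b[unfolded sheaf_bij_def, THEN conjunct1, THEN spec[of _ U], THEN mp, OF U] by simp_all

lemma sheaf_bij_res: "openin X V \<Longrightarrow> V \<subseteq> U \<Longrightarrow> s \<in> carrier (sec F U)
    \<Longrightarrow> i V (res F U V s) = res F' U V (i U s)"
  using b[unfolded sheaf_bij_def, THEN conjunct2, THEN spec[of _ U], THEN spec[of _ V], THEN mp] U by simp

lemma sheaf_bij_closed: "s \<in> carrier (sec F U) \<Longrightarrow> i U s \<in> carrier (sec F' U)"
  and sheaf_bij_inj: "s \<in> carrier (sec F U) \<Longrightarrow> t \<in> carrier (sec F U) \<Longrightarrow> i U s = i U t \<Longrightarrow> s = t"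
  and sheaf_bij_surj: "u \<in> carrier (sec F' U) \<Longrightarrow> \<exists>s\<in>carrier (sec F U). u = i U s"
  using sheaf_bij_bij by (auto simp: bij_betw_def inj_on_def)

end

lemma sheaf_bij_presheaf:
  assumes F: "presheaf R X F" and b: "sheaf_bij R X F F' i"
  shows "presheaf R X F'"
  unfolding presheaf_def
proof (intro conjI allI impI ballI; (elim conjE)?)
  fix U assume U: "openin X U"
  interpret F: Module.module R "sec F U" by (rule presheaf_module[OF F U])
  note [simp] = sheaf_bij_add[OF b U, symmetric] sheaf_bij_smult[OF b U, symmetric]
    sheaf_bij_zero[OF b U, symmetric] sheaf_bij_closed[OF b U]
  show "Module.module R (sec F' U)"
  proof (rule moduleI[OF F.R.is_cring])
    show "abelian_group (sec F' U)"
    proof (rule abelian_groupI, goal_cases)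
      case (6 x)
      then obtain s where s: "s \<in> carrier (sec F U)" "x = i U s" using sheaf_bij_surj[OF b U] by blast
      then have "i U (\<ominus>\<^bsub>sec F U\<^esub> s) \<oplus>\<^bsub>sec F' U\<^esub> x = \<zero>\<^bsub>sec F' U\<^esub>" by (simp add: F.M.l_neg)
      then show ?case using s by (intro bexI[where x = "i U (\<ominus>\<^bsub>sec F U\<^esub> s)"]) auto
    qed (auto dest!: sheaf_bij_surj[OF b U] simp: F.M.a_ac)
  qed (auto dest!: sheaf_bij_surj[OF b U] simp: F.smult_l_distr F.smult_r_distr F.smult_assoc1)
  fix s assume "s \<in> carrier (sec F' U)"
  then obtain t where "t \<in> carrier (sec F U)" "s = i U t" using sheaf_bij_surj[OF b U] by blast
  then show "res F' U U s = s"
    using sheaf_bij_res[OF b U U order_refl, of t] presheaf_res_id[OF F U, of t] by simp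
next
  fix U V assume UV: "openin X U" "openin X V" "V \<subseteq> U"
  note rs = sheaf_bij_res[OF b UV, symmetric]
  show "res F' U V \<in> linear_maps R (sec F' U) (sec F' V)"
    by (rule linear_mapsI)
       (auto dest!: sheaf_bij_surj[OF b UV(1)]
         simp: rs sheaf_bij_add[OF b UV(1), symmetric] sheaf_bij_add[OF b UV(2), symmetric]
           sheaf_bij_smult[OF b UV(1), symmetric] sheaf_bij_smult[OF b UV(2), symmetric]
           presheaf_res_closed[OF F UV] presheaf_res_add[OF F UV] presheaf_res_smult[OF F UV]
           sheaf_bij_closed[OF b UV(2)] presheaf_add_closed[OF F UV(1)] presheaf_smult_closed[OF F UV(1)])
next
  fix U V W s assume UVW: "openin X U" "openin X V" "openin X W" "W \<subseteq> V" "V \<subseteq> U"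
    and s: "s \<in> carrier (sec F' U)"
  obtain t where t: "t \<in> carrier (sec F U)" "s = i U t" using sheaf_bij_surj[OF b UVW(1) s] by blast
  have "res F' V W (res F' U V s) = i W (res F V W (res F U V t))"
    using t UVW by (simp add: sheaf_bij_res[OF b, symmetric] presheaf_res_closed[OF F])
  also have "\<dots> = i W (res F U W t)" using t UVW by (simp add: presheaf_res_comp[OF F])
  also have "\<dots> = res F' U W s" using t UVW by (simp add: sheaf_bij_res[OF b])
  finally show "res F' V W (res F' U V s) = res F' U W s" .
qed

lemma sheaf_bij_sheaf:
  assumes F: "sheaf R X F" and b: "sheaf_bij R X F F' i"
  shows "sheaf R X F'"
proof (rule sheafI)
  have P: "presheaf R X F" using F by (rule sheaf_presheaf)
  then show "presheaf R X F'" using b by (rule sheaf_bij_presheaf)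
  fix \<U> assume op: "\<And>U. U \<in> \<U> \<Longrightarrow> openin X U"
  have W: "openin X (\<Union>\<U>)" using op by blast
  have sub: "U \<subseteq> \<Union>\<U>" if "U \<in> \<U>" for U using that by blast
  { fix s t assume st: "s \<in> carrier (sec F' (\<Union>\<U>))" "t \<in> carrier (sec F' (\<Union>\<U>))"
      and eq: "\<And>U. U \<in> \<U> \<Longrightarrow> res F' (\<Union>\<U>) U s = res F' (\<Union>\<U>) U t"
    obtain s' t' where s't': "s' \<in> carrier (sec F (\<Union>\<U>))" "s = i (\<Union>\<U>) s'"
      "t' \<in> carrier (sec F (\<Union>\<U>))" "t = i (\<Union>\<U>) t'"
      using sheaf_bij_surj[OF b W] st by metis
    have "s' = t'"
    proof (rule sheaf_separated[OF F op s't'(1,3)])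
      fix U assume U: "U \<in> \<U>"
      then have "i U (res F (\<Union>\<U>) U s') = i U (res F (\<Union>\<U>) U t')"
        using eq[OF U] s't' sheaf_bij_res[OF b W op[OF U] sub[OF U]] by simp
      then show "res F (\<Union>\<U>) U s' = res F (\<Union>\<U>) U t'"
        by (rule sheaf_bij_inj[OF b op[OF U], rotated 2])
           (use s't' presheaf_res_closed[OF P W op[OF U] sub[OF U]] in auto)
    qed
    then show "s = t" using s't' by simp }
  fix \<sigma> assume \<sigma>: "\<And>U. U \<in> \<U> \<Longrightarrow> \<sigma> U \<in> carrier (sec F' U)"
    and comp: "\<And>U V. U \<in> \<U> \<Longrightarrow> V \<in> \<U> \<Longrightarrow> res F' U (U \<inter> V) (\<sigma> U) = res F' V (U \<inter> V) (\<sigma> V)"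
  have "\<forall>U\<in>\<U>. \<exists>t. t \<in> carrier (sec F U) \<and> \<sigma> U = i U t"
    using sheaf_bij_surj[OF b op] \<sigma> by blast
  then obtain \<tau> where \<tau>: "\<And>U. U \<in> \<U> \<Longrightarrow> \<tau> U \<in> carrier (sec F U)" "\<And>U. U \<in> \<U> \<Longrightarrow> \<sigma> U = i U (\<tau> U)"
    by metis
  have "\<exists>s\<in>carrier (sec F (\<Union>\<U>)). \<forall>U\<in>\<U>. res F (\<Union>\<U>) U s = \<tau> U"
  proof (rule sheaf_glue[OF F op \<tau>(1)])
    fix U V assume UV: "U \<in> \<U>" "V \<in> \<U>"
    have I: "openin X (U \<inter> V)" using op UV by blast
    have "i (U \<inter> V) (res F U (U \<inter> V) (\<tau> U)) = i (U \<inter> V) (res F V (U \<inter> V) (\<tau> V))"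
      using comp[OF UV] \<tau> UV op I by (simp add: sheaf_bij_res[OF b])
    then show "res F U (U \<inter> V) (\<tau> U) = res F V (U \<inter> V) (\<tau> V)"
      by (rule sheaf_bij_inj[OF b I, rotated 2])
         (use \<tau> UV op I in \<open>auto intro!: presheaf_res_closed[OF P]\<close>)
  qed auto
  then obtain s where s: "s \<in> carrier (sec F (\<Union>\<U>))" "\<And>U. U \<in> \<U> \<Longrightarrow> res F (\<Union>\<U>) U s = \<tau> U" by blast
  have "res F' (\<Union>\<U>) U (i (\<Union>\<U>) s) = \<sigma> U" if "U \<in> \<U>" for U
    using that s \<tau> sheaf_bij_res[OF b W op[OF that] sub[OF that] s(1)] by simp
  then show "\<exists>s\<in>carrier (sec F' (\<Union>\<U>)). \<forall>U\<in>\<U>. res F' (\<Union>\<U>) U s = \<sigma> U"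
    using sheaf_bij_closed[OF b W s(1)] by blast
qed

section \<open>Sheafification of a sheaf\<close>

lemma germ_self:
  assumes "openin X U" "x \<in> U" "s \<in> carrier (sec P U)"
  shows "(U, s) \<in> germ X P x U s"
  using assms unfolding germ_def by auto

text \<open>Germs are equivalence classes of sections, encoded as sets of representatives. Transitivity holds
  because two neighbourhoods of agreement can be intersected.\<close>

lemma germ_eq_iff:
  assumes P: "presheaf R X P" and U: "openin X U" "x \<in> U" "s \<in> carrier (sec P U)"
    and V: "openin X V" "x \<in> V" "t \<in> carrier (sec P V)"
  shows "germ X P x U s = germ X P x V t \<longleftrightarrow>
    (\<exists>W. openin X W \<and> x \<in> W \<and> W \<subseteq> U \<inter> V \<and> res P U W s = res P V W t)"
proof
  assume "germ X P x U s = germ X P x V t"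
  then have "(V, t) \<in> germ X P x U s" using germ_self[of X V x t P] V by simp
  then show "\<exists>W. openin X W \<and> x \<in> W \<and> W \<subseteq> U \<inter> V \<and> res P U W s = res P V W t"
    by (simp add: germ_def)
next
  have sub: "germ X P x V t \<subseteq> germ X P x U s"
    if U: "openin X U" "x \<in> U" "s \<in> carrier (sec P U)"
      and V: "openin X V" "x \<in> V" "t \<in> carrier (sec P V)"
      and W: "openin X W" "x \<in> W" "W \<subseteq> U \<inter> V" "res P U W s = res P V W t" for U V W s t
  proof (rule subrelI)
    fix A a assume "(A, a) \<in> germ X P x V t"
    then obtain B where A: "openin X A" "x \<in> A" "a \<in> carrier (sec P A)"
      and B: "openin X B" "x \<in> B" "B \<subseteq> V \<inter> A" "res P V B t = res P A B a"
      by (auto simp: germ_def)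
    let ?C = "W \<inter> B"
    have C: "openin X ?C" using W B by blast
    have "res P U ?C s = res P W ?C (res P U W s)"
      using presheaf_res_comp[OF P U(1) W(1) _ C _ U(3)] W by simp
    also have "\<dots> = res P V ?C t"
      using presheaf_res_comp[OF P V(1) W(1) _ C _ V(3)] W by simp
    also have "\<dots> = res P B ?C (res P V B t)"
      using presheaf_res_comp[OF P V(1) B(1) _ C _ V(3)] B by simp
    also have "\<dots> = res P A ?C a"
      using presheaf_res_comp[OF P A(1) B(1) _ C _ A(3)] B by simp
    finally show "(A, a) \<in> germ X P x U s"
      using A W B C unfolding germ_def by blast
  qed
  assume "\<exists>W. openin X W \<and> x \<in> W \<and> W \<subseteq> U \<inter> V \<and> res P U W s = res P V W t"
  then obtain W where W: "openin X W" "x \<in> W" "W \<subseteq> U \<inter> V" "res P U W s = res P V W t" by blast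
  show "germ X P x U s = germ X P x V t"
    using sub[OF U V W] sub[OF V U W(1,2) _ W(4)[symmetric]] W(3) by blast
qed

lemma germ_res:
  assumes P: "presheaf R X P" and "openin X U" "openin X V" "V \<subseteq> U" "x \<in> V" "s \<in> carrier (sec P U)"
  shows "germ X P x V (res P U V s) = germ X P x U s"
proof -
  have "res P V V (res P U V s) = res P U V s"
    using assms by (simp add: presheaf_res_id[OF P] presheaf_res_closed[OF P])
  then show ?thesis
    using assms by (subst germ_eq_iff[OF P]) (auto simp: presheaf_res_closed[OF P] intro!: exI[of _ V])
qed

text \<open>Operations on germs are given by definite descriptions. They denote because natural operations on
  sections respect equality of germs.\<close>

lemma germ_op_unique:
  assumes P: "presheaf R X P" and Q: "presheaf R' X Q"
    and U: "openin X U" "x \<in> U" "s \<in> carrier (sec P U)" "h U s \<in> carrier (sec Q U)"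
    and V: "openin X V" "x \<in> V" "t \<in> carrier (sec P V)" "h V t \<in> carrier (sec Q V)"
    and nat: "\<And>U V s. openin X U \<Longrightarrow> openin X V \<Longrightarrow> V \<subseteq> U \<Longrightarrow> s \<in> carrier (sec P U)
          \<Longrightarrow> h V (res P U V s) = res Q U V (h U s)"
    and eq: "germ X P x U s = germ X P x V t"
  shows "germ X Q x U (h U s) = germ X Q x V (h V t)"
proof -
  obtain W where W: "openin X W" "x \<in> W" "W \<subseteq> U \<inter> V" "res P U W s = res P V W t"
    using eq germ_eq_iff[OF P U(1-3) V(1-3)] by blast
  have "res Q U W (h U s) = res Q V W (h V t)"
    using nat[OF U(1) W(1) _ U(3)] nat[OF V(1) W(1) _ V(3)] W by simp
  then show ?thesis using germ_eq_iff[OF Q U(1,2,4) V(1,2,4)] W by blast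
qed

lemma stalk_map_germ:
  assumes P: "presheaf R X P" and Q: "presheaf R' X Q"
    and closed: "\<And>U s. openin X U \<Longrightarrow> s \<in> carrier (sec P U) \<Longrightarrow> h U s \<in> carrier (sec Q U)"
    and nat: "\<And>U V s. openin X U \<Longrightarrow> openin X V \<Longrightarrow> V \<subseteq> U \<Longrightarrow> s \<in> carrier (sec P U)
          \<Longrightarrow> h V (res P U V s) = res Q U V (h U s)"
    and U: "openin X U" "x \<in> U" "s \<in> carrier (sec P U)"
  shows "stalk_map X P Q h x (germ X P x U s) = germ X Q x U (h U s)"
  unfolding stalk_map_def
proof (rule the_equality)
  show "\<exists>Ua sa. openin X Ua \<and> x \<in> Ua \<and> sa \<in> carrier (sec P Ua) \<and>
       germ X P x U s = germ X P x Ua sa \<and> germ X Q x U (h U s) = germ X Q x Ua (h Ua sa)"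
    using U by blast
  fix C assume "\<exists>Ua sa. openin X Ua \<and> x \<in> Ua \<and> sa \<in> carrier (sec P Ua) \<and>
       germ X P x U s = germ X P x Ua sa \<and> C = germ X Q x Ua (h Ua sa)"
  then obtain V t where V: "openin X V" "x \<in> V" "t \<in> carrier (sec P V)"
    "germ X P x U s = germ X P x V t" "C = germ X Q x V (h V t)" by blast
  show "C = germ X Q x U (h U s)"
    unfolding V(5)
    by (rule germ_op_unique[OF P Q U closed[OF U(1,3)] V(1-3) closed[OF V(1,3)] nat V(4), symmetric])
qed

text \<open>Multiplication by \<open>a\<close> on stalks is the stalk map of multiplication by \<open>a\<close> on sections.\<close>

lemma stalk_smult_germ:
  assumes P: "presheaf R X P" and a: "a \<in> carrier R"
    and U: "openin X U" "x \<in> U" "s \<in> carrier (sec P U)"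
  shows "a \<odot>\<^bsub>stalk X P x\<^esub> germ X P x U s = germ X P x U (a \<odot>\<^bsub>sec P U\<^esub> s)"
proof -
  have "a \<odot>\<^bsub>stalk X P x\<^esub> germ X P x U s = stalk_map X P P (\<lambda>U s. a \<odot>\<^bsub>sec P U\<^esub> s) x (germ X P x U s)"
    by (simp add: stalk_def stalk_map_def)
  also have "\<dots> = germ X P x U (a \<odot>\<^bsub>sec P U\<^esub> s)"
    by (rule stalk_map_germ[OF P P])
       (use a U in \<open>auto simp: presheaf_smult_closed[OF P] presheaf_res_smult[OF P]\<close>)
  finally show ?thesis .
qed

text \<open>Two representations of the summands agree on neighbourhoods of \<open>x\<close>, one for each summand; on the
  intersection of these the sums agree.\<close>

lemma stalk_add_germ:
  assumes P: "presheaf R X P"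
    and U: "openin X U" "x \<in> U" "s \<in> carrier (sec P U)" "t \<in> carrier (sec P U)"
  shows "germ X P x U s \<oplus>\<^bsub>stalk X P x\<^esub> germ X P x U t = germ X P x U (s \<oplus>\<^bsub>sec P U\<^esub> t)"
proof -
  have "(THE C. \<exists>V s' t'. openin X V \<and> x \<in> V \<and> s' \<in> carrier (sec P V) \<and> t' \<in> carrier (sec P V) \<and>
       germ X P x U s = germ X P x V s' \<and> germ X P x U t = germ X P x V t' \<and>
       C = germ X P x V (s' \<oplus>\<^bsub>sec P V\<^esub> t')) = germ X P x U (s \<oplus>\<^bsub>sec P U\<^esub> t)" (is "The ?P = _")
  proof (rule the_equality)
    show "?P (germ X P x U (s \<oplus>\<^bsub>sec P U\<^esub> t))" using U by blast
    fix C assume "?P C"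
    then obtain V s' t' where V: "openin X V" "x \<in> V" "s' \<in> carrier (sec P V)" "t' \<in> carrier (sec P V)"
       "germ X P x U s = germ X P x V s'" "germ X P x U t = germ X P x V t'"
       "C = germ X P x V (s' \<oplus>\<^bsub>sec P V\<^esub> t')" by blast
    obtain A where A: "openin X A" "x \<in> A" "A \<subseteq> U \<inter> V" "res P U A s = res P V A s'"
      using V(5) germ_eq_iff[OF P U(1-3) V(1-3)] by blast
    obtain B where B: "openin X B" "x \<in> B" "B \<subseteq> U \<inter> V" "res P U B t = res P V B t'"
      using V(6) germ_eq_iff[OF P U(1,2,4) V(1,2,4)] by blast
    let ?W = "A \<inter> B"
    have W: "openin X ?W" "x \<in> ?W" "?W \<subseteq> U" "?W \<subseteq> V" using A B by auto
    have 1: "res P U ?W s = res P V ?W s'"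
      using presheaf_res_comp[OF P U(1) A(1) _ W(1) _ U(3)] presheaf_res_comp[OF P V(1) A(1) _ W(1) _ V(3)] A
      by simp
    have 2: "res P U ?W t = res P V ?W t'"
      using presheaf_res_comp[OF P U(1) B(1) _ W(1) _ U(4)] presheaf_res_comp[OF P V(1) B(1) _ W(1) _ V(4)] B
      by simp
    have "res P U ?W (s \<oplus>\<^bsub>sec P U\<^esub> t) = res P V ?W (s' \<oplus>\<^bsub>sec P V\<^esub> t')"
      using 1 2 presheaf_res_add[OF P U(1) W(1,3) U(3,4)] presheaf_res_add[OF P V(1) W(1,4) V(3,4)] by simp
    then show "C = germ X P x U (s \<oplus>\<^bsub>sec P U\<^esub> t)"
      unfolding V(7)
      using germ_eq_iff[OF P U(1,2) presheaf_add_closed[OF P U(1,3,4)] V(1,2) presheaf_add_closed[OF P V(1,3,4)]] W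
      by blast
  qed
  then show ?thesis by (simp add: stalk_def)
qed

lemma stalk_zero_germ:
  assumes P: "presheaf R X P" and U: "openin X U" "x \<in> U"
  shows "\<zero>\<^bsub>stalk X P x\<^esub> = germ X P x U \<zero>\<^bsub>sec P U\<^esub>"
proof -
  have sub: "U \<subseteq> topspace X" using U openin_subset by blast
  have "germ X P x U (res P (topspace X) U \<zero>\<^bsub>sec P (topspace X)\<^esub>) = germ X P x (topspace X) \<zero>\<^bsub>sec P (topspace X)\<^esub>"
    by (rule germ_res[OF P]) (use U sub presheaf_zero_closed[OF P] in auto)
  then show ?thesis using presheaf_res_zero[OF P openin_topspace U(1) sub] by (simp add: stalk_def)
qed

definition sheafify_unit :: "'x topology \<Rightarrow> ('l, 'x, 'v) sheaf_data \<Rightarrow> 'x set \<Rightarrow> 'v \<Rightarrow> 'x \<Rightarrow> ('x set \<times> 'v) set" where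
  "sheafify_unit X P U s = (\<lambda>x\<in>U. germ X P x U s)"

lemma sheafify_carrier:
  "\<sigma> \<in> carrier (sec (sheafify X P) U) \<longleftrightarrow> \<sigma> \<in> extensional U \<and> (\<forall>x\<in>U. \<exists>V t. openin X V \<and> x \<in> V \<and> V \<subseteq> U \<and>
         t \<in> carrier (sec P V) \<and> (\<forall>y\<in>V. \<sigma> y = germ X P y V t))"
  by (simp add: sheafify_def)

lemma sheafify_unit_closed:
  assumes "openin X U" "s \<in> carrier (sec P U)"
  shows "sheafify_unit X P U s \<in> carrier (sec (sheafify X P) U)"
  unfolding sheafify_carrier using assms by (auto simp: sheafify_unit_def intro!: exI[of _ U] exI[of _ s])

lemma sheaf_local_eq:
  assumes F: "sheaf R X F" and U: "openin X U" and s: "s \<in> carrier (sec F U)" and t: "t \<in> carrier (sec F U)"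
    and loc: "\<And>x. x \<in> U \<Longrightarrow> \<exists>W. openin X W \<and> x \<in> W \<and> W \<subseteq> U \<and> res F U W s = res F U W t"
  shows "s = t"
proof -
  let ?\<U> = "{W. openin X W \<and> W \<subseteq> U \<and> res F U W s = res F U W t}"
  have eq: "\<Union>?\<U> = U" using loc by blast
  have "s \<in> carrier (sec F (\<Union>?\<U>))" "t \<in> carrier (sec F (\<Union>?\<U>))" unfolding eq using s t by auto
  then show ?thesis
    by (rule sheaf_separated[OF F, rotated]) (auto simp: eq)
qed

text \<open>Injectivity is separation: sections with the same germs agree locally. For surjectivity, a local
  choice of sections that represent \<open>\<sigma>\<close> agrees on overlaps, again because the germs coincide there, and
  so it glues.\<close>

lemma sheafify_unit_bij:
  assumes F: "sheaf R X F" and U: "openin X U"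
  shows "bij_betw (sheafify_unit X F U) (carrier (sec F U)) (carrier (sec (sheafify X F) U))"
proof (rule bij_betw_imageI)
  have P: "presheaf R X F" using F by (rule sheaf_presheaf)
  show "inj_on (sheafify_unit X F U) (carrier (sec F U))"
  proof (rule inj_onI)
    fix s t assume st: "s \<in> carrier (sec F U)" "t \<in> carrier (sec F U)"
      and eq: "sheafify_unit X F U s = sheafify_unit X F U t"
    show "s = t"
    proof (rule sheaf_local_eq[OF F U st])
      fix x assume x: "x \<in> U"
      then have "germ X F x U s = germ X F x U t"
        using fun_cong[OF eq, of x] by (simp add: sheafify_unit_def)
      then show "\<exists>W. openin X W \<and> x \<in> W \<and> W \<subseteq> U \<and> res F U W s = res F U W t"
        using germ_eq_iff[OF P U x st(1) U x st(2)] by auto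
    qed
  qed
  show "sheafify_unit X F U ` carrier (sec F U) = carrier (sec (sheafify X F) U)"
  proof (intro equalityI subsetI)
    fix \<sigma> assume "\<sigma> \<in> carrier (sec (sheafify X F) U)"
    then have ext: "\<sigma> \<in> extensional U" and loc: "\<forall>x\<in>U. \<exists>V t. openin X V \<and> x \<in> V \<and> V \<subseteq> U \<and>
         t \<in> carrier (sec F V) \<and> (\<forall>y\<in>V. \<sigma> y = germ X F y V t)"
      by (auto simp: sheafify_carrier)
    \<comment> \<open>The cover consists of all open sets that admit a representative, so the choice is made once per set.\<close>
    define good where "good V t \<longleftrightarrow> t \<in> carrier (sec F V) \<and> (\<forall>y\<in>V. \<sigma> y = germ X F y V t)" for V t
    define \<U> where "\<U> = {V. openin X V \<and> V \<subseteq> U \<and> (\<exists>t. good V t)}"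
    define \<tau> where "\<tau> V = (SOME t. good V t)" for V
    have \<tau>: "good V (\<tau> V)" if "V \<in> \<U>" for V
      using that someI_ex[of "good V"] unfolding \<U>_def \<tau>_def by blast
    have op: "openin X V" if "V \<in> \<U>" for V using that by (simp add: \<U>_def)
    have cover: "\<Union>\<U> = U"
    proof (intro equalityI subsetI)
      fix x assume "x \<in> U"
      then obtain V t where "openin X V" "x \<in> V" "V \<subseteq> U" "good V t"
        using loc unfolding good_def by meson
      then show "x \<in> \<Union>\<U>" unfolding \<U>_def by blast
    qed (auto simp: \<U>_def)
    have "\<exists>s\<in>carrier (sec F (\<Union>\<U>)). \<forall>V\<in>\<U>. res F (\<Union>\<U>) V s = \<tau> V"
    proof (rule sheaf_glue[OF F op])
      show "\<tau> V \<in> carrier (sec F V)" if "V \<in> \<U>" for V using \<tau>[OF that] by (simp add: good_def)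
      fix A B assume AB: "A \<in> \<U>" "B \<in> \<U>"
      have I: "openin X (A \<inter> B)" using op AB by blast
      have c: "\<tau> A \<in> carrier (sec F A)" "\<tau> B \<in> carrier (sec F B)" using \<tau> AB by (auto simp: good_def)
      show "res F A (A \<inter> B) (\<tau> A) = res F B (A \<inter> B) (\<tau> B)"
      proof (rule sheaf_local_eq[OF F I])
        show rc: "res F A (A \<inter> B) (\<tau> A) \<in> carrier (sec F (A \<inter> B))" "res F B (A \<inter> B) (\<tau> B) \<in> carrier (sec F (A \<inter> B))"
          using c op AB I by (auto intro!: presheaf_res_closed[OF P])
        fix x assume x: "x \<in> A \<inter> B"
        have "germ X F x (A \<inter> B) (res F A (A \<inter> B) (\<tau> A)) = germ X F x A (\<tau> A)"
          using germ_res[OF P op[OF AB(1)] I _ x c(1)] by simp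
        also have "\<dots> = germ X F x B (\<tau> B)"
          using \<tau>[OF AB(1)] \<tau>[OF AB(2)] x unfolding good_def by (metis Int_iff)
        also have "\<dots> = germ X F x (A \<inter> B) (res F B (A \<inter> B) (\<tau> B))"
          using germ_res[OF P op[OF AB(2)] I _ x c(2)] by simp
        finally show "\<exists>W. openin X W \<and> x \<in> W \<and> W \<subseteq> A \<inter> B \<and>
            res F (A \<inter> B) W (res F A (A \<inter> B) (\<tau> A)) = res F (A \<inter> B) W (res F B (A \<inter> B) (\<tau> B))"
          using germ_eq_iff[OF P I x rc(1) I x rc(2)] by auto
      qed
    qed
    then obtain s where s: "s \<in> carrier (sec F U)" "\<And>V. V \<in> \<U> \<Longrightarrow> res F U V s = \<tau> V"
      unfolding cover by blast
    have "\<sigma> = sheafify_unit X F U s"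
    proof (rule extensionalityI[OF ext])
      show "sheafify_unit X F U s \<in> extensional U" by (simp add: sheafify_unit_def)
      fix x assume x: "x \<in> U"
      then obtain V where V: "V \<in> \<U>" "x \<in> V" using cover by blast
      have "\<sigma> x = germ X F x V (\<tau> V)" using \<tau>[OF V(1)] V(2) by (simp add: good_def)
      also have "\<dots> = germ X F x U s"
        using germ_res[OF P U op[OF V(1)] _ V(2) s(1)] s(2)[OF V(1)] V(1) by (simp add: \<U>_def)
      finally show "\<sigma> x = sheafify_unit X F U s x" using x by (simp add: sheafify_unit_def)
    qed
    then show "\<sigma> \<in> sheafify_unit X F U ` carrier (sec F U)" using s(1) by blast
  qed (auto simp: sheafify_unit_closed U)
qed

lemma sheafify_unit_sheaf_bij:
  assumes F: "sheaf R X F" shows "sheaf_bij R X F (sheafify X F) (sheafify_unit X F)"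
proof (rule sheaf_bijI)
  have P: "presheaf R X F" using F by (rule sheaf_presheaf)
  fix U assume U: "openin X U"
  show "bij_betw (sheafify_unit X F U) (carrier (sec F U)) (carrier (sec (sheafify X F) U))"
    by (rule sheafify_unit_bij[OF F U])
  show "sheafify_unit X F U \<zero>\<^bsub>sec F U\<^esub> = \<zero>\<^bsub>sec (sheafify X F) U\<^esub>"
    by (simp add: sheafify_unit_def sheafify_def stalk_zero_germ[OF P U] cong: restrict_cong)
  fix s t assume "s \<in> carrier (sec F U)" "t \<in> carrier (sec F U)"
  then show "sheafify_unit X F U (s \<oplus>\<^bsub>sec F U\<^esub> t)
      = sheafify_unit X F U s \<oplus>\<^bsub>sec (sheafify X F) U\<^esub> sheafify_unit X F U t"
    by (simp add: sheafify_unit_def sheafify_def stalk_add_germ[OF P U] cong: restrict_cong)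
next
  have P: "presheaf R X F" using F by (rule sheaf_presheaf)
  fix U a s assume "openin X U" "a \<in> carrier R" "s \<in> carrier (sec F U)"
  then show "sheafify_unit X F U (a \<odot>\<^bsub>sec F U\<^esub> s) = a \<odot>\<^bsub>sec (sheafify X F) U\<^esub> sheafify_unit X F U s"
    by (simp add: sheafify_unit_def sheafify_def stalk_smult_germ[OF P] cong: restrict_cong)
next
  have P: "presheaf R X F" using F by (rule sheaf_presheaf)
  fix U V s assume "openin X U" "openin X V" "V \<subseteq> U" "s \<in> carrier (sec F U)"
  then show "sheafify_unit X F V (res F U V s) = res (sheafify X F) U V (sheafify_unit X F U s)"
    by (auto simp: sheafify_unit_def sheafify_def germ_res[OF P] restrict_def fun_eq_iff)
qed

lemma sheafify_map_unit:
  assumes P: "presheaf R X P" and Q: "presheaf R' X Q"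
    and closed: "\<And>U s. openin X U \<Longrightarrow> s \<in> carrier (sec P U) \<Longrightarrow> h U s \<in> carrier (sec Q U)"
    and nat: "\<And>U V s. openin X U \<Longrightarrow> openin X V \<Longrightarrow> V \<subseteq> U \<Longrightarrow> s \<in> carrier (sec P U)
          \<Longrightarrow> h V (res P U V s) = res Q U V (h U s)"
    and U: "openin X U" "s \<in> carrier (sec P U)"
  shows "sheafify_map X P Q h U (sheafify_unit X P U s) = sheafify_unit X Q U (h U s)"
  using U sheafify_unit_closed[OF U]
  by (auto simp: sheafify_map_def sheafify_unit_def restrict_def fun_eq_iff
      stalk_map_germ[OF P Q closed nat U(1)])

section \<open>Extension of scalars for sheaves\<close>

lemma pre_ext_sec [simp]: "sec (pre_ext L K G) U = tensor L K (sec G U)"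
  and pre_ext_res: "res (pre_ext L K G) U V = tensor_map L K (sec G V) (\<lambda>l. l) (res G U V)"
  by (simp_all add: pre_ext_def)

lemma sec_twist [simp]:
  "carrier (sec (twist g F) U) = carrier (sec F U)"
  "add (sec (twist g F) U) = add (sec F U)"
  "zero (sec (twist g F) U) = zero (sec F U)"
  "a \<odot>\<^bsub>sec (twist g F) U\<^esub> v = g a \<odot>\<^bsub>sec F U\<^esub> v"
  "res (twist g F) = res F"
  by (simp_all add: twist_def)

context galois begin

abbreviation "KR \<equiv> L\<lparr>carrier := K\<rparr>"

lemma space_sec: "presheaf KR X G \<Longrightarrow> openin X U \<Longrightarrow> galois_space L K (sec G U)"
  by (intro galois_space.intro galois_axioms galois_space_axioms.intro presheaf_module)

context
  fixes X :: "'x topology" and G :: "('a, 'x, 'v) sheaf_data"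
  assumes G: "presheaf KR X G"
begin

lemma pre_ext_res_tens:
  assumes "openin X U" "openin X V" "V \<subseteq> U" "a \<in> carrier L" "s \<in> carrier (sec G U)"
  shows "res (pre_ext L K G) U V (tens L K (sec G U) a s) = tens L K (sec G V) a (res G U V s)"
proof -
  interpret U: galois_space L K "sec G U" by (rule space_sec[OF G assms(1)])
  show ?thesis unfolding pre_ext_res
    by (rule U.tensor_map_tens[OF presheaf_module[OF G assms(2)] U.scalar_linear_id
          presheaf_res_linear[OF G assms(1-3)] assms(4,5)])
qed

lemma pre_ext_res_linear:
  assumes UV: "openin X U" "openin X V" "V \<subseteq> U"
  shows "res (pre_ext L K G) U V \<in> linear_maps L (tensor L K (sec G U)) (tensor L K (sec G V))"
proof -
  interpret U: galois_space L K "sec G U" by (rule space_sec[OF G UV(1)])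
  interpret V: galois_space L K "sec G V" by (rule space_sec[OF G UV(2)])
  have rc: "res (pre_ext L K G) U V t \<in> carrier V.T" if "t \<in> carrier U.T" for t
    unfolding pre_ext_res
    by (rule U.tensor_map_closed[OF V.modV U.scalar_linear_id presheaf_res_linear[OF G UV] that])
  have ra: "res (pre_ext L K G) U V (s \<oplus>\<^bsub>U.T\<^esub> t)
      = res (pre_ext L K G) U V s \<oplus>\<^bsub>V.T\<^esub> res (pre_ext L K G) U V t"
    if "s \<in> carrier U.T" "t \<in> carrier U.T" for s t
    unfolding pre_ext_res
    by (rule U.tensor_map_add[OF V.modV U.scalar_linear_id presheaf_res_linear[OF G UV] that])
  show ?thesis
  proof (rule linear_mapsI[OF rc ra])
    fix a t assume a: "a \<in> carrier L" and t: "t \<in> carrier U.T"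
    show "res (pre_ext L K G) U V (a \<odot>\<^bsub>U.T\<^esub> t) = a \<odot>\<^bsub>V.T\<^esub> res (pre_ext L K G) U V t"
      using t
    proof (induction rule: U.tensor_induct)
      case (tens b v)
      then show ?case using a presheaf_res_closed[OF G UV]
        by (simp add: U.smult_tens V.smult_tens pre_ext_res_tens[OF UV])
    next
      case (add s t)
      then show ?case using a by (simp add: U.smult_add V.smult_add ra rc U.smult_closed)
    qed
  qed
qed

lemma pre_ext_presheaf: "presheaf L X (pre_ext L K G)"
  unfolding presheaf_def pre_ext_sec
proof (intro conjI allI impI ballI; (elim conjE)?)
  fix U assume U: "openin X U"
  interpret U: galois_space L K "sec G U" by (rule space_sec[OF G U])
  show "Module.module L U.T" by (rule U.tensor_module)
  note lin = pre_ext_res_linear[OF U U order_refl]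
  fix t assume "t \<in> carrier U.T"
  then show "res (pre_ext L K G) U U t = t"
    by (induction rule: U.tensor_induct)
       (simp_all add: pre_ext_res_tens[OF U U] presheaf_res_id[OF G U] linear_maps_add[OF lin])
next
  fix U V assume "openin X U" "openin X V" "V \<subseteq> U"
  then show "res (pre_ext L K G) U V \<in> linear_maps L (tensor L K (sec G U)) (tensor L K (sec G V))"
    by (rule pre_ext_res_linear)
next
  fix U V W t assume UVW: "openin X U" "openin X V" "openin X W" "W \<subseteq> V" "V \<subseteq> U"
    and t: "t \<in> carrier (tensor L K (sec G U))"
  interpret U: galois_space L K "sec G U" by (rule space_sec[OF G UVW(1)])
  have WU: "W \<subseteq> U" using UVW by blast
  note UV = pre_ext_res_linear[OF UVW(1,2,5)] and VW = pre_ext_res_linear[OF UVW(2,3,4)]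
    and UW = pre_ext_res_linear[OF UVW(1,3) WU]
  show "res (pre_ext L K G) V W (res (pre_ext L K G) U V t) = res (pre_ext L K G) U W t"
    using t
    by (induction rule: U.tensor_induct)
       (simp_all add: pre_ext_res_tens UVW WU presheaf_res_closed[OF G] presheaf_res_comp[OF G]
         linear_maps_add[OF UV] linear_maps_add[OF VW] linear_maps_add[OF UW] linear_maps_closed[OF UV])
qed

text \<open>The coordinate maps \<open>L \<otimes> G(U) \<rightarrow> G(U)\<close> commute with restriction; through them \<open>L \<otimes> G\<close> inherits
  the sheaf property from \<open>G\<close>.\<close>

lemma tr_func_res:
  assumes UV: "openin X U" "openin X V" "V \<subseteq> U" and y: "y \<in> carrier L"
    and t: "t \<in> carrier (tensor L K (sec G U))"
  shows "galois_space.tr_func L K (sec G V) y (res (pre_ext L K G) U V t)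
    = res G U V (galois_space.tr_func L K (sec G U) y t)"
proof -
  interpret U: galois_space L K "sec G U" by (rule space_sec[OF G UV(1)])
  interpret V: galois_space L K "sec G V" by (rule space_sec[OF G UV(2)])
  note lin = pre_ext_res_linear[OF UV]
  show ?thesis using t
  proof (induction rule: U.tensor_induct)
    case (tens a v)
    then show ?case using y
      by (simp add: pre_ext_res_tens[OF UV] U.tr_func_tens V.tr_func_tens presheaf_res_closed[OF G UV]
          presheaf_res_smult[OF G UV] tr_in_K)
  next
    case (add s t)
    then show ?case using y
      by (simp add: linear_maps_add[OF lin] linear_maps_closed[OF lin] U.tr_func_add V.tr_func_add
          U.tr_func_closed presheaf_res_add[OF G UV])
  qed
qed

end

text \<open>Sections with the same coordinates agree, and coordinates are determined locally. To glue, the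
  coordinates \<open>v y\<close> are glued in \<open>G\<close> and the section is rebuilt as \<open>\<Sum>\<^sub>i x\<^sub>i \<otimes> v y\<^sub>i\<close>; here
  finiteness of the coordinate system is essential.\<close>

lemma pre_ext_sheaf:
  fixes G :: "('a, 'x, 'v) sheaf_data"
  assumes G: "sheaf KR X G" shows "sheaf L X (pre_ext L K G)"
proof (rule sheafI)
  have P: "presheaf KR X G" using G by (rule sheaf_presheaf)
  show Q: "presheaf L X (pre_ext L K G)" by (rule pre_ext_presheaf[OF P])
  fix \<U> assume op: "\<And>U. U \<in> \<U> \<Longrightarrow> openin X U"
  let ?W = "\<Union>\<U>"
  have W: "openin X ?W" using op by blast
  have sub: "U \<subseteq> ?W" if "U \<in> \<U>" for U using that by blast
  interpret W: galois_space L K "sec G ?W" by (rule space_sec[OF P W])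
  { fix s t assume "s \<in> carrier (sec (pre_ext L K G) ?W)" "t \<in> carrier (sec (pre_ext L K G) ?W)"
    then have st: "s \<in> carrier W.T" "t \<in> carrier W.T" by simp_all
    assume eq: "\<And>U. U \<in> \<U> \<Longrightarrow> res (pre_ext L K G) ?W U s = res (pre_ext L K G) ?W U t"
    show "s = t"
    proof (rule W.tensor_eqI[OF st])
      fix y assume y: "y \<in> carrier L"
      show "W.tr_func y s = W.tr_func y t"
      proof (rule sheaf_separated[OF G op])
        show "W.tr_func y s \<in> carrier (sec G ?W)" "W.tr_func y t \<in> carrier (sec G ?W)"
          by (rule W.tr_func_closed[OF y st(1)], rule W.tr_func_closed[OF y st(2)])
        fix U assume U: "U \<in> \<U>"
        show "res G ?W U (W.tr_func y s) = res G ?W U (W.tr_func y t)"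
          using tr_func_res[OF P W op[OF U] sub[OF U] y st(1)] eq[OF U]
            tr_func_res[OF P W op[OF U] sub[OF U] y st(2)] by simp
      qed
    qed }
  fix \<sigma> assume \<sigma>: "\<And>U. U \<in> \<U> \<Longrightarrow> \<sigma> U \<in> carrier (sec (pre_ext L K G) U)"
    and comp: "\<And>U V. U \<in> \<U> \<Longrightarrow> V \<in> \<U>
      \<Longrightarrow> res (pre_ext L K G) U (U \<inter> V) (\<sigma> U) = res (pre_ext L K G) V (U \<inter> V) (\<sigma> V)"
  let ?f = "\<lambda>y U. galois_space.tr_func L K (sec G U) y (\<sigma> U)"
  have "\<exists>v\<in>carrier (sec G ?W). \<forall>U\<in>\<U>. res G ?W U v = ?f y U" if y: "y \<in> carrier L" for y
  proof (rule sheaf_glue[OF G op])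
    fix U assume U: "U \<in> \<U>"
    interpret U: galois_space L K "sec G U" by (rule space_sec[OF P op[OF U]])
    show "?f y U \<in> carrier (sec G U)" using U.tr_func_closed[OF y] \<sigma>[OF U] by simp
  next
    fix U V assume UV: "U \<in> \<U>" "V \<in> \<U>"
    have I: "openin X (U \<inter> V)" using op UV by blast
    have tr: "galois_space.tr_func L K (sec G (U \<inter> V)) y (res (pre_ext L K G) W' (U \<inter> V) (\<sigma> W'))
        = res G W' (U \<inter> V) (?f y W')" if "W' \<in> {U, V}" for W'
      using \<sigma>[of W'] UV that by (intro tr_func_res[OF P op I _ y]) auto
    show "res G U (U \<inter> V) (?f y U) = res G V (U \<inter> V) (?f y V)"
      using tr[of U] tr[of V] comp[OF UV] by simp
  qed auto
  then obtain v where v: "\<And>y. y \<in> carrier L \<Longrightarrow> v y \<in> carrier (sec G ?W)"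
    "\<And>y U. y \<in> carrier L \<Longrightarrow> U \<in> \<U> \<Longrightarrow> res G ?W U (v y) = ?f y U" by metis
  interpret WT: abelian_group W.T by (rule W.abelian_tensor)
  let ?ts = "map (\<lambda>(x, y). tens L K (sec G ?W) x (v y)) coords"
  have ts: "set ?ts \<subseteq> carrier W.T" using coords_closed v(1) by (auto intro!: W.tens_closed)
  have "res (pre_ext L K G) ?W U (msum W.T ?ts) = \<sigma> U" if U: "U \<in> \<U>" for U
  proof -
    interpret U: galois_space L K "sec G U" by (rule space_sec[OF P op[OF U]])
    note lin = pre_ext_res_linear[OF P W op[OF U] sub[OF U]]
    have "res (pre_ext L K G) ?W U (msum W.T ?ts) = msum U.T (map (res (pre_ext L K G) ?W U) ?ts)"
      by (rule msum_hom[OF linear_maps_zero[OF lin W.abelian_tensor U.abelian_tensor] W.abelian_tensor ts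
            linear_maps_add[OF lin]])
    also have "map (res (pre_ext L K G) ?W U) ?ts
        = map (\<lambda>(x, y). tens L K (sec G U) x (U.tr_func y (\<sigma> U))) coords"
      using coords_closed v U by (auto simp: pre_ext_res_tens[OF P W op sub])
    also have "msum U.T \<dots> = \<sigma> U" using U.tensor_expansion \<sigma>[OF U] by simp
    finally show ?thesis .
  qed
  moreover have "msum W.T ?ts \<in> carrier (sec (pre_ext L K G) ?W)"
    using WT.msum_closed[OF ts] by simp
  ultimately show "\<exists>s\<in>carrier (sec (pre_ext L K G) ?W). \<forall>U\<in>\<U>. res (pre_ext L K G) ?W U s = \<sigma> U"
    by blast
qed

lemma ext_sheaf_bij:
  assumes "sheaf KR X G"
  shows "sheaf_bij L X (pre_ext L K G) (ext L K X G) (sheafify_unit X (pre_ext L K G))"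
  unfolding ext_def by (rule sheafify_unit_sheaf_bij[OF pre_ext_sheaf[OF assms]])

subsection \<open>Maps between tensor products of sections\<close>

definition tensor_hom :: "('a, 'x, 'w) sheaf_data \<Rightarrow> ('x set \<Rightarrow> 'v \<Rightarrow> 'w) \<Rightarrow> 'x set
    \<Rightarrow> (('a \<times> 'v) \<Rightarrow>\<^sub>0 int) set \<Rightarrow> (('a \<times> 'w) \<Rightarrow>\<^sub>0 int) set" where
  "tensor_hom G' f U = tensor_map L K (sec G' U) (\<lambda>l. l) (f U)"

definition tensor_gal :: "('a, 'x, 'v) sheaf_data \<Rightarrow> ('a \<Rightarrow> 'a) \<Rightarrow> 'x set
    \<Rightarrow> (('a \<times> 'v) \<Rightarrow>\<^sub>0 int) set \<Rightarrow> (('a \<times> 'v) \<Rightarrow>\<^sub>0 int) set" where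
  "tensor_gal G g U = tensor_map L K (sec G U) g (\<lambda>v. v)"

context
  fixes X :: "'x topology" and G :: "('a, 'x, 'v) sheaf_data" and G' :: "('a, 'x, 'w) sheaf_data" and f
  assumes G: "presheaf KR X G" and G': "presheaf KR X G'" and f: "f \<in> sheaf_hom KR X G G'"
begin

lemma tensor_hom_tens:
  assumes "openin X U" "a \<in> carrier L" "s \<in> carrier (sec G U)"
  shows "tensor_hom G' f U (tens L K (sec G U) a s) = tens L K (sec G' U) a (f U s)"
proof -
  interpret U: galois_space L K "sec G U" by (rule space_sec[OF G assms(1)])
  show ?thesis unfolding tensor_hom_def
    by (rule U.tensor_map_tens[OF presheaf_module[OF G' assms(1)] U.scalar_linear_id
          sheaf_hom_linear[OF f assms(1)] assms(2,3)])
qed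

lemma tensor_hom_linear:
  assumes U: "openin X U"
  shows "tensor_hom G' f U \<in> linear_maps L (tensor L K (sec G U)) (tensor L K (sec G' U))"
proof -
  interpret U: galois_space L K "sec G U" by (rule space_sec[OF G U])
  interpret U': galois_space L K "sec G' U" by (rule space_sec[OF G' U])
  have rc: "tensor_hom G' f U t \<in> carrier U'.T" if "t \<in> carrier U.T" for t
    unfolding tensor_hom_def
    by (rule U.tensor_map_closed[OF U'.modV U.scalar_linear_id sheaf_hom_linear[OF f U] that])
  have ra: "tensor_hom G' f U (s \<oplus>\<^bsub>U.T\<^esub> t) = tensor_hom G' f U s \<oplus>\<^bsub>U'.T\<^esub> tensor_hom G' f U t"
    if "s \<in> carrier U.T" "t \<in> carrier U.T" for s t
    unfolding tensor_hom_def
    by (rule U.tensor_map_add[OF U'.modV U.scalar_linear_id sheaf_hom_linear[OF f U] that])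
  show ?thesis
  proof (rule linear_mapsI[OF rc ra])
    fix a t assume a: "a \<in> carrier L" and t: "t \<in> carrier U.T"
    show "tensor_hom G' f U (a \<odot>\<^bsub>U.T\<^esub> t) = a \<odot>\<^bsub>U'.T\<^esub> tensor_hom G' f U t"
      using t
    proof (induction rule: U.tensor_induct)
      case (tens b v)
      then show ?case using a sheaf_hom_closed[OF f U]
        by (simp add: U.smult_tens U'.smult_tens tensor_hom_tens[OF U])
    next
      case (add s t)
      then show ?case using a by (simp add: U.smult_add U'.smult_add ra rc U.smult_closed)
    qed
  qed
qed

lemma tensor_hom_res:
  assumes UV: "openin X U" "openin X V" "V \<subseteq> U" and t: "t \<in> carrier (tensor L K (sec G U))"
  shows "tensor_hom G' f V (res (pre_ext L K G) U V t) = res (pre_ext L K G') U V (tensor_hom G' f U t)"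
proof -
  interpret U: galois_space L K "sec G U" by (rule space_sec[OF G UV(1)])
  note lin = pre_ext_res_linear[OF G UV] and lin' = pre_ext_res_linear[OF G' UV]
    and hU = tensor_hom_linear[OF UV(1)] and hV = tensor_hom_linear[OF UV(2)]
  show ?thesis using t
    by (induction rule: U.tensor_induct)
       (simp_all add: pre_ext_res_tens[OF G UV] pre_ext_res_tens[OF G' UV] tensor_hom_tens UV
         presheaf_res_closed[OF G UV] sheaf_hom_closed[OF f UV(1)] sheaf_hom_res[OF f UV]
         linear_maps_add[OF lin] linear_maps_add[OF lin'] linear_maps_add[OF hU] linear_maps_add[OF hV]
         linear_maps_closed[OF lin] linear_maps_closed[OF hU])
qed

lemma tensor_hom_sheaf_hom:
  "mk_hom X (pre_ext L K G) (tensor_hom G' f) \<in> sheaf_hom L X (pre_ext L K G) (pre_ext L K G')"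
  by (rule sheaf_homI[OF _ _ _ _ pre_ext_presheaf[OF G]])
     (simp_all add: linear_maps_closed[OF tensor_hom_linear] linear_maps_add[OF tensor_hom_linear]
       linear_maps_smult[OF tensor_hom_linear] tensor_hom_res)

lemma ext_map_unit:
  assumes "openin X U" "t \<in> carrier (tensor L K (sec G U))"
  shows "ext_map L K X G G' f U (sheafify_unit X (pre_ext L K G) U t)
    = sheafify_unit X (pre_ext L K G') U (tensor_hom G' f U t)"
  unfolding ext_map_def tensor_hom_def[symmetric]
  by (rule sheafify_map_unit[OF pre_ext_presheaf[OF G] pre_ext_presheaf[OF G']])
     (use assms linear_maps_closed[OF tensor_hom_linear] tensor_hom_res in auto)

end

context
  fixes X :: "'x topology" and G :: "('a, 'x, 'v) sheaf_data" and g
  assumes G: "presheaf KR X G" and g: "g \<in> Gal"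
begin

lemma tensor_gal_res:
  assumes UV: "openin X U" "openin X V" "V \<subseteq> U" and t: "t \<in> carrier (tensor L K (sec G U))"
  shows "tensor_gal G g V (res (pre_ext L K G) U V t) = res (pre_ext L K G) U V (tensor_gal G g U t)"
proof -
  interpret U: galois_space L K "sec G U" by (rule space_sec[OF G UV(1)])
  interpret V: galois_space L K "sec G V" by (rule space_sec[OF G UV(2)])
  note lin = pre_ext_res_linear[OF G UV]
  show ?thesis unfolding tensor_gal_def using t
    by (induction rule: U.tensor_induct)
       (simp_all add: pre_ext_res_tens[OF G UV] U.gal_tensor_tens V.gal_tensor_tens g
         presheaf_res_closed[OF G UV] linear_maps_add[OF lin] linear_maps_closed[OF lin]
         U.gal_tensor_add V.gal_tensor_add U.gal_tensor_closed)
qed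

lemma tensor_gal_closed:
  assumes "openin X U" "t \<in> carrier (tensor L K (sec G U))"
  shows "tensor_gal G g U t \<in> carrier (tensor L K (sec G U))"
  unfolding tensor_gal_def by (rule galois_space.gal_tensor_closed[OF space_sec[OF G assms(1)] g assms(2)])

lemma tensor_gal_sheaf_hom:
  "mk_hom X (pre_ext L K G) (tensor_gal G g) \<in> sheaf_hom L X (pre_ext L K G) (twist g (pre_ext L K G))"
  by (rule sheaf_homI[OF _ _ _ _ pre_ext_presheaf[OF G]])
     (simp_all add: tensor_gal_closed[unfolded tensor_gal_def] tensor_gal_res[unfolded tensor_gal_def]
       tensor_gal_def galois_space.gal_tensor_add[OF space_sec[OF G] g] galois_space.gal_tensor_smult[OF space_sec[OF G] g])

lemma ext_act_unit:
  assumes "openin X U" "t \<in> carrier (tensor L K (sec G U))"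
  shows "ext_act L K X G g U (sheafify_unit X (pre_ext L K G) U t)
    = sheafify_unit X (pre_ext L K G) U (tensor_gal G g U t)"
  unfolding ext_act_def tensor_gal_def[symmetric]
  by (rule sheafify_map_unit[OF pre_ext_presheaf[OF G] pre_ext_presheaf[OF G]])
     (use assms tensor_gal_closed tensor_gal_res in auto)

end

section \<open>Descent of sheaves\<close>

lemma G_structure_hom:
  assumes "G_structure L K X F \<phi>" "g \<in> Gal" shows "\<phi> g \<in> sheaf_hom L X F (twist g F)"
  using assms by (auto simp: G_structure_def intro: sheaf_iso_hom)

text \<open>The cocycle condition makes \<open>\<phi>\<close> of the identity an idempotent. It is injective as well, hence the
  identity.\<close>

lemma G_structure_action:
  assumes F: "presheaf L X F" and \<phi>: "G_structure L K X F \<phi>" and U: "openin X U"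
  shows "semilinear_action L K (sec F U) (\<lambda>g. \<phi> g U)"
proof -
  note hom = G_structure_hom[OF \<phi>]
  have comp: "\<phi> (compose (carrier L) g h) U v = \<phi> g U (\<phi> h U v)"
    if "g \<in> Gal" "h \<in> Gal" "v \<in> carrier (sec F U)" for g h v
    using \<phi> that U by (simp add: G_structure_def twist_mor_def sheaf_comp_apply)
  have one: "\<phi> gal_one U v = v" if v: "v \<in> carrier (sec F U)" for v
  proof -
    have "compose (carrier L) gal_one gal_one = gal_one"
      unfolding gal_one_def by (auto simp: compose_def)
    then have "\<phi> gal_one U (\<phi> gal_one U v) = \<phi> gal_one U v"
      using comp[OF gal_one_in gal_one_in v] by simp
    moreover have "inj_on (\<phi> gal_one U) (carrier (sec F U))"
      using \<phi> gal_one_in sheaf_iso_bij[of "\<phi> gal_one" L X F "twist gal_one F" U] U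
      by (auto simp: G_structure_def bij_betw_def)
    moreover have "\<phi> gal_one U v \<in> carrier (sec F U)"
      using sheaf_hom_closed[OF hom[OF gal_one_in] U v] by simp
    ultimately show ?thesis using v by (auto dest: inj_onD)
  qed
  show ?thesis
  proof (intro semilinear_action.intro galois_axioms semilinear_action_axioms.intro presheaf_module[OF F U])
    fix g v assume "g \<in> Gal" "v \<in> carrier (sec F U)"
    then show "\<phi> g U v \<in> carrier (sec F U)" using sheaf_hom_closed[OF hom U] by simp
  next
    fix g v w assume "g \<in> Gal" "v \<in> carrier (sec F U)" "w \<in> carrier (sec F U)"
    then show "\<phi> g U (v \<oplus>\<^bsub>sec F U\<^esub> w) = \<phi> g U v \<oplus>\<^bsub>sec F U\<^esub> \<phi> g U w"
      using sheaf_hom_add[OF hom U] by simp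
  next
    fix g a v assume "g \<in> Gal" "a \<in> carrier L" "v \<in> carrier (sec F U)"
    then show "\<phi> g U (a \<odot>\<^bsub>sec F U\<^esub> v) = g a \<odot>\<^bsub>sec F U\<^esub> \<phi> g U v"
      using sheaf_hom_smult[OF hom U] by simp
  qed (rule comp one; assumption)+
qed

definition inv_sheaf ::
    "('a, 'x, 'v) sheaf_data \<Rightarrow> (('a \<Rightarrow> 'a) \<Rightarrow> 'x set \<Rightarrow> 'v \<Rightarrow> 'v) \<Rightarrow> ('a, 'x, 'v) sheaf_data" where
  "inv_sheaf F \<phi> = \<lparr>sec = \<lambda>U. semilinear_action.invariants L K (sec F U) (\<lambda>g. \<phi> g U), res = res F\<rparr>"

context
  fixes X :: "'x topology" and F :: "('a, 'x, 'v) sheaf_data" and \<phi>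
  assumes F: "sheaf L X F" and \<phi>: "G_structure L K X F \<phi>"
begin

private lemma PF: "presheaf L X F" using F by (rule sheaf_presheaf)

lemma inv_sheaf_carrier:
  assumes "openin X U"
  shows "v \<in> carrier (sec (inv_sheaf F \<phi>) U) \<longleftrightarrow> v \<in> carrier (sec F U) \<and> (\<forall>g\<in>Gal. \<phi> g U v = v)"
  using semilinear_action.invariants_carrier[OF G_structure_action[OF PF \<phi> assms]]
  by (simp add: inv_sheaf_def)

lemma inv_sheaf_ops:
  assumes "openin X U"
  shows "add (sec (inv_sheaf F \<phi>) U) = add (sec F U)" "zero (sec (inv_sheaf F \<phi>) U) = zero (sec F U)"
    "smult (sec (inv_sheaf F \<phi>) U) = smult (sec F U)" "res (inv_sheaf F \<phi>) = res F"
  using semilinear_action.invariants_ops[OF G_structure_action[OF PF \<phi> assms]]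
  by (simp_all add: inv_sheaf_def)

text \<open>A section glued from invariant ones is invariant: it agrees with its image under \<open>\<phi> g\<close> on every
  member of the cover.\<close>

lemma inv_sheaf_sheaf: "sheaf KR X (inv_sheaf F \<phi>)"
proof (rule sheafI)
  have resF: "res (inv_sheaf F \<phi>) = res F" by (simp add: inv_sheaf_def)
  have act_res: "\<phi> g V (res F U V v) = res F U V (\<phi> g U v)"
    if "g \<in> Gal" "openin X U" "openin X V" "V \<subseteq> U" "v \<in> carrier (sec F U)" for g U V v
    using sheaf_hom_res[OF G_structure_hom[OF \<phi> that(1)] that(2-5)] by simp
  have closed: "res F U V v \<in> carrier (sec (inv_sheaf F \<phi>) V)"
    if "openin X U" "openin X V" "V \<subseteq> U" "v \<in> carrier (sec (inv_sheaf F \<phi>) U)" for U V v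
    using that by (simp add: inv_sheaf_carrier presheaf_res_closed[OF PF] act_res)
  show "presheaf KR X (inv_sheaf F \<phi>)"
    unfolding presheaf_def resF
  proof (intro conjI allI impI ballI; (elim conjE)?)
    fix U assume U: "openin X U"
    show "Module.module KR (sec (inv_sheaf F \<phi>) U)"
      using semilinear_action.invariants_module[OF G_structure_action[OF PF \<phi> U]]
      by (simp add: inv_sheaf_def)
    fix s assume "s \<in> carrier (sec (inv_sheaf F \<phi>) U)"
    then show "res F U U s = s" using U by (simp add: inv_sheaf_carrier presheaf_res_id[OF PF])
  next
    fix U V assume UV: "openin X U" "openin X V" "V \<subseteq> U"
    show "res F U V \<in> linear_maps KR (sec (inv_sheaf F \<phi>) U) (sec (inv_sheaf F \<phi>) V)"
      by (rule linear_mapsI)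
         (use UV closed[OF UV] in \<open>auto simp: inv_sheaf_ops inv_sheaf_carrier presheaf_res_add[OF PF]
            presheaf_res_smult[OF PF] K_closed\<close>)
  next
    fix U V W s assume UVW: "openin X U" "openin X V" "openin X W" "W \<subseteq> V" "V \<subseteq> U"
      and "s \<in> carrier (sec (inv_sheaf F \<phi>) U)"
    then show "res F V W (res F U V s) = res F U W s"
      by (simp add: inv_sheaf_carrier presheaf_res_comp[OF PF])
  qed
  fix \<U> assume op: "\<And>U. U \<in> \<U> \<Longrightarrow> openin X U"
  have W: "openin X (\<Union>\<U>)" using op by blast
  { fix s t assume "s \<in> carrier (sec (inv_sheaf F \<phi>) (\<Union>\<U>))" "t \<in> carrier (sec (inv_sheaf F \<phi>) (\<Union>\<U>))"
    then have st: "s \<in> carrier (sec F (\<Union>\<U>))" "t \<in> carrier (sec F (\<Union>\<U>))"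
      by (simp_all only: inv_sheaf_carrier[OF W])
    assume eq: "\<And>U. U \<in> \<U> \<Longrightarrow> res (inv_sheaf F \<phi>) (\<Union>\<U>) U s = res (inv_sheaf F \<phi>) (\<Union>\<U>) U t"
    show "s = t" by (rule sheaf_separated[OF F op st eq[unfolded resF]]) }
  fix \<sigma> assume \<sigma>: "\<And>U. U \<in> \<U> \<Longrightarrow> \<sigma> U \<in> carrier (sec (inv_sheaf F \<phi>) U)"
    and comp: "\<And>U V. U \<in> \<U> \<Longrightarrow> V \<in> \<U>
      \<Longrightarrow> res (inv_sheaf F \<phi>) U (U \<inter> V) (\<sigma> U) = res (inv_sheaf F \<phi>) V (U \<inter> V) (\<sigma> V)"
  have \<sigma>F: "\<sigma> U \<in> carrier (sec F U)" "\<And>g. g \<in> Gal \<Longrightarrow> \<phi> g U (\<sigma> U) = \<sigma> U" if "U \<in> \<U>" for U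
    using \<sigma>[OF that] inv_sheaf_carrier[OF op[OF that]] by auto
  obtain s where s: "s \<in> carrier (sec F (\<Union>\<U>))" "\<And>U. U \<in> \<U> \<Longrightarrow> res F (\<Union>\<U>) U s = \<sigma> U"
    using sheaf_glue[of L X F \<U> \<sigma>, OF F op \<sigma>F(1) comp[unfolded resF]] by auto
  have "\<phi> g (\<Union>\<U>) s = s" if g: "g \<in> Gal" for g
  proof (rule sheaf_separated[OF F op _ s(1)])
    show "\<phi> g (\<Union>\<U>) s \<in> carrier (sec F (\<Union>\<U>))"
      using sheaf_hom_closed[OF G_structure_hom[OF \<phi> g] W s(1)] by simp
    fix U assume U: "U \<in> \<U>"
    have "res F (\<Union>\<U>) U (\<phi> g (\<Union>\<U>) s) = \<phi> g U (res F (\<Union>\<U>) U s)"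
      by (rule act_res[OF g W op[OF U] Union_upper[OF U] s(1), symmetric])
    then show "res F (\<Union>\<U>) U (\<phi> g (\<Union>\<U>) s) = res F (\<Union>\<U>) U s"
      using U s(2) \<sigma>F(2)[OF U g] by simp
  qed
  then have "s \<in> carrier (sec (inv_sheaf F \<phi>) (\<Union>\<U>))" using s(1) by (simp add: inv_sheaf_carrier[OF W])
  then show "\<exists>s\<in>carrier (sec (inv_sheaf F \<phi>) (\<Union>\<U>)). \<forall>U\<in>\<U>. res (inv_sheaf F \<phi>) (\<Union>\<U>) U s = \<sigma> U"
    using s(2) resF by auto
qed

private lemma PI: "presheaf KR X (inv_sheaf F \<phi>)" using inv_sheaf_sheaf by (rule sheaf_presheaf)

definition sheaf_mult :: "'x set \<Rightarrow> (('a \<times> 'v) \<Rightarrow>\<^sub>0 int) set \<Rightarrow> 'v" where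
  "sheaf_mult U = semilinear_action.mult_map L K (sec F U) (\<lambda>g. \<phi> g U)"

lemma sheaf_mult_tens:
  assumes "openin X U" "a \<in> carrier L" "v \<in> carrier (sec (inv_sheaf F \<phi>) U)"
  shows "sheaf_mult U (tens L K (sec (inv_sheaf F \<phi>) U) a v) = a \<odot>\<^bsub>sec F U\<^esub> v"
  using semilinear_action.mult_map_tens[OF G_structure_action[OF PF \<phi> assms(1)] assms(2)] assms(3)
  by (simp add: sheaf_mult_def inv_sheaf_def)

lemma sheaf_mult_bij: "sheaf_bij L X (pre_ext L K (inv_sheaf F \<phi>)) F sheaf_mult"
proof (rule sheaf_bijI)
  fix U assume U: "openin X U"
  interpret A: semilinear_action L K "sec F U" "\<lambda>g. \<phi> g U" by (rule G_structure_action[OF PF \<phi> U])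
  have eq: "sec (inv_sheaf F \<phi>) U = A.invariants" by (simp add: inv_sheaf_def)
  show "bij_betw (sheaf_mult U) (carrier (sec (pre_ext L K (inv_sheaf F \<phi>)) U)) (carrier (sec F U))"
    unfolding pre_ext_sec eq sheaf_mult_def by (rule A.mult_map_bij)
  have add: "sheaf_mult U (s \<oplus>\<^bsub>A.inv.T\<^esub> t) = sheaf_mult U s \<oplus>\<^bsub>sec F U\<^esub> sheaf_mult U t"
    if "s \<in> carrier A.inv.T" "t \<in> carrier A.inv.T" for s t
    unfolding sheaf_mult_def by (rule A.mult_map_add[OF that])
  then show "sheaf_mult U (s \<oplus>\<^bsub>sec (pre_ext L K (inv_sheaf F \<phi>)) U\<^esub> t) = sheaf_mult U s \<oplus>\<^bsub>sec F U\<^esub> sheaf_mult U t"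
    if "s \<in> carrier (sec (pre_ext L K (inv_sheaf F \<phi>)) U)" "t \<in> carrier (sec (pre_ext L K (inv_sheaf F \<phi>)) U)" for s t
    using that unfolding pre_ext_sec eq .
  have z: "\<zero>\<^bsub>A.inv.T\<^esub> \<in> carrier A.inv.T" using A.inv.abelian_tensor by (simp add: abelian_groupE)
  show "sheaf_mult U \<zero>\<^bsub>sec (pre_ext L K (inv_sheaf F \<phi>)) U\<^esub> = \<zero>\<^bsub>sec F U\<^esub>"
    unfolding pre_ext_sec eq
    by (rule additive_zero[OF A.inv.abelian_tensor presheaf_abelian[OF PF U] _ add[OF z z]])
       (simp add: sheaf_mult_def A.mult_map_closed[OF z])
  fix a s assume "a \<in> carrier L" "s \<in> carrier (sec (pre_ext L K (inv_sheaf F \<phi>)) U)"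
  then show "sheaf_mult U (a \<odot>\<^bsub>sec (pre_ext L K (inv_sheaf F \<phi>)) U\<^esub> s) = a \<odot>\<^bsub>sec F U\<^esub> sheaf_mult U s"
    unfolding pre_ext_sec eq sheaf_mult_def by (rule A.mult_map_smult)
next
  fix U V s assume UV: "openin X U" "openin X V" "V \<subseteq> U" and s: "s \<in> carrier (sec (pre_ext L K (inv_sheaf F \<phi>)) U)"
  interpret A: semilinear_action L K "sec F U" "\<lambda>g. \<phi> g U" by (rule G_structure_action[OF PF \<phi> UV(1)])
  interpret B: semilinear_action L K "sec F V" "\<lambda>g. \<phi> g V" by (rule G_structure_action[OF PF \<phi> UV(2)])
  have eq: "sec (inv_sheaf F \<phi>) U = A.invariants" "sec (inv_sheaf F \<phi>) V = B.invariants"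
    by (simp_all add: inv_sheaf_def)
  note lin = pre_ext_res_linear[OF PI UV, unfolded eq]
  have "s \<in> carrier A.inv.T" using s eq by simp
  then show "sheaf_mult V (res (pre_ext L K (inv_sheaf F \<phi>)) U V s) = res F U V (sheaf_mult U s)"
  proof (induction rule: A.inv.tensor_induct)
    case (tens a v)
    then have v: "v \<in> carrier (sec (inv_sheaf F \<phi>) U)" using eq by simp
    then have "v \<in> carrier (sec F U)" using UV by (simp add: inv_sheaf_carrier)
    then show ?case using tens(1) v UV presheaf_res_closed[OF PI UV v]
      pre_ext_res_tens[OF PI UV tens(1) v] presheaf_res_smult[OF PF UV]
      by (simp add: eq[symmetric] sheaf_mult_tens inv_sheaf_ops[OF UV(1)])
  next
    case (add s t)
    then show ?case
      by (simp add: linear_maps_add[OF lin] sheaf_mult_def A.mult_map_add B.mult_map_add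
          linear_maps_closed[OF lin] A.mult_map_closed presheaf_res_add[OF PF UV])
  qed
qed

lemma sheaf_mult_act:
  assumes U: "openin X U" and g: "g \<in> Gal" and t: "t \<in> carrier (tensor L K (sec (inv_sheaf F \<phi>) U))"
  shows "sheaf_mult U (tensor_gal (inv_sheaf F \<phi>) g U t) = \<phi> g U (sheaf_mult U t)"
  using semilinear_action.mult_map_act[OF G_structure_action[OF PF \<phi> U] g] t
  by (simp add: sheaf_mult_def tensor_gal_def inv_sheaf_def)

end

end

section \<open>Sheaves known through a bijection\<close>

text \<open>The sheaf \<open>ext L K X G\<close> and its copy inside a universe both are \<open>U \<mapsto> L \<otimes> G(U)\<close> up to a bijection
  \<open>k\<close> in the sense of \<open>sheaf_bij\<close>. Every section of them is \<open>k U t\<close> for some \<open>t\<close>, so morphisms out of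
  them are determined by, and constructed from, their values at \<open>k U t\<close>. This treats both at once.\<close>

lemma sheaf_bij_comp:
  assumes i: "sheaf_bij R X F F' i" and j: "sheaf_bij R X F' F'' j"
  shows "sheaf_bij R X F F'' (\<lambda>U s. j U (i U s))"
proof (rule sheaf_bijI)
  fix U assume U: "openin X U"
  show "bij_betw (\<lambda>s. j U (i U s)) (carrier (sec F U)) (carrier (sec F'' U))"
    using bij_betw_trans[OF sheaf_bij_bij[OF i U] sheaf_bij_bij[OF j U]] by (simp add: comp_def)
qed (simp_all add: sheaf_bij_zero[OF i] sheaf_bij_zero[OF j] sheaf_bij_add[OF i] sheaf_bij_add[OF j]
      sheaf_bij_smult[OF i] sheaf_bij_smult[OF j] sheaf_bij_closed[OF i] sheaf_bij_res[OF i] sheaf_bij_res[OF j])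

text \<open>The square with sides \<open>k\<close>, \<open>m\<close>, \<open>h\<close> and \<open>f\<close> commutes, and \<open>k\<close> is surjective; thus \<open>f\<close> inherits
  all properties of a morphism from \<open>h\<close>.\<close>

lemma hom_of_models:
  assumes P: "presheaf R X P" and b: "sheaf_bij R X P E k" and c: "sheaf_bij R X Q F m"
    and hom: "mk_hom X P h \<in> sheaf_hom R X P Q"
    and ext: "mk_hom X E f = f"
    and val: "\<And>U t. openin X U \<Longrightarrow> t \<in> carrier (sec P U) \<Longrightarrow> f U (k U t) = m U (h U t)"
  shows "f \<in> sheaf_hom R X E F"
proof -
  have closed: "h U t \<in> carrier (sec Q U)" if "openin X U" "t \<in> carrier (sec P U)" for U t
    using sheaf_hom_closed[OF hom that] that by simp
  have "mk_hom X E f \<in> sheaf_hom R X E F"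
  proof (rule sheaf_homI)
    fix U u assume U: "openin X U" and "u \<in> carrier (sec E U)"
    then obtain s where s: "s \<in> carrier (sec P U)" "u = k U s" using sheaf_bij_surj[OF b U] by blast
    then show "f U u \<in> carrier (sec F U)" by (simp add: val sheaf_bij_closed[OF c] closed U)
    { fix v assume "v \<in> carrier (sec E U)"
      then obtain t where t: "t \<in> carrier (sec P U)" "v = k U t" using sheaf_bij_surj[OF b U] by blast
      then have "h U (s \<oplus>\<^bsub>sec P U\<^esub> t) = h U s \<oplus>\<^bsub>sec Q U\<^esub> h U t"
        using sheaf_hom_add[OF hom U s(1) t(1)] s U by (simp add: presheaf_add_closed[OF P])
      then show "f U (u \<oplus>\<^bsub>sec E U\<^esub> v) = f U u \<oplus>\<^bsub>sec F U\<^esub> f U v"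
        using s t by (simp add: sheaf_bij_add[OF b U, symmetric] val U presheaf_add_closed[OF P]
            sheaf_bij_add[OF c] closed) }
    { fix a assume a: "a \<in> carrier R"
      then have "h U (a \<odot>\<^bsub>sec P U\<^esub> s) = a \<odot>\<^bsub>sec Q U\<^esub> h U s"
        using sheaf_hom_smult[OF hom U a s(1)] s U by (simp add: presheaf_smult_closed[OF P])
      then show "f U (a \<odot>\<^bsub>sec E U\<^esub> u) = a \<odot>\<^bsub>sec F U\<^esub> f U u"
        using s a by (simp add: sheaf_bij_smult[OF b U, symmetric] val U presheaf_smult_closed[OF P]
            sheaf_bij_smult[OF c] closed) }
    { fix V assume V: "openin X V" "V \<subseteq> U"
      then have "h V (res P U V s) = res Q U V (h U s)"
        using sheaf_hom_res[OF hom U V s(1)] s U by (simp add: presheaf_res_closed[OF P])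
      then show "f V (res E U V u) = res F U V (f U u)"
        using s by (simp add: sheaf_bij_res[OF b U V, symmetric] val U V presheaf_res_closed[OF P]
            sheaf_bij_res[OF c] closed) }
  qed (rule sheaf_bij_presheaf[OF P b])
  then show ?thesis by (simp only: ext)
qed

lemma mk_hom_model_eqI:
  assumes b: "sheaf_bij R X P E k"
    and eq: "\<And>U t. openin X U \<Longrightarrow> t \<in> carrier (sec P U) \<Longrightarrow> f U (k U t) = f' U (k U t)"
  shows "mk_hom X E f = mk_hom X E f'"
proof (rule mk_hom_eqI)
  fix U u assume U: "openin X U" and "u \<in> carrier (sec E U)"
  then obtain s where "s \<in> carrier (sec P U)" "u = k U s" using sheaf_bij_surj[OF b U] by blast
  then show "f U u = f' U u" using eq U by simp
qed

lemma mk_hom_idem: "mk_hom X F (mk_hom X F h) = mk_hom X F h"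
  by (rule mk_hom_eqI) simp

lemma transport_sheaf_bij:
  assumes F: "presheaf R X F" and inj: "\<And>U. openin X U \<Longrightarrow> inj_on (i U) (carrier (sec F U))"
  shows "sheaf_bij R X F (transport i F) i"
proof (rule sheaf_bijI)
  fix U assume U: "openin X U"
  show "bij_betw (i U) (carrier (sec F U)) (carrier (sec (transport i F) U))"
    using inj[OF U] by (simp add: transport_def Let_def bij_betw_def)
qed (simp_all add: transport_def Let_def inj)

lemma transport_map_apply:
  assumes "openin X U" "inj_on (i U) (carrier (sec F U))" "s \<in> carrier (sec F U)"
  shows "transport_map X i i' F f U (i U s) = i' U (f U s)"
  using assms by (simp add: transport_map_def)

lemma transport_map_mk_hom: "mk_hom X (transport i F) (transport_map X i i' F f) = transport_map X i i' F f"
proof -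
  have "transport_map X i i' F f
      = mk_hom X (transport i F) (\<lambda>U a. i' U (f U (inv_into (carrier (sec F U)) (i U) a)))"
    by (simp add: transport_map_def mk_hom_def transport_def Let_def)
  then show ?thesis by (simp add: mk_hom_idem)
qed

section \<open>Categories of sheaves\<close>

lemma sheaf_comp_id_right:
  "f \<in> sheaf_hom R X F F' \<Longrightarrow> sheaf_comp X F f (sheaf_id X F) = f"
  by (subst (2) sheaf_hom_mk_hom[symmetric], assumption, unfold sheaf_comp_mk_hom, rule mk_hom_eqI)
     (simp add: sheaf_id_apply)

lemma sheaf_comp_id_left:
  "f \<in> sheaf_hom R X F F' \<Longrightarrow> sheaf_comp X F (sheaf_id X F') f = f"
  by (subst (2) sheaf_hom_mk_hom[symmetric], assumption, unfold sheaf_comp_mk_hom, rule mk_hom_eqI)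
     (simp add: sheaf_id_apply sheaf_hom_closed)

lemma sheaf_comp_assoc:
  "f \<in> sheaf_hom R X F F' \<Longrightarrow> sheaf_comp X F h (sheaf_comp X F g f) = sheaf_comp X F (sheaf_comp X F' h g) f"
  unfolding sheaf_comp_mk_hom by (rule mk_hom_eqI) (simp add: sheaf_hom_closed)

lemma is_category_ShMod: "is_category (ShMod R X)"
  unfolding is_category_def ShMod_def
  by (auto simp: sheaf_id_hom sheaf_presheaf sheaf_comp_hom sheaf_comp_id_right sheaf_comp_id_left
      sheaf_comp_assoc)

lemma sheaf_comp_eq_iff:
  "sheaf_comp X F g f = sheaf_comp X F g' f' \<longleftrightarrow>
    (\<forall>U. openin X U \<longrightarrow> (\<forall>s\<in>carrier (sec F U). g U (f U s) = g' U (f' U s)))"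
proof
  assume eq: "sheaf_comp X F g f = sheaf_comp X F g' f'"
  show "\<forall>U. openin X U \<longrightarrow> (\<forall>s\<in>carrier (sec F U). g U (f U s) = g' U (f' U s))"
    using sheaf_comp_apply[of X _ _ F g f] sheaf_comp_apply[of X _ _ F g' f'] unfolding eq by auto
qed (auto simp: sheaf_comp_mk_hom intro: mk_hom_eqI)

context galois begin

lemma ShModG_ob: "(F, \<phi>) \<in> ob (ShModG L K X) \<longleftrightarrow> sheaf L X F \<and> G_structure L K X F \<phi>"
  by (simp add: ShModG_def)

lemma ShModG_mor:
  "f \<in> mor (ShModG L K X) (F, \<phi>) (F', \<phi>') \<longleftrightarrow> f \<in> sheaf_hom L X F F' \<and>
    (\<forall>g\<in>Gal. \<forall>U. openin X U \<longrightarrow> (\<forall>s\<in>carrier (sec F U). \<phi>' g U (f U s) = f U (\<phi> g U s)))"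
  by (simp add: ShModG_def twist_mor_def sheaf_comp_eq_iff)

lemma ShModG_ident: "ident (ShModG L K X) (F, \<phi>) = sheaf_id X F"
  by (simp add: ShModG_def)

lemma ShModG_cmp: "cmp (ShModG L K X) (F, \<phi>) B C g f = sheaf_comp X F g f"
  by (simp add: ShModG_def)

lemma act_closed:
  "G_structure L K X F \<phi> \<Longrightarrow> g \<in> Gal \<Longrightarrow> openin X U \<Longrightarrow> s \<in> carrier (sec F U) \<Longrightarrow> \<phi> g U s \<in> carrier (sec F U)"
  using sheaf_hom_closed[OF G_structure_hom, of X F \<phi> g U s] by simp

lemma ShModG_comp_closed:
  assumes A: "(A, \<alpha>) \<in> ob (ShModG L K X)" and f: "f \<in> mor (ShModG L K X) (A, \<alpha>) (B, \<beta>)"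
    and g: "g \<in> mor (ShModG L K X) (B, \<beta>) (C, \<gamma>)"
  shows "sheaf_comp X A g f \<in> mor (ShModG L K X) (A, \<alpha>) (C, \<gamma>)"
  using assms sheaf_comp_hom[OF sheaf_presheaf]
  by (auto simp: ShModG_ob ShModG_mor sheaf_comp_apply sheaf_hom_closed act_closed)

lemma is_category_ShModG:
  fixes X :: "'x topology"
  shows "is_category (ShModG L K X :: (('a, 'x, 'v) sheaf_data \<times> (('a \<Rightarrow> 'a) \<Rightarrow> 'x set \<Rightarrow> 'v \<Rightarrow> 'v), _) cat)"
  unfolding is_category_def
proof (intro conjI ballI; clarify?)
  fix A :: "('a, 'x, 'v) sheaf_data" and \<alpha> assume A: "(A, \<alpha>) \<in> ob (ShModG L K X)"
  then show "ident (ShModG L K X) (A, \<alpha>) \<in> mor (ShModG L K X) (A, \<alpha>) (A, \<alpha>)"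
    by (auto simp: ShModG_ident ShModG_ob ShModG_mor sheaf_id_hom sheaf_presheaf sheaf_id_apply act_closed)
  fix B :: "('a, 'x, 'v) sheaf_data" and \<beta> assume B: "(B, \<beta>) \<in> ob (ShModG L K X)"
  fix f assume f: "f \<in> mor (ShModG L K X) (A, \<alpha>) (B, \<beta>)"
  then show "cmp (ShModG L K X) (A, \<alpha>) (A, \<alpha>) (B, \<beta>) f (ident (ShModG L K X) (A, \<alpha>)) = f"
    "cmp (ShModG L K X) (A, \<alpha>) (B, \<beta>) (B, \<beta>) (ident (ShModG L K X) (B, \<beta>)) f = f"
    by (auto simp: ShModG_ident ShModG_cmp ShModG_mor sheaf_comp_id_right sheaf_comp_id_left)
  fix C :: "('a, 'x, 'v) sheaf_data" and \<gamma> assume C: "(C, \<gamma>) \<in> ob (ShModG L K X)"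
  fix g assume g: "g \<in> mor (ShModG L K X) (B, \<beta>) (C, \<gamma>)"
  show "cmp (ShModG L K X) (A, \<alpha>) (B, \<beta>) (C, \<gamma>) g f \<in> mor (ShModG L K X) (A, \<alpha>) (C, \<gamma>)"
    unfolding ShModG_cmp by (rule ShModG_comp_closed[OF A f g])
  fix D :: "('a, 'x, 'v) sheaf_data" and \<delta> h
  show "cmp (ShModG L K X) (A, \<alpha>) (C, \<gamma>) (D, \<delta>) h (cmp (ShModG L K X) (A, \<alpha>) (B, \<beta>) (C, \<gamma>) g f)
    = cmp (ShModG L K X) (A, \<alpha>) (B, \<beta>) (D, \<delta>) (cmp (ShModG L K X) (B, \<beta>) (C, \<gamma>) (D, \<delta>) h g) f"
    unfolding ShModG_cmp using f by (intro sheaf_comp_assoc[where R = L]) (simp add: ShModG_mor)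
qed

lemma is_isomorphism_ShMod: "f \<in> sheaf_iso R X F F' \<Longrightarrow> is_isomorphism (ShMod R X) F F' f"
  by (auto simp: is_isomorphism_def ShMod_def sheaf_iso_def)

text \<open>The inverse of an equivariant isomorphism of sheaves is automatically equivariant.\<close>

lemma is_isomorphism_ShModG:
  assumes ob: "(F, \<phi>) \<in> ob (ShModG L K X)" "(F', \<phi>') \<in> ob (ShModG L K X)"
    and f: "f \<in> mor (ShModG L K X) (F, \<phi>) (F', \<phi>')" and iso: "f \<in> sheaf_iso L X F F'"
  shows "is_isomorphism (ShModG L K X) (F, \<phi>) (F', \<phi>') f"
proof -
  obtain h where h: "h \<in> sheaf_hom L X F' F" "sheaf_comp X F h f = sheaf_id X F"
    "sheaf_comp X F' f h = sheaf_id X F'"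
    using iso unfolding sheaf_iso_def by blast
  have hf: "h U (f U s) = s" if "openin X U" "s \<in> carrier (sec F U)" for U s
    using that h(2) by (metis sheaf_comp_apply sheaf_id_apply)
  have fh: "f U (h U s) = s" if "openin X U" "s \<in> carrier (sec F' U)" for U s
    using that h(3) by (metis sheaf_comp_apply sheaf_id_apply)
  have "\<phi> g U (h U s) = h U (\<phi>' g U s)"
    if g: "g \<in> Gal" and U: "openin X U" and s: "s \<in> carrier (sec F' U)" for g U s
  proof -
    have hs: "h U s \<in> carrier (sec F U)" using sheaf_hom_closed[OF h(1) U s] .
    have "\<phi>' g U (f U (h U s)) = f U (\<phi> g U (h U s))" using f g U hs by (simp add: ShModG_mor)
    moreover have "\<phi> g U (h U s) \<in> carrier (sec F U)" using act_closed ob(1) g U hs by (auto simp: ShModG_ob)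
    ultimately show ?thesis using hf[OF U] fh[OF U s] by metis
  qed
  then have "h \<in> mor (ShModG L K X) (F', \<phi>') (F, \<phi>)" using h(1) by (simp add: ShModG_mor)
  then show ?thesis unfolding is_isomorphism_def using f h by (auto simp: ShModG_cmp ShModG_ident)
qed

section \<open>The descent isomorphism\<close>

definition inv_hom :: "'x topology \<Rightarrow> ('a, 'x, 'v) sheaf_data \<times> (('a \<Rightarrow> 'a) \<Rightarrow> 'x set \<Rightarrow> 'v \<Rightarrow> 'v)
    \<Rightarrow> ('x set \<Rightarrow> 'v \<Rightarrow> 'w) \<Rightarrow> 'x set \<Rightarrow> 'v \<Rightarrow> 'w" where
  "inv_hom X = (\<lambda>(F, \<phi>). mk_hom X (inv_sheaf F \<phi>))"

lemma inv_hom_apply: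
  "openin X U \<Longrightarrow> s \<in> carrier (sec (inv_sheaf F \<phi>) U) \<Longrightarrow> inv_hom X (F, \<phi>) f U s = f U s"
  by (simp add: inv_hom_def)

lemma inv_hom_in:
  assumes A: "(F, \<phi>) \<in> ob (ShModG L K X)" and B: "(F', \<phi>') \<in> ob (ShModG L K X)"
    and f: "f \<in> mor (ShModG L K X) (F, \<phi>) (F', \<phi>')"
  shows "inv_hom X (F, \<phi>) f \<in> sheaf_hom KR X (inv_sheaf F \<phi>) (inv_sheaf F' \<phi>')"
proof -
  have A': "sheaf L X F" "G_structure L K X F \<phi>" and B': "sheaf L X F'" "G_structure L K X F' \<phi>'"
    using A B by (auto simp: ShModG_ob)
  have fh: "f \<in> sheaf_hom L X F F'" and eq: "\<And>g U s. g \<in> Gal \<Longrightarrow> openin X U \<Longrightarrow> s \<in> carrier (sec F U)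
      \<Longrightarrow> \<phi>' g U (f U s) = f U (\<phi> g U s)"
    using f by (auto simp: ShModG_mor)
  show ?thesis unfolding inv_hom_def prod.case
    by (rule sheaf_homI)
       (auto simp: inv_sheaf_carrier[OF A'] inv_sheaf_carrier[OF B'] inv_sheaf_ops[OF A'] inv_sheaf_ops[OF B']
         sheaf_hom_closed[OF fh] sheaf_hom_add[OF fh] sheaf_hom_smult[OF fh] sheaf_hom_res[OF fh] eq K_closed
         intro: sheaf_presheaf[OF inv_sheaf_sheaf[OF A']])
qed

lemma inv_functor:
  fixes X :: "'x topology"
  shows "is_functor (ShModG L K X) (ShMod KR X) (\<lambda>(F :: ('a, 'x, 'v) sheaf_data, \<phi>). inv_sheaf F \<phi>) (\<lambda>A B. inv_hom X A)"
  unfolding is_functor_def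
proof (intro conjI ballI; clarify?)
  fix F :: "('a, 'x, 'v) sheaf_data" and \<phi> assume A: "(F, \<phi>) \<in> ob (ShModG L K X)"
  then have A': "sheaf L X F" "G_structure L K X F \<phi>" by (auto simp: ShModG_ob)
  show "inv_sheaf F \<phi> \<in> ob (ShMod KR X)" using inv_sheaf_sheaf[OF A'] by (simp add: ShMod_def)
  show "inv_hom X (F, \<phi>) (ident (ShModG L K X) (F, \<phi>)) = ident (ShMod KR X) (inv_sheaf F \<phi>)"
    by (auto simp: ShMod_def ShModG_ident inv_hom_def sheaf_id_mk_hom inv_sheaf_carrier[OF A'] intro!: mk_hom_eqI)
  fix F' :: "('a, 'x, 'v) sheaf_data" and \<phi>' f assume B: "(F', \<phi>') \<in> ob (ShModG L K X)" and f: "f \<in> mor (ShModG L K X) (F, \<phi>) (F', \<phi>')"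
  note fi = inv_hom_in[OF A B f]
  show "inv_hom X (F, \<phi>) f \<in> mor (ShMod KR X) (inv_sheaf F \<phi>) (inv_sheaf F' \<phi>')"
    using fi by (simp add: ShMod_def)
  fix F'' :: "('a, 'x, 'v) sheaf_data" and \<phi>'' g
  show "inv_hom X (F, \<phi>) (cmp (ShModG L K X) (F, \<phi>) (F', \<phi>') (F'', \<phi>'') g f)
      = cmp (ShMod KR X) (inv_sheaf F \<phi>) (inv_sheaf F' \<phi>') (inv_sheaf F'' \<phi>'')
          (inv_hom X (F', \<phi>') g) (inv_hom X (F, \<phi>) f)"
    unfolding ShModG_cmp
    using sheaf_hom_closed[OF fi]
    by (auto simp: ShMod_def sheaf_comp_mk_hom inv_hom_def inv_sheaf_carrier[OF A'] intro!: mk_hom_eqI)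
qed

lemma sheaf_mult_hom:
  assumes A: "(F, \<phi>) \<in> ob (ShModG L K X)" and B: "(F', \<phi>') \<in> ob (ShModG L K X)"
    and f: "f \<in> mor (ShModG L K X) (F, \<phi>) (F', \<phi>')"
    and U: "openin X U" and t: "t \<in> carrier (tensor L K (sec (inv_sheaf F \<phi>) U))"
  shows "sheaf_mult F' \<phi>' U (tensor_hom (inv_sheaf F' \<phi>') (inv_hom X (F, \<phi>) f) U t) = f U (sheaf_mult F \<phi> U t)"
proof -
  have A': "sheaf L X F" "G_structure L K X F \<phi>" and B': "sheaf L X F'" "G_structure L K X F' \<phi>'"
    using A B by (auto simp: ShModG_ob)
  have P: "presheaf KR X (inv_sheaf F \<phi>)" and P': "presheaf KR X (inv_sheaf F' \<phi>')"
    using inv_sheaf_sheaf[OF A'] inv_sheaf_sheaf[OF B'] by (auto intro: sheaf_presheaf)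
  have fh: "f \<in> sheaf_hom L X F F'" using f by (simp add: ShModG_mor)
  note fi = inv_hom_in[OF A B f]
  note th = tensor_hom_tens[OF P P' fi U] and tl = tensor_hom_linear[OF P P' fi U]
  note m = sheaf_mult_bij[OF A'] and m' = sheaf_mult_bij[OF B']
  interpret S: galois_space L K "sec (inv_sheaf F \<phi>) U" by (rule space_sec[OF P U])
  show ?thesis using t
  proof (induction rule: S.tensor_induct)
    case (tens a v)
    have "inv_hom X (F, \<phi>) f U v \<in> carrier (sec (inv_sheaf F' \<phi>') U)"
      using sheaf_hom_closed[OF fi U tens(2)] .
    moreover have "v \<in> carrier (sec F U)" using tens(2) inv_sheaf_carrier[OF A' U] by blast
    ultimately show ?case using tens
      by (simp add: th sheaf_mult_tens[OF A' U] sheaf_mult_tens[OF B' U] inv_hom_apply[OF U] sheaf_hom_smult[OF fh U])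
  next
    case (add s t)
    then show ?case
      using sheaf_bij_add[OF m U] sheaf_bij_add[OF m' U] sheaf_bij_closed[OF m U]
      by (simp add: linear_maps_add[OF tl] linear_maps_closed[OF tl] sheaf_hom_add[OF fh U])
  qed
qed

text \<open>Multiplication from \<open>L \<otimes> Inv F(U)\<close> to \<open>F(U)\<close>, read through the bijection \<open>k\<close> with the sections of \<open>E\<close>.\<close>

definition descent_map :: "'x topology \<Rightarrow> ('a, 'x, 'w) sheaf_data \<Rightarrow> ('x set \<Rightarrow> (('a \<times> 'v) \<Rightarrow>\<^sub>0 int) set \<Rightarrow> 'w)
    \<Rightarrow> ('a, 'x, 'v) sheaf_data \<times> (('a \<Rightarrow> 'a) \<Rightarrow> 'x set \<Rightarrow> 'v \<Rightarrow> 'v) \<Rightarrow> 'x set \<Rightarrow> 'w \<Rightarrow> 'v" where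
  "descent_map X E k = (\<lambda>(F, \<phi>). mk_hom X E (\<lambda>U u.
     sheaf_mult F \<phi> U (inv_into (carrier (tensor L K (sec (inv_sheaf F \<phi>) U))) (k U) u)))"

lemma descent_map_mk_hom: "mk_hom X E (descent_map X E k A) = descent_map X E k A"
  by (simp add: descent_map_def mk_hom_idem case_prod_beta)

context
  fixes X :: "'x topology" and F :: "('a, 'x, 'v) sheaf_data" and \<phi> and E :: "('a, 'x, 'w) sheaf_data" and k
  assumes A: "(F, \<phi>) \<in> ob (ShModG L K X)"
    and b: "sheaf_bij L X (pre_ext L K (inv_sheaf F \<phi>)) E k"
begin

private lemma A': "sheaf L X F" "G_structure L K X F \<phi>" using A by (auto simp: ShModG_ob)

private lemma pre_ext_P: "presheaf L X (pre_ext L K (inv_sheaf F \<phi>))"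
  by (rule pre_ext_presheaf[OF sheaf_presheaf[OF inv_sheaf_sheaf[OF A']]])

lemma descent_map_apply:
  assumes U: "openin X U" and t: "t \<in> carrier (tensor L K (sec (inv_sheaf F \<phi>) U))"
  shows "descent_map X E k (F, \<phi>) U (k U t) = sheaf_mult F \<phi> U t"
  using sheaf_bij_bij[OF b U] sheaf_bij_closed[OF b U, of t] t U
  by (simp add: descent_map_def bij_betw_def)

lemma descent_map_iso: "descent_map X E k (F, \<phi>) \<in> sheaf_iso L X E F"
proof (rule sheaf_isoI[OF sheaf_bij_presheaf[OF pre_ext_P b] sheaf_presheaf[OF A'(1)]])
  note m = sheaf_mult_bij[OF A']
  show "descent_map X E k (F, \<phi>) \<in> sheaf_hom L X E F"
    by (rule hom_of_models[OF pre_ext_P b m, where h = "\<lambda>U t. t"])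
       (simp_all add: sheaf_id_mk_hom[symmetric] sheaf_id_hom[OF pre_ext_P] descent_map_apply descent_map_mk_hom)
  fix U assume U: "openin X U"
  have "bij_betw (descent_map X E k (F, \<phi>) U \<circ> k U) (carrier (sec (pre_ext L K (inv_sheaf F \<phi>)) U)) (carrier (sec F U))"
    by (rule bij_betw_cong[THEN iffD2, OF _ sheaf_bij_bij[OF m U]]) (simp add: descent_map_apply U)
  then show "bij_betw (descent_map X E k (F, \<phi>) U) (carrier (sec E U)) (carrier (sec F U))"
    using bij_betw_comp_iff[OF sheaf_bij_bij[OF b U]] by blast
qed

lemma descent_map_act:
  assumes g: "g \<in> Gal" and U: "openin X U" and t: "t \<in> carrier (tensor L K (sec (inv_sheaf F \<phi>) U))"
  shows "\<phi> g U (descent_map X E k (F, \<phi>) U (k U t))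
    = descent_map X E k (F, \<phi>) U (k U (tensor_gal (inv_sheaf F \<phi>) g U t))"
  using tensor_gal_closed[OF sheaf_presheaf[OF inv_sheaf_sheaf[OF A']] g U t]
  by (simp add: descent_map_apply U t sheaf_mult_act[OF A' U g t])

end

lemma descent_map_natural:
  assumes A: "(F, \<phi>) \<in> ob (ShModG L K X)" and B: "(F', \<phi>') \<in> ob (ShModG L K X)"
    and f: "f \<in> mor (ShModG L K X) (F, \<phi>) (F', \<phi>')"
    and b: "sheaf_bij L X (pre_ext L K (inv_sheaf F \<phi>)) E k"
    and b': "sheaf_bij L X (pre_ext L K (inv_sheaf F' \<phi>')) E' k'"
    and \<theta>: "\<And>U t. openin X U \<Longrightarrow> t \<in> carrier (tensor L K (sec (inv_sheaf F \<phi>) U))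
      \<Longrightarrow> \<theta> U (k U t) = k' U (tensor_hom (inv_sheaf F' \<phi>') (inv_hom X (F, \<phi>) f) U t)"
  shows "sheaf_comp X E (descent_map X E' k' (F', \<phi>')) \<theta> = sheaf_comp X E f (descent_map X E k (F, \<phi>))"
  unfolding sheaf_comp_mk_hom
proof (rule mk_hom_model_eqI[OF b])
  have P: "presheaf KR X (inv_sheaf F \<phi>)" "presheaf KR X (inv_sheaf F' \<phi>')"
    using A B by (auto simp: ShModG_ob intro: sheaf_presheaf inv_sheaf_sheaf)
  fix U t assume U: "openin X U" and "t \<in> carrier (sec (pre_ext L K (inv_sheaf F \<phi>)) U)"
  then have t: "t \<in> carrier (tensor L K (sec (inv_sheaf F \<phi>) U))" by simp
  have "tensor_hom (inv_sheaf F' \<phi>') (inv_hom X (F, \<phi>) f) U t \<in> carrier (tensor L K (sec (inv_sheaf F' \<phi>') U))"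
    using linear_maps_closed[OF tensor_hom_linear[OF P inv_hom_in[OF A B f] U] t] .
  then show "descent_map X E' k' (F', \<phi>') U (\<theta> U (k U t)) = f U (descent_map X E k (F, \<phi>) U (k U t))"
    using U t by (simp add: \<theta> descent_map_apply[OF A b] descent_map_apply[OF B b'] sheaf_mult_hom[OF A B f])
qed

abbreviation "ext_unit X G \<equiv> sheafify_unit X (pre_ext L K G)"

definition ext_descent :: "'x topology \<Rightarrow> ('a, 'x, 'v) sheaf_data \<times> (('a \<Rightarrow> 'a) \<Rightarrow> 'x set \<Rightarrow> 'v \<Rightarrow> 'v)
    \<Rightarrow> 'x set \<Rightarrow> ('a, 'x, 'v) tensor_section \<Rightarrow> 'v" where
  "ext_descent X = (\<lambda>(F, \<phi>). descent_map X (ext L K X (inv_sheaf F \<phi>)) (ext_unit X (inv_sheaf F \<phi>)) (F, \<phi>))"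

lemma ext_descent_iso:
  assumes A: "(F, \<phi>) \<in> ob (ShModG L K X)"
  shows "ext_descent X (F, \<phi>) \<in> sheaf_iso L X (ext L K X (inv_sheaf F \<phi>)) F"
proof -
  have A': "sheaf L X F" "G_structure L K X F \<phi>" using A by (auto simp: ShModG_ob)
  show ?thesis unfolding ext_descent_def prod.case
    by (rule descent_map_iso[OF A ext_sheaf_bij[OF inv_sheaf_sheaf[OF A']]])
qed

lemma ext_descent_act:
  assumes A: "(F, \<phi>) \<in> ob (ShModG L K X)" and g: "g \<in> Gal"
  shows "sheaf_comp X (ext L K X (inv_sheaf F \<phi>)) (\<phi> g) (ext_descent X (F, \<phi>))
    = sheaf_comp X (ext L K X (inv_sheaf F \<phi>)) (ext_descent X (F, \<phi>)) (ext_act L K X (inv_sheaf F \<phi>) g)"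
proof -
  have A': "sheaf L X F" "G_structure L K X F \<phi>" using A by (auto simp: ShModG_ob)
  note S = inv_sheaf_sheaf[OF A']
  note b = ext_sheaf_bij[OF S]
  show ?thesis unfolding sheaf_comp_mk_hom
    by (rule mk_hom_model_eqI[OF b])
       (simp add: ext_descent_def descent_map_act[OF A b g] ext_act_unit[OF sheaf_presheaf[OF S] g])
qed

lemma ext_descent_natural:
  assumes A: "(F, \<phi>) \<in> ob (ShModG L K X)" and B: "(F', \<phi>') \<in> ob (ShModG L K X)"
    and f: "f \<in> mor (ShModG L K X) (F, \<phi>) (F', \<phi>')"
  shows "sheaf_comp X (ext L K X (inv_sheaf F \<phi>)) (ext_descent X (F', \<phi>'))
      (ext_map L K X (inv_sheaf F \<phi>) (inv_sheaf F' \<phi>') (inv_hom X (F, \<phi>) f))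
    = sheaf_comp X (ext L K X (inv_sheaf F \<phi>)) f (ext_descent X (F, \<phi>))"
proof -
  have S: "sheaf KR X (inv_sheaf F \<phi>)" "sheaf KR X (inv_sheaf F' \<phi>')"
    using A B by (auto simp: ShModG_ob intro: inv_sheaf_sheaf)
  show ?thesis unfolding ext_descent_def prod.case
    by (rule descent_map_natural[OF A B f ext_sheaf_bij[OF S(1)] ext_sheaf_bij[OF S(2)]])
       (rule ext_map_unit[OF sheaf_presheaf[OF S(1)] sheaf_presheaf[OF S(2)] inv_hom_in[OF A B f]])
qed

section \<open>The equivalence of categories\<close>

text \<open>The operations of a twist are those of \<open>F\<close> with the scalars moved by a ring automorphism.\<close>

lemma twist_presheaf:
  assumes F: "presheaf L X F" and g: "g \<in> Gal" shows "presheaf L X (twist g F)"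
  unfolding presheaf_def
proof (intro conjI allI impI ballI; (elim conjE)?)
  fix U assume U: "openin X U"
  interpret F: Module.module L "sec F U" by (rule presheaf_module[OF F U])
  have "abelian_group (sec (twist g F) U)"
    by (rule abelian_groupI)
       (auto simp: F.M.a_ac intro!: bexI[where x = "\<ominus>\<^bsub>sec F U\<^esub> _"] F.M.l_neg)
  then show "Module.module L (sec (twist g F) U)"
    by (rule moduleI[OF is_cring])
       (auto simp: g gal_add gal_mult F.smult_l_distr F.smult_r_distr F.smult_assoc1 ring_hom_one[OF gal_hom[OF g]])
  fix s assume "s \<in> carrier (sec (twist g F) U)"
  then show "res (twist g F) U U s = s" using presheaf_res_id[OF F U] by simp
next
  fix U V assume UV: "openin X U" "openin X V" "V \<subseteq> U"
  show "res (twist g F) U V \<in> linear_maps L (sec (twist g F) U) (sec (twist g F) V)"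
    by (rule linear_mapsI)
       (auto simp: g presheaf_res_closed[OF F UV] presheaf_res_add[OF F UV] presheaf_res_smult[OF F UV])
next
  fix U V W s assume "openin X U" "openin X V" "openin X W" "W \<subseteq> V" "V \<subseteq> U" "s \<in> carrier (sec (twist g F) U)"
  then show "res (twist g F) V W (res (twist g F) U V s) = res (twist g F) U W s"
    by (simp add: presheaf_res_comp[OF F])
qed

lemma twist_sheaf_bij:
  "sheaf_bij L X P E k \<Longrightarrow> g \<in> Gal \<Longrightarrow> sheaf_bij L X (twist g P) (twist g E) k"
  by (rule sheaf_bijI)
     (simp_all add: sheaf_bij_bij sheaf_bij_zero sheaf_bij_add sheaf_bij_smult sheaf_bij_res)

context
  fixes X :: "'x topology" and e :: "('a, 'x, 'u) sheaf_data \<Rightarrow> 'x set \<Rightarrow> ('a, 'x, 'u) tensor_section \<Rightarrow> 'u"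
  assumes e: "universe_embedding L K X e"
begin

definition phi_unit :: "('a, 'x, 'u) sheaf_data \<Rightarrow> 'x set \<Rightarrow> (('a \<times> 'u) \<Rightarrow>\<^sub>0 int) set \<Rightarrow> 'u" where
  "phi_unit G U t = e G U (ext_unit X G U t)"

abbreviation "phi_sheaf G \<equiv> fst (PhiG L K X e G)"
abbreviation "phi_act G \<equiv> snd (PhiG L K X e G)"
abbreviation "phi_map \<equiv> PhiG_map L K X e"

private lemma e_inj: "sheaf KR X G \<Longrightarrow> openin X U \<Longrightarrow> inj_on (e G U) (carrier (sec (ext L K X G) U))"
  using e by (simp add: universe_embedding_def)

context
  fixes G :: "('a, 'x, 'u) sheaf_data" assumes G: "sheaf KR X G"
begin

private lemma PG: "presheaf KR X G" using G by (rule sheaf_presheaf)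

lemma phi_bij: "sheaf_bij L X (pre_ext L K G) (phi_sheaf G) (phi_unit G)"
proof -
  have "presheaf L X (ext L K X G)"
    by (rule sheaf_bij_presheaf[OF pre_ext_presheaf[OF PG] ext_sheaf_bij[OF G]])
  then have "sheaf_bij L X (ext L K X G) (transport (e G) (ext L K X G)) (e G)"
    by (rule transport_sheaf_bij) (rule e_inj[OF G])
  then show ?thesis
    using sheaf_bij_comp[OF ext_sheaf_bij[OF G]] unfolding phi_unit_def PhiG_def by simp
qed

lemma phi_sheaf: "sheaf L X (phi_sheaf G)"
  by (rule sheaf_bij_sheaf[OF pre_ext_sheaf[OF G] phi_bij])

lemma phi_act_unit:
  assumes "g \<in> Gal" "openin X U" "t \<in> carrier (tensor L K (sec G U))"
  shows "phi_act G g U (phi_unit G U t) = phi_unit G U (tensor_gal G g U t)"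
  using assms sheaf_bij_closed[OF ext_sheaf_bij[OF G] assms(2), of t]
  by (simp add: PhiG_def phi_unit_def transport_map_apply e_inj[OF G] ext_act_unit[OF PG])

lemma phi_act_mk_hom: "mk_hom X (phi_sheaf G) (phi_act G g) = phi_act G g"
  by (simp add: PhiG_def transport_map_mk_hom)

lemma phi_act_hom:
  assumes g: "g \<in> Gal" shows "phi_act G g \<in> sheaf_hom L X (phi_sheaf G) (twist g (phi_sheaf G))"
  by (rule hom_of_models[OF pre_ext_presheaf[OF PG] phi_bij twist_sheaf_bij[OF phi_bij g]
        tensor_gal_sheaf_hom[OF PG g] phi_act_mk_hom])
     (simp add: phi_act_unit[OF g])

lemma phi_act_comp:
  assumes "g \<in> Gal" "h \<in> Gal" "openin X U" "u \<in> carrier (sec (phi_sheaf G) U)"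
  shows "phi_act G (compose (carrier L) g h) U u = phi_act G g U (phi_act G h U u)"
proof -
  obtain t where t: "t \<in> carrier (tensor L K (sec G U))" "u = phi_unit G U t"
    using sheaf_bij_surj[OF phi_bij assms(3,4)] by auto
  then show ?thesis
    using assms galois_space.gal_tensor_comp[OF space_sec[OF PG]]
    by (simp add: phi_act_unit gal_comp tensor_gal_closed[OF PG], simp add: tensor_gal_def)
qed

lemma phi_act_one:
  assumes "openin X U" "u \<in> carrier (sec (phi_sheaf G) U)"
  shows "phi_act G gal_one U u = u"
proof -
  obtain t where t: "t \<in> carrier (tensor L K (sec G U))" "u = phi_unit G U t"
    using sheaf_bij_surj[OF phi_bij assms] by auto
  then show ?thesis using assms galois_space.gal_tensor_one[OF space_sec[OF PG]]
    by (simp add: phi_act_unit gal_one_in tensor_gal_def)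
qed

text \<open>Each \<open>g \<otimes> id\<close> is bijective because the tensored inverse automorphism undoes it.\<close>

lemma phi_G_structure: "G_structure L K X (phi_sheaf G) (phi_act G)"
  unfolding G_structure_def
proof (intro conjI ballI)
  have P: "presheaf L X (phi_sheaf G)" using phi_sheaf by (rule sheaf_presheaf)
  have closed: "phi_act G g U u \<in> carrier (sec (phi_sheaf G) U)"
    if "g \<in> Gal" "openin X U" "u \<in> carrier (sec (phi_sheaf G) U)" for g U u
    using sheaf_hom_closed[OF phi_act_hom that(2)] that by simp
  fix g assume g: "g \<in> Gal"
  show "phi_act G g \<in> sheaf_iso L X (phi_sheaf G) (twist g (phi_sheaf G))"
  proof (rule sheaf_isoI[OF P twist_presheaf[OF P g] phi_act_hom[OF g]])
    fix U assume U: "openin X U"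
    obtain h where h: "h \<in> Gal" "compose (carrier L) g h = gal_one" "compose (carrier L) h g = gal_one"
      using gal_inv[OF g] .
    show "bij_betw (phi_act G g U) (carrier (sec (phi_sheaf G) U)) (carrier (sec (twist g (phi_sheaf G)) U))"
      by (rule bij_betw_byWitness[where f' = "phi_act G h U"])
         (use g h U closed in \<open>auto simp: phi_act_comp[symmetric] phi_act_one\<close>)
  qed
  fix h assume h: "h \<in> Gal"
  show "phi_act G (compose (carrier L) g h) = sheaf_comp X (phi_sheaf G) (twist_mor h (phi_act G g)) (phi_act G h)"
    unfolding sheaf_comp_mk_hom twist_mor_def
    by (subst phi_act_mk_hom[symmetric], rule mk_hom_eqI) (simp add: phi_act_comp g h)
qed

end

lemma phi_ob: "sheaf KR X G \<Longrightarrow> PhiG L K X e G \<in> ob (ShModG L K X)"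
  using ShModG_ob[of "phi_sheaf G" "phi_act G" X] phi_sheaf phi_G_structure by simp

context
  fixes G G' :: "('a, 'x, 'u) sheaf_data" and f assumes G: "sheaf KR X G" and G': "sheaf KR X G'" and f: "f \<in> sheaf_hom KR X G G'"
begin

private lemma PP: "presheaf KR X G" "presheaf KR X G'" using G G' by (auto intro: sheaf_presheaf)

lemma phi_map_unit:
  assumes "openin X U" "t \<in> carrier (tensor L K (sec G U))"
  shows "phi_map G G' f U (phi_unit G U t) = phi_unit G' U (tensor_hom G' f U t)"
  using assms sheaf_bij_closed[OF ext_sheaf_bij[OF G] assms(1), of t]
  by (simp add: PhiG_map_def phi_unit_def transport_map_apply e_inj[OF G] ext_map_unit[OF PP f])

lemma phi_map_mk_hom: "mk_hom X (phi_sheaf G) (phi_map G G' f) = phi_map G G' f"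
  by (simp add: PhiG_def PhiG_map_def transport_map_mk_hom)

lemma tensor_hom_gal:
  assumes U: "openin X U" and g: "g \<in> Gal" and t: "t \<in> carrier (tensor L K (sec G U))"
  shows "tensor_gal G' g U (tensor_hom G' f U t) = tensor_hom G' f U (tensor_gal G g U t)"
proof -
  interpret U: galois_space L K "sec G U" by (rule space_sec[OF PP(1) U])
  interpret U': galois_space L K "sec G' U" by (rule space_sec[OF PP(2) U])
  note tl = tensor_hom_linear[OF PP f U] and tt = tensor_hom_tens[OF PP f U]
  show ?thesis unfolding tensor_gal_def using t
    by (induction rule: U.tensor_induct)
       (simp_all add: g tt U.gal_tensor_tens U'.gal_tensor_tens sheaf_hom_closed[OF f U]
         linear_maps_add[OF tl] linear_maps_closed[OF tl] U.gal_tensor_add U'.gal_tensor_add U.gal_tensor_closed)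
qed

lemma phi_map_mor: "phi_map G G' f \<in> mor (ShModG L K X) (PhiG L K X e G) (PhiG L K X e G')"
proof -
  note b = phi_bij[OF G] and b' = phi_bij[OF G']
  have hom: "phi_map G G' f \<in> sheaf_hom L X (phi_sheaf G) (phi_sheaf G')"
    by (rule hom_of_models[OF pre_ext_presheaf[OF PP(1)] b b' tensor_hom_sheaf_hom[OF PP f] phi_map_mk_hom])
       (simp add: phi_map_unit)
  have "phi_act G' g U (phi_map G G' f U u) = phi_map G G' f U (phi_act G g U u)"
    if g: "g \<in> Gal" and U: "openin X U" and u: "u \<in> carrier (sec (phi_sheaf G) U)" for g U u
  proof -
    obtain t where t: "t \<in> carrier (tensor L K (sec G U))" "u = phi_unit G U t"
      using sheaf_bij_surj[OF b U u] by auto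
    then show ?thesis
      using U g linear_maps_closed[OF tensor_hom_linear[OF PP f U]]
      by (simp add: phi_map_unit phi_act_unit[OF G] phi_act_unit[OF G'] tensor_gal_closed[OF PP(1)] tensor_hom_gal)
  qed
  then show ?thesis using hom ShModG_mor[of _ X "phi_sheaf G" "phi_act G" "phi_sheaf G'" "phi_act G'"] by simp
qed

end

lemma PhiG_cmp: "cmp (ShModG L K X) (PhiG L K X e G) B C g f = sheaf_comp X (phi_sheaf G) g f"
  using ShModG_cmp[of X "phi_sheaf G" "phi_act G"] by simp

lemma PhiG_ident: "ident (ShModG L K X) (PhiG L K X e G) = sheaf_id X (phi_sheaf G)"
  using ShModG_ident[of X "phi_sheaf G" "phi_act G"] by simp

lemma phi_functor:
  "is_functor (ShMod KR X) (ShModG L K X) (PhiG L K X e) phi_map"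
  unfolding is_functor_def
proof (intro conjI ballI)
  fix G :: "('a, 'x, 'u) sheaf_data" assume "G \<in> ob (ShMod KR X)"
  then have G: "sheaf KR X G" by (simp add: ShMod_def)
  note P = sheaf_presheaf[OF G]
  show "PhiG L K X e G \<in> ob (ShModG L K X)" by (rule phi_ob[OF G])
  have idh: "sheaf_id X G \<in> sheaf_hom KR X G G" by (rule sheaf_id_hom[OF P])
  have "tensor_hom G (sheaf_id X G) U t = t" if U: "openin X U" and t: "t \<in> carrier (tensor L K (sec G U))" for U t
  proof -
    interpret U: galois_space L K "sec G U" by (rule space_sec[OF P U])
    show ?thesis using t
      by (induction rule: U.tensor_induct)
         (simp_all add: tensor_hom_tens[OF P P idh U] sheaf_id_apply U linear_maps_add[OF tensor_hom_linear[OF P P idh U]])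
  qed
  then have "mk_hom X (phi_sheaf G) (phi_map G G (sheaf_id X G)) = mk_hom X (phi_sheaf G) (\<lambda>U s. s)"
    by (intro mk_hom_model_eqI[OF phi_bij[OF G]]) (simp add: phi_map_unit[OF G G idh])
  then show "phi_map G G (ident (ShMod KR X) G) = ident (ShModG L K X) (PhiG L K X e G)"
    by (simp add: PhiG_ident phi_map_mk_hom[OF G G idh] sheaf_id_mk_hom[symmetric] ShMod_def)
  fix G' :: "('a, 'x, 'u) sheaf_data" and f assume "G' \<in> ob (ShMod KR X)" "f \<in> mor (ShMod KR X) G G'"
  then have G': "sheaf KR X G'" and f: "f \<in> sheaf_hom KR X G G'" by (simp_all add: ShMod_def)
  note P' = sheaf_presheaf[OF G']
  show "phi_map G G' f \<in> mor (ShModG L K X) (PhiG L K X e G) (PhiG L K X e G')"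
    by (rule phi_map_mor[OF G G' f])
  fix G'' :: "('a, 'x, 'u) sheaf_data" and g assume "G'' \<in> ob (ShMod KR X)" "g \<in> mor (ShMod KR X) G' G''"
  then have G'': "sheaf KR X G''" and g: "g \<in> sheaf_hom KR X G' G''" by (simp_all add: ShMod_def)
  note P'' = sheaf_presheaf[OF G'']
  let ?c = "sheaf_comp X G g f"
  have c: "?c \<in> sheaf_hom KR X G G''" by (rule sheaf_comp_hom[OF P f g])
  have th: "tensor_hom G'' ?c U t = tensor_hom G'' g U (tensor_hom G' f U t)"
    and tc: "tensor_hom G' f U t \<in> carrier (tensor L K (sec G' U))"
    if U: "openin X U" and t: "t \<in> carrier (tensor L K (sec G U))" for U t
  proof -
    interpret U: galois_space L K "sec G U" by (rule space_sec[OF P U])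
    note tf = tensor_hom_linear[OF P P' f U] and tg = tensor_hom_linear[OF P' P'' g U]
      and tc = tensor_hom_linear[OF P P'' c U]
    show "tensor_hom G'' ?c U t = tensor_hom G'' g U (tensor_hom G' f U t)" using t
      by (induction rule: U.tensor_induct)
         (simp_all add: tensor_hom_tens[OF P P' f U] tensor_hom_tens[OF P' P'' g U] tensor_hom_tens[OF P P'' c U]
           sheaf_comp_apply U sheaf_hom_closed[OF f U] linear_maps_add[OF tf] linear_maps_add[OF tg]
           linear_maps_add[OF tc] linear_maps_closed[OF tf])
    show "tensor_hom G' f U t \<in> carrier (tensor L K (sec G' U))" using linear_maps_closed[OF tf t] .
  qed
  have "mk_hom X (phi_sheaf G) (phi_map G G'' ?c)
      = mk_hom X (phi_sheaf G) (\<lambda>U s. phi_map G' G'' g U (phi_map G G' f U s))"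
    by (rule mk_hom_model_eqI[OF phi_bij[OF G]])
       (simp add: phi_map_unit[OF G G' f] phi_map_unit[OF G' G'' g] phi_map_unit[OF G G'' c] th tc)
  then show "phi_map G G'' (cmp (ShMod KR X) G G' G'' g f)
      = cmp (ShModG L K X) (PhiG L K X e G) (PhiG L K X e G') (PhiG L K X e G'') (phi_map G' G'' g) (phi_map G G' f)"
    unfolding phi_map_mk_hom[OF G G'' c] by (simp add: PhiG_cmp ShMod_def sheaf_comp_mk_hom[of X "phi_sheaf G"])
qed

abbreviation "inv_ob \<equiv> \<lambda>(F, \<phi>). inv_sheaf F \<phi>"

lemma inv_ob_PhiG: "inv_ob (PhiG L K X e G) = inv_sheaf (phi_sheaf G) (phi_act G)"
  by (simp add: case_prod_beta)

definition unit_iso :: "('a, 'x, 'u) sheaf_data \<Rightarrow> 'x set \<Rightarrow> 'u \<Rightarrow> 'u" where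
  "unit_iso G = mk_hom X G (\<lambda>U s. phi_unit G U (tens L K (sec G U) \<one> s))"

text \<open>Injectivity and surjectivity onto the invariants both come from the functional \<open>tr(c _) \<otimes> id\<close> with
  \<open>tr c = 1\<close>: it is a left inverse of \<open>s \<mapsto> 1 \<otimes> s\<close>, and on invariant tensors a right inverse.\<close>

lemma unit_iso_iso:
  assumes G: "sheaf KR X G"
  shows "unit_iso G \<in> sheaf_iso KR X G (inv_sheaf (phi_sheaf G) (phi_act G))"
proof -
  let ?I = "inv_sheaf (phi_sheaf G) (phi_act G)"
  note P = sheaf_presheaf[OF G] and b = phi_bij[OF G]
  note A = phi_sheaf[OF G] phi_G_structure[OF G]
  note S = inv_sheaf_sheaf[OF A]
  have tens_inv: "phi_unit G U (tens L K (sec G U) \<one> s) \<in> carrier (sec ?I U)"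
    if U: "openin X U" and s: "s \<in> carrier (sec G U)" for U s
  proof -
    interpret U: galois_space L K "sec G U" by (rule space_sec[OF P U])
    have t: "tens L K (sec G U) \<one> s \<in> carrier U.T" using s by (simp add: U.tens_closed)
    have "tensor_gal G g U (tens L K (sec G U) \<one> s) = tens L K (sec G U) \<one> s" if "g \<in> Gal" for g
      using s that by (simp add: tensor_gal_def U.gal_tensor_tens ring_hom_one[OF gal_hom])
    then show ?thesis using t sheaf_bij_closed[OF b U, of "tens L K (sec G U) \<one> s"]
      by (simp add: inv_sheaf_carrier[OF A U] phi_act_unit[OF G _ U])
  qed
  have hom: "unit_iso G \<in> sheaf_hom KR X G ?I"
    unfolding unit_iso_def
  proof (rule sheaf_homI[OF _ _ _ _ P])
    fix U s assume U: "openin X U" and s: "s \<in> carrier (sec G U)"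
    interpret U: galois_space L K "sec G U" by (rule space_sec[OF P U])
    show "phi_unit G U (tens L K (sec G U) \<one> s) \<in> carrier (sec ?I U)"
      by (rule tens_inv[OF U s])
    have t: "tens L K (sec G U) \<one> s' \<in> carrier U.T" if "s' \<in> carrier (sec G U)" for s'
      using that by (simp add: U.tens_closed)
    { fix a assume a: "a \<in> carrier KR"
      then have aL: "a \<in> carrier L" "a \<in> K" using K_closed by auto
      have "tens L K (sec G U) \<one> (a \<odot>\<^bsub>sec G U\<^esub> s) = a \<odot>\<^bsub>U.T\<^esub> tens L K (sec G U) \<one> s"
        using aL s U.tens_balanced[of \<one> a s] by (simp add: U.smult_tens)
      then show "phi_unit G U (tens L K (sec G U) \<one> (a \<odot>\<^bsub>sec G U\<^esub> s))
          = a \<odot>\<^bsub>sec ?I U\<^esub> phi_unit G U (tens L K (sec G U) \<one> s)"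
        using sheaf_bij_smult[OF b U aL(1)] t[OF s] by (simp add: inv_sheaf_ops[OF A U]) }
    { fix V assume V: "openin X V" "V \<subseteq> U"
      then show "phi_unit G V (tens L K (sec G V) \<one> (res G U V s))
          = res ?I U V (phi_unit G U (tens L K (sec G U) \<one> s))"
        using sheaf_bij_res[OF b U V, of "tens L K (sec G U) \<one> s"] t[OF s] s
        by (simp add: inv_sheaf_ops[OF A U] pre_ext_res_tens[OF P U V]) }
    fix s' assume s': "s' \<in> carrier (sec G U)"
    show "phi_unit G U (tens L K (sec G U) \<one> (s \<oplus>\<^bsub>sec G U\<^esub> s'))
        = phi_unit G U (tens L K (sec G U) \<one> s) \<oplus>\<^bsub>sec ?I U\<^esub>
          phi_unit G U (tens L K (sec G U) \<one> s')"
      using sheaf_bij_add[OF b U] t[OF s] t[OF s'] s s' by (simp add: inv_sheaf_ops[OF A U] U.tens_add_right)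
  qed
  show ?thesis
  proof (rule sheaf_isoI[OF P sheaf_presheaf[OF S] hom], rule bij_betw_imageI)
    fix U assume U: "openin X U"
    interpret U: galois_space L K "sec G U" by (rule space_sec[OF P U])
    have t: "tens L K (sec G U) \<one> s \<in> carrier U.T" if "s \<in> carrier (sec G U)" for s
      using that by (simp add: U.tens_closed)
    show "inj_on (unit_iso G U) (carrier (sec G U))"
    proof (rule inj_onI)
      fix s s' assume s: "s \<in> carrier (sec G U)" "s' \<in> carrier (sec G U)" and "unit_iso G U s = unit_iso G U s'"
      then have "tens L K (sec G U) \<one> s = tens L K (sec G U) \<one> s'"
        using sheaf_bij_inj[OF b U] t U by (simp add: unit_iso_def)
      then show "s = s'" using U.tr_func_tens_one s by metis
    qed
    show "unit_iso G U ` carrier (sec G U) = carrier (sec ?I U)"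
    proof (intro equalityI subsetI)
      fix u assume "u \<in> unit_iso G U ` carrier (sec G U)"
      then show "u \<in> carrier (sec ?I U)"
        using tens_inv[OF U] U by (auto simp: unit_iso_def)
    next
      fix u assume "u \<in> carrier (sec ?I U)"
      then have u: "u \<in> carrier (sec (phi_sheaf G) U)" "\<And>g. g \<in> Gal \<Longrightarrow> phi_act G g U u = u"
        by (auto simp: inv_sheaf_carrier[OF A U])
      obtain t where t: "t \<in> carrier U.T" "u = phi_unit G U t" using sheaf_bij_surj[OF b U u(1)] by auto
      have "U.gal_tensor g t = t" if g: "g \<in> Gal" for g
      proof (rule sheaf_bij_inj[OF b U])
        show "phi_unit G U (U.gal_tensor g t) = phi_unit G U t"
          using phi_act_unit[OF G g U t(1)] u(2)[OF g] t(2) by (simp add: tensor_gal_def)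
      qed (use t(1) U.gal_tensor_closed[OF g] in auto)
      then have "tens L K (sec G U) \<one> (U.tr_func unit_trace t) = t"
        by (rule U.gal_invariant_tensor[OF t(1)])
      moreover have "U.tr_func unit_trace t \<in> carrier (sec G U)"
        by (rule U.tr_func_closed[OF unit_trace(1) t(1)])
      ultimately show "u \<in> unit_iso G U ` carrier (sec G U)"
        using t(2) U by (intro image_eqI[where x = "U.tr_func unit_trace t"]) (simp_all add: unit_iso_def)
    qed
  qed
qed

lemma unit_iso_natural:
  assumes G: "sheaf KR X G" and G': "sheaf KR X G'" and f: "f \<in> sheaf_hom KR X G G'"
  shows "sheaf_comp X G (unit_iso G') f = sheaf_comp X G (inv_hom X (PhiG L K X e G) (phi_map G G' f)) (unit_iso G)"
proof -
  note P = sheaf_presheaf[OF G] and P' = sheaf_presheaf[OF G']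
  show ?thesis unfolding sheaf_comp_mk_hom
  proof (rule mk_hom_eqI)
    fix U s assume U: "openin X U" and s: "s \<in> carrier (sec G U)"
    interpret U: galois_space L K "sec G U" by (rule space_sec[OF P U])
    have t: "tens L K (sec G U) \<one> s \<in> carrier U.T" using s by (simp add: U.tens_closed)
    have "unit_iso G U s \<in> carrier (sec (inv_sheaf (phi_sheaf G) (phi_act G)) U)"
      using sheaf_hom_closed[OF sheaf_iso_hom[OF unit_iso_iso[OF G]] U s] .
    then have "inv_hom X (PhiG L K X e G) (phi_map G G' f) U (unit_iso G U s) = phi_map G G' f U (unit_iso G U s)"
      using inv_hom_apply[OF U, of _ "phi_sheaf G" "phi_act G"] by simp
    also have "\<dots> = phi_unit G' U (tens L K (sec G' U) \<one> (f U s))"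
      using U s t by (simp add: unit_iso_def phi_map_unit[OF G G' f] tensor_hom_tens[OF P P' f])
    also have "\<dots> = unit_iso G' U (f U s)"
      using U sheaf_hom_closed[OF f U s] by (simp add: unit_iso_def)
    finally show "unit_iso G' U (f U s) = inv_hom X (PhiG L K X e G) (phi_map G G' f) U (unit_iso G U s)" by simp
  qed
qed

definition counit_iso :: "('a, 'x, 'u) sheaf_data \<times> (('a \<Rightarrow> 'a) \<Rightarrow> 'x set \<Rightarrow> 'u \<Rightarrow> 'u) \<Rightarrow> 'x set \<Rightarrow> 'u \<Rightarrow> 'u" where
  "counit_iso = (\<lambda>(F, \<phi>). descent_map X (phi_sheaf (inv_sheaf F \<phi>)) (phi_unit (inv_sheaf F \<phi>)) (F, \<phi>))"

lemma counit_iso_isomorphism: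
  assumes A: "(F, \<phi>) \<in> ob (ShModG L K X)"
  shows "is_isomorphism (ShModG L K X) (PhiG L K X e (inv_sheaf F \<phi>)) (F, \<phi>) (counit_iso (F, \<phi>))"
proof -
  have A': "sheaf L X F" "G_structure L K X F \<phi>" using A by (auto simp: ShModG_ob)
  note S = inv_sheaf_sheaf[OF A']
  note b = phi_bij[OF S]
  let ?G = "inv_sheaf F \<phi>"
  have iso: "counit_iso (F, \<phi>) \<in> sheaf_iso L X (phi_sheaf ?G) F"
    unfolding counit_iso_def prod.case by (rule descent_map_iso[OF A b])
  have "\<phi> g U (counit_iso (F, \<phi>) U u) = counit_iso (F, \<phi>) U (phi_act ?G g U u)"
    if g: "g \<in> Gal" and U: "openin X U" and u: "u \<in> carrier (sec (phi_sheaf ?G) U)" for g U u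
  proof -
    obtain t where "t \<in> carrier (tensor L K (sec ?G U))" "u = phi_unit ?G U t"
      using sheaf_bij_surj[OF b U u] by auto
    then show ?thesis
      by (simp add: counit_iso_def descent_map_act[OF A b g U] phi_act_unit[OF S g U])
  qed
  then have "counit_iso (F, \<phi>) \<in> mor (ShModG L K X) (phi_sheaf ?G, phi_act ?G) (F, \<phi>)"
    using sheaf_iso_hom[OF iso] unfolding ShModG_mor by blast
  then show ?thesis
    using is_isomorphism_ShModG[OF _ A _ iso, of "phi_act ?G"] phi_ob[OF S] by simp
qed

lemma counit_iso_natural:
  assumes A: "(F, \<phi>) \<in> ob (ShModG L K X)" and B: "(F', \<phi>') \<in> ob (ShModG L K X)"
    and f: "f \<in> mor (ShModG L K X) (F, \<phi>) (F', \<phi>')"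
  shows "sheaf_comp X (phi_sheaf (inv_sheaf F \<phi>)) (counit_iso (F', \<phi>'))
      (phi_map (inv_sheaf F \<phi>) (inv_sheaf F' \<phi>') (inv_hom X (F, \<phi>) f))
    = sheaf_comp X (phi_sheaf (inv_sheaf F \<phi>)) f (counit_iso (F, \<phi>))"
proof -
  have S: "sheaf KR X (inv_sheaf F \<phi>)" "sheaf KR X (inv_sheaf F' \<phi>')"
    using A B by (auto simp: ShModG_ob intro: inv_sheaf_sheaf)
  show ?thesis unfolding counit_iso_def prod.case
    by (rule descent_map_natural[OF A B f phi_bij[OF S(1)] phi_bij[OF S(2)]])
       (rule phi_map_unit[OF S inv_hom_in[OF A B f]])
qed

lemma phi_equivalence:
  "equivalence_of_categories (ShMod KR X) (ShModG L K X) (PhiG L K X e) phi_map"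
proof -
  have "natural_isomorphism (ShMod KR X) (ShMod KR X) (\<lambda>a. a) (\<lambda>a b f. f)
     (\<lambda>G. inv_ob (PhiG L K X e G)) (\<lambda>G G' f. inv_hom X (PhiG L K X e G) (phi_map G G' f)) unit_iso"
    unfolding natural_isomorphism_def inv_ob_PhiG
    using unit_iso_natural
    by (auto simp: ShMod_def intro!: is_isomorphism_ShMod[unfolded ShMod_def] unit_iso_iso)
  moreover have "natural_isomorphism (ShModG L K X) (ShModG L K X) (\<lambda>A. PhiG L K X e (inv_ob A))
     (\<lambda>A B f. phi_map (inv_ob A) (inv_ob B) (inv_hom X A f)) (\<lambda>a. a) (\<lambda>a b f. f) counit_iso"
    unfolding natural_isomorphism_def
  proof (intro conjI ballI; clarify?)
    fix F :: "('a, 'x, 'u) sheaf_data" and \<phi> assume A: "(F, \<phi>) \<in> ob (ShModG L K X)"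
    show "is_isomorphism (ShModG L K X) (PhiG L K X e (inv_sheaf F \<phi>)) (F, \<phi>) (counit_iso (F, \<phi>))"
      by (rule counit_iso_isomorphism[OF A])
    fix F' :: "('a, 'x, 'u) sheaf_data" and \<phi>' f assume "(F', \<phi>') \<in> ob (ShModG L K X)" "f \<in> mor (ShModG L K X) (F, \<phi>) (F', \<phi>')"
    then show "cmp (ShModG L K X) (PhiG L K X e (inv_sheaf F \<phi>)) (PhiG L K X e (inv_sheaf F' \<phi>')) (F', \<phi>')
        (counit_iso (F', \<phi>')) (phi_map (inv_sheaf F \<phi>) (inv_sheaf F' \<phi>') (inv_hom X (F, \<phi>) f))
      = cmp (ShModG L K X) (PhiG L K X e (inv_sheaf F \<phi>)) (F, \<phi>) (F', \<phi>') f (counit_iso (F, \<phi>))"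
      unfolding PhiG_cmp by (rule counit_iso_natural[OF A])
  qed
  ultimately show ?thesis
    unfolding equivalence_of_categories_def
    using is_category_ShMod is_category_ShModG phi_functor inv_functor by blast
qed

end

end

theorem proposition5p1:
  fixes L :: "('l, 'm) ring_scheme" and K :: "'l set" and X :: "'x topology"
  assumes "finite_galois_extension L K"
    and "good_space TYPE('u) X"
  shows
    "(\<forall>(F :: ('l, 'x, 'u) sheaf_data) \<phi>. sheaf L X F \<and> G_structure L K X F \<phi> \<longrightarrow>
        (\<exists>(G :: ('l, 'x, 'u) sheaf_data) \<psi>. sheaf (L\<lparr>carrier := K\<rparr>) X G \<and>
           \<psi> \<in> sheaf_iso L X (ext L K X G) F \<and>
           (\<forall>g\<in>galois_group L K.
              sheaf_comp X (ext L K X G) (\<phi> g) \<psi>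
                = sheaf_comp X (ext L K X G) (twist_mor g \<psi>) (ext_act L K X G g))))
     \<and>
     (\<exists>(\<Gamma> :: ('l, 'x, 'u) sheaf_data \<times> _ \<Rightarrow> ('l, 'x, 'u) sheaf_data) \<Gamma>m \<psi>.
        is_functor (ShModG L K X) (ShMod (L\<lparr>carrier := K\<rparr>) X) \<Gamma> \<Gamma>m \<and>
        (\<forall>(F, \<phi>)\<in>ob (ShModG L K X).
           \<psi> (F, \<phi>) \<in> sheaf_iso L X (ext L K X (\<Gamma> (F, \<phi>))) F \<and>
           (\<forall>g\<in>galois_group L K.
              sheaf_comp X (ext L K X (\<Gamma> (F, \<phi>))) (\<phi> g) (\<psi> (F, \<phi>))
                = sheaf_comp X (ext L K X (\<Gamma> (F, \<phi>))) (twist_mor g (\<psi> (F, \<phi>)))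
                    (ext_act L K X (\<Gamma> (F, \<phi>)) g))) \<and>
        (\<forall>A\<in>ob (ShModG L K X). \<forall>B\<in>ob (ShModG L K X). \<forall>f\<in>mor (ShModG L K X) A B.
           sheaf_comp X (ext L K X (\<Gamma> A)) (\<psi> B) (ext_map L K X (\<Gamma> A) (\<Gamma> B) (\<Gamma>m A B f))
             = sheaf_comp X (ext L K X (\<Gamma> A)) f (\<psi> A)))
     \<and>
     (\<forall>e :: ('l, 'x, 'u) sheaf_data \<Rightarrow> 'x set \<Rightarrow> ('l, 'x, 'u) tensor_section \<Rightarrow> 'u.
        universe_embedding L K X e \<longrightarrow>
        equivalence_of_categories (ShMod (L\<lparr>carrier := K\<rparr>) X) (ShModG L K X)
          (PhiG L K X e) (PhiG_map L K X e))"
proof -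
  interpret galois L K
    using assms(1) by (intro galois.intro galois_axioms.intro) (simp_all add: finite_galois_extension_def)
  show ?thesis
  proof (intro conjI allI impI, goal_cases)
    case (1 F \<phi>)
    then have F: "sheaf L X F" "G_structure L K X F \<phi>" and A: "(F, \<phi>) \<in> ob (ShModG L K X)"
      by (simp_all add: ShModG_ob)
    show ?case
      using inv_sheaf_sheaf[OF F] ext_descent_iso[OF A] ext_descent_act[OF A] unfolding twist_mor_def by blast
  next
    case 2
    show ?case
      by (rule exI[of _ "\<lambda>(F, \<phi>). inv_sheaf F \<phi>"], rule exI[of _ "\<lambda>A B. inv_hom X A"],
          rule exI[of _ "ext_descent X"])
         (auto simp: twist_mor_def inv_functor ext_descent_iso ext_descent_act ext_descent_natural)
  next
    case (3 e)
    then show ?case by (rule phi_equivalence)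
  qed
qed

end
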